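(* Let $\lambda$ be a cardinal with $\lambda\ge\omega_3$, and assume that there is an $\omega_1$-strongly unbounded function on $\lambda$. Then in some c.c.c. generic extension there is a $\langle\omega\rangle_{\omega_1}{}^\frown\langle\lambda\rangle$-poset which is an $\omega_1$-skeleton.
   Context: A function $F:[\lambda]^2\to\omega_1$ is $\omega_1$-strongly unbounded on $\lambda$ if for every $\delta<\omega_1$, every $n<\omega$ and every family $A\subseteq[\lambda]^n$ of pairwise disjoint sets with $|A|=\omega_1$, there are distinct $a,b\in A$ with $F\{\alpha,\beta\}>\delta$ for all $\alpha\in a,\beta\in b$. For a sequence $\mathfrak s=\langle\kappa_\alpha:\alpha<\delta\rangle$ of infinite cardinals, an $\mathfrak s$-poset is a poset $\langle T,\preceq\rangle$ with: (1) $T=\bigcup_{\alpha<\delta}T_\alpha$, $T_\alpha=\{\alpha\}\times\kappa_\alpha$; (2) if $s\in T_\alpha$, $t\in T_\beta$ and $s\prec t$ then $\alpha<\beta$; (3) for every $\{s,t\}\in[T]^2$ there is a finite $i\{s,t\}\subseteq T$ such that for all $u\in T$: $u\preceq s\wedge u\preceq t$ iff $u\preceq v$ for some $v\in i\{s,t\}$; (4) for $\alpha<\beta<\delta$ and $t\in T_\beta$, the set $\{s\in T_\alpha:s\prec t\}$ is infinite. If $\mathfrak s=\langle\kappa\rangle_\mu{}^\frown\langle\lambda\rangle$ with $\kappa<\lambda$ and $\mu>0$, a level $T_\gamma$ ($\gamma<\mu$) is a bone level if (1) distinct $s,t\in T_\gamma$ have no common lower bound, and (2) if $x\in T_{\gamma+1}$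 and $y\prec x$ then there is $z\in T_\gamma$ with $y\preceq z\prec x$. The $\mathfrak s$-poset is a $\mu$-skeleton if every $T_\gamma$, $\gamma<\mu$, is a bone level. *)

theory Defs
  imports Main "HOL-Library.Ramsey" "HOL-Library.Countable_Set"
begin

unbundle cardinal_syntax

section \<open>Strongly unbounded functions in the ground model\<close>

text \<open>The ground model is the ambient logic. A cardinal is a relation satisfying
  \<^const>\<open>Card_order\<close>, its elements being the members of its field.\<close>

abbreviation omega1 :: "nat set rel" where
  "omega1 \<equiv> cardSuc natLeq"

abbreviation omega3 :: "nat set set set rel" where
  "omega3 \<equiv> cardSuc (cardSuc omega1)"

definition strongly_unbounded :: "'a rel \<Rightarrow> ('a set \<Rightarrow> nat set) \<Rightarrow> bool" where
  "strongly_unbounded lam F \<longleftrightarrow>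
     F ` nsets (Field lam) 2 \<subseteq> Field omega1 \<and>
     (\<forall>d \<in> Field omega1. \<forall>n. \<forall>A.
        A \<subseteq> nsets (Field lam) n \<and> pairwise disjnt A \<and> |A| =o omega1 \<longrightarrow>
        (\<exists>a\<in>A. \<exists>b\<in>A. a \<noteq> b \<and>
           (\<forall>x\<in>a. \<forall>y\<in>b. (d, F {x, y}) \<in> omega1 \<and> d \<noteq> F {x, y})))"


section \<open>Forcing notions\<close>

text \<open>\<open>(q, p) \<in> P\<close> means that \<open>q\<close> is a stronger condition than \<open>p\<close> (or equal to it); the conditions
  are the members of \<open>Field P\<close>.\<close>

definition forcing_notion :: "'p rel \<Rightarrow> bool" where
  "forcing_notion P \<longleftrightarrow> Partial_order P \<and> Field P \<noteq> {}"

definition compatible :: "'p rel \<Rightarrow> 'p \<Rightarrow> 'p \<Rightarrow> bool" where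
  "compatible P p q \<longleftrightarrow> (\<exists>r. (r, p) \<in> P \<and> (r, q) \<in> P)"

definition ccc :: "'p rel \<Rightarrow> bool" where
  "ccc P \<longleftrightarrow> (\<forall>A \<subseteq> Field P. pairwise (\<lambda>p q. \<not> compatible P p q) A \<longrightarrow> countable A)"

definition dense_below :: "'p rel \<Rightarrow> 'p \<Rightarrow> 'p set \<Rightarrow> bool" where
  "dense_below P p D \<longleftrightarrow> (\<forall>q. (q, p) \<in> P \<longrightarrow> (\<exists>r. (r, q) \<in> P \<and> r \<in> D))"


section \<open>Names\<close>

text \<open>A name is a set of pairs (name, condition). Since there is no datatype of arbitrarily large
  sets, the type bounds the size of a name by that of an index type \<open>'i\<close>: a name is a family, indexed
  by part of \<open>'i\<close>, of such pairs. For a ccc forcing \<open>P\<close> with \<open>|P| \<le> \<kappa> = |'i|\<close> the names of type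
  \<open>('i, 'p) name\<close> are names for exactly the members of \<open>H(\<kappa>\<^sup>+)\<close> of the generic extension.\<close>

datatype ('i, 'p) name = Name "'i \<Rightarrow> (('i, 'p) name \<times> 'p) option"

primrec elts :: "('i, 'p) name \<Rightarrow> (('i, 'p) name \<times> 'p) set" where
  "elts (Name f) = ran f"

text \<open>Some name with the given set of pairs; it exists if the set is no larger than \<open>'i\<close>.\<close>

definition mk_name :: "(('i, 'p) name \<times> 'p) set \<Rightarrow> ('i, 'p) name" where
  "mk_name S = (SOME x. elts x = S)"

lemma elts_mk_name:
  fixes S :: "(('i, 'p) name \<times> 'p) set"
  assumes "|S| \<le>o |UNIV :: 'i set|"
  shows "elts (mk_name S) = S"
proof -
  obtain g where g: "inj_on g S" "g ` S \<subseteq> (UNIV :: 'i set)"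
    using assms card_of_ordLeq by metis
  define f where "f i = (if i \<in> g ` S then Some (the_inv_into S g i) else None)" for i
  have "ran f = S"
  proof (intro set_eqI iffI)
    fix u assume "u \<in> ran f"
    then obtain i where "f i = Some u" by (auto simp: ran_def)
    then show "u \<in> S" using g(1) by (auto simp: f_def the_inv_into_f_f split: if_splits)
  next
    fix u assume "u \<in> S"
    then have "f (g u) = Some u" using g(1) by (auto simp: f_def the_inv_into_f_f)
    then show "u \<in> ran f" by (rule ranI)
  qed
  then have "elts (Name f) = S" by simp
  then show ?thesis unfolding mk_name_def by (rule someI)
qed

lemma wf_subname: "wf {(x, y). x \<in> fst ` elts y}"
proof (rule wfUNIVI)
  fix Q :: "('a, 'b) name \<Rightarrow> bool" and x
  assume step: "\<forall>x. (\<forall>y. (y, x) \<in> {(x, y). x \<in> fst ` elts y} \<longrightarrow> Q y) \<longrightarrow> Q x"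
  show "Q x"
  proof (induction x)
    case (Name f)
    have "Q y" if "y \<in> fst ` ran f" for y
    proof -
      from that obtain p i where i: "f i = Some (y, p)"
        by (auto simp: ran_def)
      then show ?thesis
        by (intro Name.IH[of "f i" "(y, p)" y]) (auto intro: rangeI[of f i, unfolded i])
    qed
    then show ?case using step[rule_format, of "Name f"] by simp
  qed
qed

text \<open>The canonical name of the ordinal that is the order type of a well-order \<open>r\<close>: its members are
  the canonical names of the order types of the proper initial segments.\<close>

definition check_elem :: "'p rel \<Rightarrow> 'a rel \<Rightarrow> 'a \<Rightarrow> ('i, 'p) name" where
  "check_elem P r = wfrec (r - Id) (\<lambda>c a. mk_name (c ` underS r a \<times> Field P))"

definition check_ordinal :: "'p rel \<Rightarrow> 'a rel \<Rightarrow> ('i, 'p) name" where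
  "check_ordinal P r = mk_name (check_elem P r ` Field r \<times> Field P)"

lemma check_elem_unfold:
  fixes P :: "'p rel" and r :: "'a rel"
  assumes "Well_order r"
  shows "(check_elem P r a :: ('i, 'p) name) = mk_name (check_elem P r ` underS r a \<times> Field P)"
proof -
  let ?G = "\<lambda>c a. mk_name (c ` underS r a \<times> Field P) :: ('i, 'p) name"
  have "wf (r - Id)" using assms by (simp add: well_order_on_def)
  then have "wfrec (r - Id) ?G a = ?G (cut (wfrec (r - Id) ?G) (r - Id) a) a"
    by (rule wfrec)
  moreover have "cut (wfrec (r - Id) ?G) (r - Id) a ` underS r a = wfrec (r - Id) ?G ` underS r a"
    by (intro image_cong) (auto simp: cut_def underS_def)
  ultimately show ?thesis
    unfolding check_elem_def by simp
qed


section \<open>Formulas of set theory\<close>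

text \<open>First-order formulas with parameters from \<open>'n\<close>, quantifiers ranging over \<open>'n\<close>. All formulas
  below are defined uniformly in \<open>'n\<close>.\<close>

datatype 'n fm =
    Mem 'n 'n  (infix \<open>\<^bold>\<in>\<close> 50)
  | Eql 'n 'n  (infix \<open>\<^bold>=\<close> 50)
  | Neg "'n fm"  (\<open>\<^bold>\<not> _\<close> [40] 40)
  | Conj "'n fm" "'n fm"  (infixr \<open>\<^bold>\<and>\<close> 35)
  | Forall "'n \<Rightarrow> 'n fm"  (binder \<open>\<^bold>\<forall>\<close> 10)

definition Disj :: "'n fm \<Rightarrow> 'n fm \<Rightarrow> 'n fm"  (infixr \<open>\<^bold>\<or>\<close> 30) where
  "(A \<^bold>\<or> B) = (\<^bold>\<not> (\<^bold>\<not> A \<^bold>\<and> \<^bold>\<not> B))"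

definition Imp :: "'n fm \<Rightarrow> 'n fm \<Rightarrow> 'n fm"  (infixr \<open>\<^bold>\<longrightarrow>\<close> 25) where
  "(A \<^bold>\<longrightarrow> B) = (\<^bold>\<not> (A \<^bold>\<and> \<^bold>\<not> B))"

definition Equ :: "'n fm \<Rightarrow> 'n fm \<Rightarrow> 'n fm"  (infixr \<open>\<^bold>\<longleftrightarrow>\<close> 25) where
  "(A \<^bold>\<longleftrightarrow> B) = ((A \<^bold>\<longrightarrow> B) \<^bold>\<and> (B \<^bold>\<longrightarrow> A))"

definition Exists :: "('n \<Rightarrow> 'n fm) \<Rightarrow> 'n fm"  (binder \<open>\<^bold>\<exists>\<close> 10) where
  "(\<^bold>\<exists>x. A x) = (\<^bold>\<not> (\<^bold>\<forall>x. \<^bold>\<not> A x))"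

definition AllIn :: "'n \<Rightarrow> ('n \<Rightarrow> 'n fm) \<Rightarrow> 'n fm" where
  "AllIn a A = (\<^bold>\<forall>x. x \<^bold>\<in> a \<^bold>\<longrightarrow> A x)"

definition ExIn :: "'n \<Rightarrow> ('n \<Rightarrow> 'n fm) \<Rightarrow> 'n fm" where
  "ExIn a A = (\<^bold>\<exists>x. x \<^bold>\<in> a \<^bold>\<and> A x)"


section \<open>The forcing relation\<close>

text \<open>The clause for equality has the usual clause for membership substituted into it; see
  \<open>forces_eq_iff_mem\<close> below.\<close>

function forces_eq :: "'p rel \<Rightarrow> ('i, 'p) name \<Rightarrow> ('i, 'p) name \<Rightarrow> 'p \<Rightarrow> bool" where
  "forces_eq P x y p \<longleftrightarrow>
     (\<forall>u \<in> elts x. \<forall>q. (q, p) \<in> P \<and> (q, snd u) \<in> P \<longrightarrow>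
        dense_below P q {r. \<exists>v \<in> elts y. (r, snd v) \<in> P \<and> forces_eq P (fst u) (fst v) r}) \<and>
     (\<forall>v \<in> elts y. \<forall>q. (q, p) \<in> P \<and> (q, snd v) \<in> P \<longrightarrow>
        dense_below P q {r. \<exists>u \<in> elts x. (r, snd u) \<in> P \<and> forces_eq P (fst u) (fst v) r})"
  by pat_completeness auto
termination
  by (relation "inv_image {(x, y). x \<in> fst ` elts y} (\<lambda>(P, x, y, p). x)")
     (auto intro: wf_subname)

declare forces_eq.simps [simp del]

definition forces_mem :: "'p rel \<Rightarrow> ('i, 'p) name \<Rightarrow> ('i, 'p) name \<Rightarrow> 'p \<Rightarrow> bool" where
  "forces_mem P x y p \<longleftrightarrow>
     dense_below P p {r. \<exists>v \<in> elts y. (r, snd v) \<in> P \<and> forces_eq P x (fst v) r}"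

lemma forces_eq_sym: "forces_eq P x y p \<longleftrightarrow> forces_eq P y x p"
proof (induction x arbitrary: y p rule: wf_induct_rule[OF wf_subname])
  case (1 x)
  have IH: "forces_eq P (fst u) (fst v) r \<longleftrightarrow> forces_eq P (fst v) (fst u) r" if "u \<in> elts x" for u v r
    by (rule 1) (use that in simp)
  have 1: "{r. \<exists>v \<in> elts y. (r, snd v) \<in> P \<and> forces_eq P (fst u) (fst v) r} =
        {r. \<exists>v \<in> elts y. (r, snd v) \<in> P \<and> forces_eq P (fst v) (fst u) r}" if "u \<in> elts x" for u
    by (simp only: IH[OF that])
  have 2: "{r. \<exists>u \<in> elts x. (r, snd u) \<in> P \<and> forces_eq P (fst u) (fst v) r} =
        {r. \<exists>u \<in> elts x. (r, snd u) \<in> P \<and> forces_eq P (fst v) (fst u) r}" for v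
    by (intro Collect_cong bex_cong refl) (simp only: IH)
  show ?case
    unfolding forces_eq.simps[of P x y p] forces_eq.simps[of P y x p] 2
    by (simp only: 1 conj_commute cong: ball_cong)
qed

lemma forces_eq_iff_mem:
  "forces_eq P x y p \<longleftrightarrow>
     (\<forall>u \<in> elts x. \<forall>q. (q, p) \<in> P \<and> (q, snd u) \<in> P \<longrightarrow> forces_mem P (fst u) y q) \<and>
     (\<forall>v \<in> elts y. \<forall>q. (q, p) \<in> P \<and> (q, snd v) \<in> P \<longrightarrow> forces_mem P (fst v) x q)"
proof -
  have *: "{r. \<exists>u \<in> elts x. (r, snd u) \<in> P \<and> forces_eq P (fst u) (fst v) r} =
        {r. \<exists>u \<in> elts x. (r, snd u) \<in> P \<and> forces_eq P (fst v) (fst u) r}" for v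
    by (intro Collect_cong bex_cong refl arg_cong2[where f = "(\<and>)"] forces_eq_sym)
  show ?thesis
    unfolding forces_mem_def forces_eq.simps[of P x y p] * ..
qed

primrec forces :: "'p rel \<Rightarrow> ('i, 'p) name fm \<Rightarrow> 'p \<Rightarrow> bool" where
  "forces P (x \<^bold>\<in> y) = forces_mem P x y"
| "forces P (x \<^bold>= y) = forces_eq P x y"
| "forces P (\<^bold>\<not> A) = (\<lambda>p. \<forall>q. (q, p) \<in> P \<longrightarrow> \<not> forces P A q)"
| "forces P (A \<^bold>\<and> B) = (\<lambda>p. forces P A p \<and> forces P B p)"
| "forces P (Forall A) = (\<lambda>p. \<forall>x. forces P (A x) p)"

lemma forces_Exists:
  "forces P (\<^bold>\<exists>x. A x) p \<longleftrightarrow> dense_below P p {r. \<exists>x. forces P (A x) r}"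
  by (simp add: Exists_def dense_below_def) blast

lemma forces_Disj:
  "forces P (A \<^bold>\<or> B) p \<longleftrightarrow> dense_below P p {r. forces P A r \<or> forces P B r}"
  by (simp add: Disj_def dense_below_def) blast

lemma forces_Imp:
  "forces P (A \<^bold>\<longrightarrow> B) p \<longleftrightarrow>
     (\<forall>q. (q, p) \<in> P \<and> forces P A q \<longrightarrow> (\<exists>r. (r, q) \<in> P \<and> forces P B r))"
  by (auto simp: Imp_def)


section \<open>Elementary notions of set theory\<close>

definition fm_subset :: "'n \<Rightarrow> 'n \<Rightarrow> 'n fm" where
  "fm_subset x y = AllIn x (\<lambda>z. z \<^bold>\<in> y)"

definition fm_upair :: "'n \<Rightarrow> 'n \<Rightarrow> 'n \<Rightarrow> 'n fm" where  \<comment> \<open>\<open>z = {x, y}\<close>\<close>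
  "fm_upair z x y = (\<^bold>\<forall>w. w \<^bold>\<in> z \<^bold>\<longleftrightarrow> w \<^bold>= x \<^bold>\<or> w \<^bold>= y)"

definition fm_pair :: "'n \<Rightarrow> 'n \<Rightarrow> 'n \<Rightarrow> 'n fm" where  \<comment> \<open>\<open>z = {{x}, {x, y}}\<close>\<close>
  "fm_pair z x y = (\<^bold>\<exists>u v. fm_upair u x x \<^bold>\<and> fm_upair v x y \<^bold>\<and> fm_upair z u v)"

definition fm_rel :: "'n \<Rightarrow> 'n \<Rightarrow> 'n \<Rightarrow> 'n fm" where  \<comment> \<open>\<open>(x, y) \<in> R\<close>\<close>
  "fm_rel R x y = (\<^bold>\<exists>z. fm_pair z x y \<^bold>\<and> z \<^bold>\<in> R)"

definition fm_transitive :: "'n \<Rightarrow> 'n fm" where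
  "fm_transitive x = AllIn x (\<lambda>y. fm_subset y x)"

definition fm_ordinal :: "'n \<Rightarrow> 'n fm" where
  "fm_ordinal x = (fm_transitive x \<^bold>\<and> AllIn x fm_transitive)"

definition fm_succ :: "'n \<Rightarrow> 'n \<Rightarrow> 'n fm" where  \<comment> \<open>\<open>y = x \<union> {x}\<close>\<close>
  "fm_succ y x = (\<^bold>\<forall>z. z \<^bold>\<in> y \<^bold>\<longleftrightarrow> z \<^bold>\<in> x \<^bold>\<or> z \<^bold>= x)"

definition fm_empty :: "'n \<Rightarrow> 'n fm" where
  "fm_empty x = (\<^bold>\<forall>y. \<^bold>\<not> y \<^bold>\<in> x)"

definition fm_omega :: "'n \<Rightarrow> 'n fm" where  \<comment> \<open>the least nonzero limit ordinal\<close>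
  "fm_omega w = (fm_ordinal w \<^bold>\<and> \<^bold>\<not> fm_empty w \<^bold>\<and>
     AllIn w (\<lambda>x. ExIn w (\<lambda>y. fm_succ y x)) \<^bold>\<and>
     AllIn w (\<lambda>x. fm_empty x \<^bold>\<or> ExIn x (\<lambda>y. fm_succ x y)))"

definition fm_function_on :: "'n \<Rightarrow> 'n \<Rightarrow> 'n fm" where  \<comment> \<open>\<open>f\<close> is a function with domain \<open>x\<close>\<close>
  "fm_function_on f x =
     (AllIn f (\<lambda>z. ExIn x (\<lambda>a. \<^bold>\<exists>b. fm_pair z a b)) \<^bold>\<and>
      AllIn x (\<lambda>a. \<^bold>\<exists>b. fm_rel f a b \<^bold>\<and> (\<^bold>\<forall>c. fm_rel f a c \<^bold>\<longrightarrow> c \<^bold>= b)))"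

definition fm_injection :: "'n \<Rightarrow> 'n \<Rightarrow> 'n \<Rightarrow> 'n fm" where  \<comment> \<open>\<open>f\<close> is an injection from \<open>x\<close> to \<open>y\<close>\<close>
  "fm_injection f x y =
     (fm_function_on f x \<^bold>\<and>
      AllIn x (\<lambda>a. \<^bold>\<forall>b. fm_rel f a b \<^bold>\<longrightarrow> b \<^bold>\<in> y) \<^bold>\<and>
      AllIn x (\<lambda>a. AllIn x (\<lambda>a'. \<^bold>\<forall>b. fm_rel f a b \<^bold>\<and> fm_rel f a' b \<^bold>\<longrightarrow> a \<^bold>= a')))"

definition fm_cardinal :: "'n \<Rightarrow> 'n fm" where
  "fm_cardinal k = (fm_ordinal k \<^bold>\<and> AllIn k (\<lambda>a. \<^bold>\<not> (\<^bold>\<exists>f. fm_injection f k a)))"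

definition fm_finite :: "'n \<Rightarrow> 'n fm" where
  "fm_finite x = (\<^bold>\<exists>w. fm_omega w \<^bold>\<and> ExIn w (\<lambda>n. \<^bold>\<exists>f. fm_injection f x n))"

definition fm_infinite_cardinal :: "'n \<Rightarrow> 'n fm" where
  "fm_infinite_cardinal k = (fm_cardinal k \<^bold>\<and> \<^bold>\<not> fm_finite k)"

definition fm_omega1 :: "'n \<Rightarrow> 'n fm" where  \<comment> \<open>the least infinite cardinal greater than \<open>\<omega>\<close>\<close>
  "fm_omega1 k = (\<^bold>\<exists>w. fm_omega w \<^bold>\<and> fm_cardinal k \<^bold>\<and> w \<^bold>\<in> k \<^bold>\<and>
     AllIn k (\<lambda>a. fm_infinite_cardinal a \<^bold>\<longrightarrow> a \<^bold>= w))"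


section \<open>\<open>\<s>\<close>-posets and skeletons\<close>

text \<open>In this section \<open>s\<close> is a sequence of length \<open>d\<close>, \<open>T\<close> the underlying set and \<open>L\<close> the order.\<close>

definition fm_card_sequence :: "'n \<Rightarrow> 'n \<Rightarrow> 'n fm" where
  "fm_card_sequence s d = (fm_ordinal d \<^bold>\<and> fm_function_on s d \<^bold>\<and>
     AllIn d (\<lambda>a. \<^bold>\<forall>k. fm_rel s a k \<^bold>\<longrightarrow> fm_infinite_cardinal k))"

definition fm_level :: "'n \<Rightarrow> 'n \<Rightarrow> 'n \<Rightarrow> 'n fm" where  \<comment> \<open>\<open>t \<in> {a} \<times> s(a)\<close>\<close>
  "fm_level s a t = (\<^bold>\<exists>k. fm_rel s a k \<^bold>\<and> ExIn k (\<lambda>x. fm_pair t a x))"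

definition fm_less :: "'n \<Rightarrow> 'n \<Rightarrow> 'n \<Rightarrow> 'n fm" where
  "fm_less L x y = (fm_rel L x y \<^bold>\<and> \<^bold>\<not> x \<^bold>= y)"

definition fm_partial_order :: "'n \<Rightarrow> 'n \<Rightarrow> 'n fm" where
  "fm_partial_order T L =
     (AllIn L (\<lambda>z. ExIn T (\<lambda>x. ExIn T (\<lambda>y. fm_pair z x y))) \<^bold>\<and>
      AllIn T (\<lambda>x. fm_rel L x x) \<^bold>\<and>
      AllIn T (\<lambda>x. AllIn T (\<lambda>y. fm_rel L x y \<^bold>\<and> fm_rel L y x \<^bold>\<longrightarrow> x \<^bold>= y)) \<^bold>\<and>
      AllIn T (\<lambda>x. AllIn T (\<lambda>y. AllIn T (\<lambda>z.
        fm_rel L x y \<^bold>\<and> fm_rel L y z \<^bold>\<longrightarrow> fm_rel L x z))))"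

definition fm_s_poset :: "'n \<Rightarrow> 'n \<Rightarrow> 'n \<Rightarrow> 'n \<Rightarrow> 'n fm" where
  "fm_s_poset s d T L =
     (fm_card_sequence s d \<^bold>\<and> fm_partial_order T L \<^bold>\<and>
      (\<^bold>\<forall>t. t \<^bold>\<in> T \<^bold>\<longleftrightarrow> ExIn d (\<lambda>a. fm_level s a t)) \<^bold>\<and>
      AllIn d (\<lambda>a. AllIn d (\<lambda>b. \<^bold>\<forall>x y.
        fm_level s a x \<^bold>\<and> fm_level s b y \<^bold>\<and> fm_less L x y \<^bold>\<longrightarrow> a \<^bold>\<in> b)) \<^bold>\<and>
      AllIn T (\<lambda>x. AllIn T (\<lambda>y. \<^bold>\<not> x \<^bold>= y \<^bold>\<longrightarrow>
        (\<^bold>\<exists>I. fm_finite I \<^bold>\<and> fm_subset I T \<^bold>\<and>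
          AllIn T (\<lambda>u. (fm_rel L u x \<^bold>\<and> fm_rel L u y) \<^bold>\<longleftrightarrow> ExIn I (\<lambda>v. fm_rel L u v))))) \<^bold>\<and>
      AllIn d (\<lambda>b. AllIn b (\<lambda>a. \<^bold>\<forall>t. fm_level s b t \<^bold>\<longrightarrow>
        (\<^bold>\<exists>X. \<^bold>\<not> fm_finite X \<^bold>\<and>
          (\<^bold>\<forall>x. x \<^bold>\<in> X \<^bold>\<longleftrightarrow> fm_level s a x \<^bold>\<and> fm_less L x t)))))"

definition fm_const_snoc :: "'n \<Rightarrow> 'n \<Rightarrow> 'n \<Rightarrow> 'n \<Rightarrow> 'n \<Rightarrow> 'n fm" where
    \<comment> \<open>\<open>s\<close> is the constant sequence \<open>k\<close> of length \<open>m\<close> followed by \<open>l\<close>, its length being \<open>d\<close>\<close>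
  "fm_const_snoc s d k m l =
     (fm_ordinal m \<^bold>\<and> fm_succ d m \<^bold>\<and> fm_function_on s d \<^bold>\<and>
      AllIn m (\<lambda>a. fm_rel s a k) \<^bold>\<and> fm_rel s m l)"

definition fm_bone_level :: "'n \<Rightarrow> 'n \<Rightarrow> 'n \<Rightarrow> 'n \<Rightarrow> 'n fm" where
  "fm_bone_level s T L g =
     ((\<^bold>\<forall>x y. fm_level s g x \<^bold>\<and> fm_level s g y \<^bold>\<and> \<^bold>\<not> x \<^bold>= y \<^bold>\<longrightarrow>
        \<^bold>\<not> ExIn T (\<lambda>u. fm_rel L u x \<^bold>\<and> fm_rel L u y)) \<^bold>\<and>
      (\<^bold>\<forall>g' x. fm_succ g' g \<^bold>\<and> fm_level s g' x \<^bold>\<longrightarrow>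
        AllIn T (\<lambda>y. fm_less L y x \<^bold>\<longrightarrow>
          (\<^bold>\<exists>z. fm_level s g z \<^bold>\<and> fm_rel L y z \<^bold>\<and> fm_less L z x))))"

text \<open>\<open>(T, L)\<close> is a \<open>\<langle>k\<rangle>\<^sub>m\<^sup>\<frown>\<langle>l\<rangle>\<close>-poset which is an \<open>m\<close>-skeleton.\<close>

definition fm_skeleton :: "'n \<Rightarrow> 'n \<Rightarrow> 'n \<Rightarrow> 'n \<Rightarrow> 'n \<Rightarrow> 'n fm" where
  "fm_skeleton k m l T L =
     (k \<^bold>\<in> l \<^bold>\<and> \<^bold>\<not> fm_empty m \<^bold>\<and>
      (\<^bold>\<exists>s d. fm_const_snoc s d k m l \<^bold>\<and> fm_s_poset s d T L \<^bold>\<and>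
        AllIn m (fm_bone_level s T L)))"

definition fm_omega1_skeleton_exists :: "'n \<Rightarrow> 'n fm" where
  "fm_omega1_skeleton_exists l =
     (\<^bold>\<exists>k m T L. fm_omega k \<^bold>\<and> fm_omega1 m \<^bold>\<and> fm_skeleton k m l T L)"

end

theory Submission
  imports Defs
begin

text \<open>Write the levels as initial segments of \<open>lam\<close>: \<open>w\<close> and \<open>m\<close> are its elements of rank \<open>\<omega>\<close> and
  \<open>\<omega>\<^sub>1\<close>. A condition is a finite partial order on \<open>(m \<times> w) \<union> ({m} \<times> lam)\<close>, graded by the first
  coordinate, which already obeys the two bone level conditions and in which two elements \<open>x\<close>, \<open>y\<close> of the
  top level have common lower bounds only on levels below \<open>F x y\<close>. An extension may not put a new common lower
  bound of two old elements anywhere but below an old one, so that the finite sets \<open>i{x, y}\<close> are decided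
  by any condition containing \<open>x\<close> and \<open>y\<close>.

  For the countable chain condition, pass to an uncountable family whose fields form a \<open>\<Delta>\<close>-system with root
  \<open>R\<close>, whose sets of levels form a \<open>\<Delta>\<close>-system too, and which induces a single order on \<open>R\<close>.
  Some countable \<open>d\<close> bounds the countable levels of \<open>R\<close> and the values of \<open>F\<close> on the top part of \<open>R\<close>, and
  all but countably many members of the family have their new countable levels above \<open>d\<close>. By strong
  unboundedness two members have \<open>F > d\<close> between their new top elements, and then their union is a
  condition extending both: the common lower bounds of a new top element of each lie in \<open>R\<close>,
  hence on levels at most \<open>d\<close>, and a new element of one cannot lie below two elements of the other,
  since these would be top elements in \<open>R\<close> with \<open>F\<close> at most \<open>d\<close>.

  Adding a single element below \<open>t\<close> works if the level of \<open>t\<close> is a limit or the successor of the new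
  level; by induction on the level of \<open>t\<close> this makes every lower level infinite below \<open>t\<close>.\<close>

section \<open>The forcing relation\<close>

text \<open>No generic extension is built: every statement is a fact about the relation
  \<open>forces\<close>, and the logic of the extension has to be redone there. Two devices carry
  this. What is forced densely below \<open>p\<close> is forced by \<open>p\<close>, so an argument
  may always pass to stronger conditions that choose its witnesses. And a formula with a variable is
  a function on names, so that substituting forced equals is a property to be shown formula by
  formula. Apart from the generic order and the sets of predecessors on one level, the names
  constructed denote ground model objects; most clauses thus reduce to statements about ground model
  elements. The chain condition enters this verification through omega1 and lambda, which must
  remain cardinals. On the combinatorial side the bound by \<open>F\<close> pulls in two directions:
  small values on pairs of shared top elements are what excludes new meets, large values on mixed
  pairs are what admits the meets already present in the shared part. A function that is strongly
  unbounded allows both at once.\<close>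

declare forces.simps(1,2) [simp del]

text \<open>The argument \<open>ity\<close> fixes the index type of the names, so that all formulas
  of the locale range over the same names.\<close>

locale forcing_rel =
  fixes P :: "'p rel" and ity :: "'i itself"
  assumes po: "Partial_order P"
begin

abbreviation stronger :: "'p \<Rightarrow> 'p \<Rightarrow> bool"  (infix \<open>\<sqsubseteq>\<close> 50) where
  "q \<sqsubseteq> p \<equiv> (q, p) \<in> P"

abbreviation forces_at :: "'p \<Rightarrow> ('i, 'p) name fm \<Rightarrow> bool"  (\<open>_ ||- _\<close> [50, 50] 49) where
  "p ||- A \<equiv> forces P A p"

section \<open>Density below a condition, and the forcing clauses in terms of it\<close>

definition dens :: "'p \<Rightarrow> ('p \<Rightarrow> bool) \<Rightarrow> bool" where
  "dens p Q \<longleftrightarrow> (\<forall>q. q \<sqsubseteq> p \<longrightarrow> (\<exists>r. r \<sqsubseteq> q \<and> Q r))"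

lemma dense_below_dens: "dense_below P p {r. Q r} = dens p Q"
  by (simp add: dens_def dense_below_def)

lemma le_refl: "p \<in> Field P \<Longrightarrow> p \<sqsubseteq> p"
  using po by (auto simp: partial_order_on_def preorder_on_def refl_on_def)

lemma le_refl1: "q \<sqsubseteq> p \<Longrightarrow> q \<sqsubseteq> q"
  by (rule le_refl) (auto intro: FieldI1)

lemma le_trans: "r \<sqsubseteq> q \<Longrightarrow> q \<sqsubseteq> p \<Longrightarrow> r \<sqsubseteq> p"
  using po by (auto simp: partial_order_on_def preorder_on_def trans_def)

lemma densI: "(\<And>q. q \<sqsubseteq> p \<Longrightarrow> Q q) \<Longrightarrow> dens p Q"
  unfolding dens_def using le_refl1 by blast

lemma densI_ex: "(\<And>q. q \<sqsubseteq> p \<Longrightarrow> \<exists>r. r \<sqsubseteq> q \<and> Q r) \<Longrightarrow> dens p Q"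
  unfolding dens_def by blast

lemma densD: "dens p Q \<Longrightarrow> q \<sqsubseteq> p \<Longrightarrow> \<exists>r. r \<sqsubseteq> q \<and> Q r"
  unfolding dens_def by blast

lemma dens_mono: "dens p Q \<Longrightarrow> q \<sqsubseteq> p \<Longrightarrow> dens q Q"
  unfolding dens_def using le_trans by blast

lemma dens_imp: "dens p Q \<Longrightarrow> (\<And>r. r \<sqsubseteq> p \<Longrightarrow> Q r \<Longrightarrow> Q' r) \<Longrightarrow> dens p Q'"
  unfolding dens_def using le_trans by blast

text \<open>Density iterates. Arguments that choose witnesses one after another descend through this
  rule or through \<open>forces_bind\<close>.\<close>

lemma dens_bind: "dens p Q \<Longrightarrow> (\<And>r. r \<sqsubseteq> p \<Longrightarrow> Q r \<Longrightarrow> dens r Q') \<Longrightarrow> dens p Q'"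
  unfolding dens_def by (meson le_refl1 le_trans)

lemma forces_mono: "p ||- A \<Longrightarrow> q \<sqsubseteq> p \<Longrightarrow> q ||- A"
proof (induction A arbitrary: p q)
  case (Mem x y)
  then show ?case
    by (simp add: forces.simps forces_mem_def dense_below_dens) (rule dens_mono)
next
  case (Eql x y)
  have "forces_eq P x y p" using Eql(1) by (simp add: forces.simps)
  then have "forces_eq P x y q"
    unfolding forces_eq.simps[of P x y] using le_trans[OF _ Eql(2)] by blast
  then show ?case by (simp add: forces.simps)
next
  case (Neg A)
  then show ?case unfolding forces.simps using le_trans by meson
next
  case (Forall A)
  have "q ||- A x" for x
    by (rule Forall.IH[OF rangeI _ Forall(3)]) (use Forall(2) in simp)
  then show ?case by simp
next
  case (Conj A B)
  then show ?case unfolding forces.simps by blast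
qed

text \<open>The clauses for membership and equality already ask only for density, and a forced
  negation is refuted by a single stronger condition. Hence a set of conditions dense below
  \<open>p\<close> is as good as \<open>p\<close> itself.\<close>

lemma forces_dens: "dens p (\<lambda>r. r ||- A) \<Longrightarrow> p ||- A"
proof (induction A arbitrary: p)
  case (Mem x y)
  then show ?case
    by (simp add: forces.simps forces_mem_def dense_below_dens) (erule dens_bind, simp)
next
  case (Eql x y)
  have d: "dens q (\<lambda>r. \<exists>v\<in>elts y. r \<sqsubseteq> snd v \<and> forces_eq P (fst u) (fst v) r)"
    if u: "u \<in> elts x" and q: "q \<sqsubseteq> p" "q \<sqsubseteq> snd u" for u q
  proof (rule dens_bind[OF dens_mono[OF Eql q(1)]])
    fix r assume r: "r \<sqsubseteq> q" and "r ||- (x \<^bold>= y)"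
    then have "forces_eq P x y r" by (simp add: forces.simps)
    then show "dens r (\<lambda>r. \<exists>v\<in>elts y. r \<sqsubseteq> snd v \<and> forces_eq P (fst u) (fst v) r)"
      unfolding forces_eq.simps[of P x y] dense_below_dens
      using u le_refl1[OF r] le_trans[OF r q(2)] by blast
  qed
  have d': "dens q (\<lambda>r. \<exists>u\<in>elts x. r \<sqsubseteq> snd u \<and> forces_eq P (fst u) (fst v) r)"
    if v: "v \<in> elts y" and q: "q \<sqsubseteq> p" "q \<sqsubseteq> snd v" for v q
  proof (rule dens_bind[OF dens_mono[OF Eql q(1)]])
    fix r assume r: "r \<sqsubseteq> q" and "r ||- (x \<^bold>= y)"
    then have "forces_eq P x y r" by (simp add: forces.simps)
    then show "dens r (\<lambda>r. \<exists>u\<in>elts x. r \<sqsubseteq> snd u \<and> forces_eq P (fst u) (fst v) r)"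
      unfolding forces_eq.simps[of P x y] dense_below_dens
      using v le_refl1[OF r] le_trans[OF r q(2)] by blast
  qed
  show ?case
    unfolding forces.simps forces_eq.simps[of P x y] dense_below_dens using d d' by blast
next
  case (Neg A)
  show ?case unfolding forces.simps
  proof (intro allI impI notI)
    fix q assume q: "q \<sqsubseteq> p" "q ||- A"
    then obtain r where "r \<sqsubseteq> q" "r ||- (\<^bold>\<not> A)" using densD[OF Neg(2)] by blast
    then show False using forces_mono[OF q(2)] le_refl1 unfolding forces.simps by meson
  qed
next
  case (Conj A B)
  show ?case unfolding forces.simps
    by (intro conjI Conj.IH; rule dens_imp[OF Conj(3)]) simp_all
next
  case (Forall A)
  show ?case unfolding forces.simps
    by (intro allI Forall.IH[OF rangeI]; rule dens_imp[OF Forall(2)]) simp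
qed

lemma forces_iff_dens: "p ||- A \<longleftrightarrow> dens p (\<lambda>r. r ||- A)"
  using forces_dens forces_mono densI by metis

lemma dens_forces [simp]: "dens p (\<lambda>r. r ||- A) = (p ||- A)"
  by (rule forces_iff_dens[symmetric])

lemma forces_bind: "dens p Q \<Longrightarrow> (\<And>r. r \<sqsubseteq> p \<Longrightarrow> Q r \<Longrightarrow> r ||- A) \<Longrightarrow> p ||- A"
  by (rule forces_dens) (rule dens_imp)

lemma fr_Neg: "p ||- (\<^bold>\<not> A) \<longleftrightarrow> (\<forall>q. q \<sqsubseteq> p \<longrightarrow> \<not> q ||- A)"
  by simp

text \<open>Unfolding the defining negation yields \<open>B\<close> only densely below a condition
  forcing \<open>A\<close>; \<open>forces_dens\<close> removes the density.\<close>

lemma fr_Imp: "p ||- (A \<^bold>\<longrightarrow> B) \<longleftrightarrow> (\<forall>q. q \<sqsubseteq> p \<longrightarrow> q ||- A \<longrightarrow> q ||- B)"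
proof -
  have "q ||- B" if "\<forall>q. q \<sqsubseteq> p \<and> q ||- A \<longrightarrow> (\<exists>r. r \<sqsubseteq> q \<and> r ||- B)" "q \<sqsubseteq> p" "q ||- A" for q
    by (rule forces_dens, rule densI_ex) (use that forces_mono le_trans in blast)
  then show ?thesis unfolding forces_Imp using le_refl1 by blast
qed

lemma fr_Disj: "p ||- (A \<^bold>\<or> B) \<longleftrightarrow> dens p (\<lambda>r. r ||- A \<or> r ||- B)"
  by (simp add: forces_Disj dense_below_dens)

lemma fr_Exists: "p ||- (Exists A) \<longleftrightarrow> dens p (\<lambda>r. \<exists>x. r ||- A x)"
  by (simp add: forces_Exists dense_below_dens)

lemma fr_ExistsI: "p ||- A x \<Longrightarrow> p ||- (Exists A)"
  unfolding fr_Exists by (rule densI) (use forces_mono in blast)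

section \<open>Forced equivalence and forced equality\<close>

text \<open>Equivalence at \<open>p\<close> alone would not pass through a negation, whose clause
  looks at all stronger conditions.\<close>

definition feq :: "'p \<Rightarrow> ('i, 'p) name fm \<Rightarrow> ('i, 'p) name fm \<Rightarrow> bool" where
  "feq p A B \<longleftrightarrow> (\<forall>q. q \<sqsubseteq> p \<longrightarrow> (q ||- A \<longleftrightarrow> q ||- B))"

lemma fr_Equ: "p ||- (A \<^bold>\<longleftrightarrow> B) \<longleftrightarrow> feq p A B"
  unfolding Equ_def feq_def by (auto simp: fr_Imp)

lemma fr_AllIn: "p ||- (AllIn a A) \<longleftrightarrow> (\<forall>x q. q \<sqsubseteq> p \<longrightarrow> q ||- (x \<^bold>\<in> a) \<longrightarrow> q ||- A x)"
  unfolding AllIn_def by (auto simp: fr_Imp)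

lemma fr_ExIn: "p ||- (ExIn a A) \<longleftrightarrow> dens p (\<lambda>r. \<exists>x. r ||- (x \<^bold>\<in> a) \<and> r ||- A x)"
  unfolding ExIn_def by (auto simp: fr_Exists)

lemma fr_ExInI: "p ||- (x \<^bold>\<in> a) \<Longrightarrow> p ||- A x \<Longrightarrow> p ||- (ExIn a A)"
  unfolding ExIn_def by (rule fr_ExistsI) simp

lemma feq_fr: "feq p A B \<Longrightarrow> p ||- A \<Longrightarrow> p ||- B"
  unfolding feq_def
  by (metis forces_dens densI forces_mono)

lemma eq_refl: "p ||- (x \<^bold>= x)"
proof -
  have "\<forall>p. forces_eq P x x p"
  proof (induction x rule: wf_induct_rule[OF wf_subname])
    case (1 x)
    have IH: "forces_eq P (fst u) (fst u) r" if "u \<in> elts x" for u r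
      using 1[of "fst u"] that by simp
    have "dens q (\<lambda>r. \<exists>v\<in>elts x. r \<sqsubseteq> snd v \<and> forces_eq P (fst u) (fst v) r)"
      "dens q (\<lambda>r. \<exists>v\<in>elts x. r \<sqsubseteq> snd v \<and> forces_eq P (fst v) (fst u) r)"
      if "u \<in> elts x" "q \<sqsubseteq> snd u" for u q
      by (rule densI, rule bexI[of _ u], use that IH le_trans in simp_all)+
    then show ?case
      unfolding forces_eq.simps[of P x x] dense_below_dens by blast
  qed
  then show ?thesis by (simp add: forces.simps)
qed

lemma eq_sym: "p ||- (x \<^bold>= y) \<Longrightarrow> p ||- (y \<^bold>= x)"
  by (simp only: forces.simps) (subst forces_eq_sym)

lemma fr_Mem: "p ||- (x \<^bold>\<in> y) \<longleftrightarrow> dens p (\<lambda>r. \<exists>v\<in>elts y. r \<sqsubseteq> snd v \<and> r ||- (x \<^bold>= fst v))"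
  by (simp add: forces.simps forces_mem_def dense_below_dens)

lemma fr_Eql: "p ||- (x \<^bold>= y) \<longleftrightarrow>
    (\<forall>u\<in>elts x. \<forall>q. q \<sqsubseteq> p \<and> q \<sqsubseteq> snd u \<longrightarrow> q ||- (fst u \<^bold>\<in> y)) \<and>
    (\<forall>v\<in>elts y. \<forall>q. q \<sqsubseteq> p \<and> q \<sqsubseteq> snd v \<longrightarrow> q ||- (fst v \<^bold>\<in> x))"
  using forces_eq_iff_mem[of P x y p] by (simp only: forces.simps)

text \<open>The induction is on the name \<open>x\<close>, with the other names and the condition
  general: members of \<open>x\<close> are followed through \<open>y\<close> to \<open>z\<close>,
  and members of \<open>z\<close> back through \<open>y\<close> to \<open>x\<close>.\<close>

lemma eq_trans: "p ||- (x \<^bold>= y) \<Longrightarrow> p ||- (y \<^bold>= z) \<Longrightarrow> p ||- (x \<^bold>= z)"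
proof (induction x arbitrary: y z p rule: wf_induct_rule[OF wf_subname])
  case (1 x)
  have IH: "r ||- (fst u \<^bold>= a) \<Longrightarrow> r ||- (a \<^bold>= b) \<Longrightarrow> r ||- (fst u \<^bold>= b)" if "u \<in> elts x" for u a b r
    by (rule 1(1)[of "fst u"]) (use that in auto)
  show ?case unfolding fr_Eql[of x z p]
  proof (intro conjI ballI allI impI)
    fix u q assume u: "u \<in> elts x" and q: "q \<sqsubseteq> p \<and> q \<sqsubseteq> snd u"
    then have "q ||- (fst u \<^bold>\<in> y)" using 1(2) by (simp add: fr_Eql[of x y p])
    then have "dens q (\<lambda>r. \<exists>v\<in>elts y. r \<sqsubseteq> snd v \<and> r ||- (fst u \<^bold>= fst v))"
      by (simp add: fr_Mem)
    then show "q ||- (fst u \<^bold>\<in> z)"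
    proof (rule forces_bind)
      fix r assume r: "r \<sqsubseteq> q" and "\<exists>v\<in>elts y. r \<sqsubseteq> snd v \<and> r ||- (fst u \<^bold>= fst v)"
      then obtain v where v: "v \<in> elts y" "r \<sqsubseteq> snd v" "r ||- (fst u \<^bold>= fst v)" by blast
      then have "r ||- (fst v \<^bold>\<in> z)" using 1(3) q le_trans[OF r] by (simp add: fr_Eql[of y z p])
      then show "r ||- (fst u \<^bold>\<in> z)"
        unfolding fr_Mem by (rule dens_imp) (use IH[OF u] forces_mono[OF v(3)] in blast)
    qed
  next
    fix w q assume w: "w \<in> elts z" and q: "q \<sqsubseteq> p \<and> q \<sqsubseteq> snd w"
    then have "q ||- (fst w \<^bold>\<in> y)" using 1(3) by (simp add: fr_Eql[of y z p])
    then have "dens q (\<lambda>r. \<exists>v\<in>elts y. r \<sqsubseteq> snd v \<and> r ||- (fst w \<^bold>= fst v))"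
      by (simp add: fr_Mem)
    then show "q ||- (fst w \<^bold>\<in> x)"
    proof (rule forces_bind)
      fix r assume r: "r \<sqsubseteq> q" and "\<exists>v\<in>elts y. r \<sqsubseteq> snd v \<and> r ||- (fst w \<^bold>= fst v)"
      then obtain v where v: "v \<in> elts y" "r \<sqsubseteq> snd v" "r ||- (fst w \<^bold>= fst v)" by blast
      then have "r ||- (fst v \<^bold>\<in> x)" using 1(2) q le_trans[OF r] by (simp add: fr_Eql[of x y p])
      then show "r ||- (fst w \<^bold>\<in> x)"
        unfolding fr_Mem
      proof (rule dens_imp)
        fix r' assume r': "r' \<sqsubseteq> r" and "\<exists>u\<in>elts x. r' \<sqsubseteq> snd u \<and> r' ||- (fst v \<^bold>= fst u)"
        then obtain u where u: "u\<in>elts x" "r' \<sqsubseteq> snd u" "r' ||- (fst v \<^bold>= fst u)" by blast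
        \<comment> \<open>The induction hypothesis is available only with a member of
          \<open>x\<close> on the left, so the chain is turned around by symmetry.\<close>
        have "r' ||- (fst u \<^bold>= fst w)"
          by (rule IH[OF u(1)]) (use u(3) forces_mono[OF v(3) r'] eq_sym in blast)+
        then show "\<exists>u\<in>elts x. r' \<sqsubseteq> snd u \<and> r' ||- (fst w \<^bold>= fst u)"
          using u eq_sym by blast
      qed
    qed
  qed
qed

lemma mem_cong1: "p ||- (x \<^bold>= x') \<Longrightarrow> p ||- (x \<^bold>\<in> y) \<Longrightarrow> p ||- (x' \<^bold>\<in> y)"
  unfolding fr_Mem
  by (erule dens_imp) (blast intro: eq_trans eq_sym forces_mono)

lemma elts_mem: "u \<in> elts x \<Longrightarrow> q \<sqsubseteq> snd u \<Longrightarrow> q ||- (fst u \<^bold>\<in> x)"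
  unfolding fr_Mem by (rule densI) (use le_trans eq_refl in blast)

lemma mem_cong2: "p ||- (y \<^bold>= y') \<Longrightarrow> p ||- (x \<^bold>\<in> y) \<Longrightarrow> p ||- (x \<^bold>\<in> y')"
proof -
  assume y: "p ||- (y \<^bold>= y')" and x: "p ||- (x \<^bold>\<in> y)"
  show ?thesis
  proof (rule forces_bind[OF x[unfolded fr_Mem]])
    fix r assume r: "r \<sqsubseteq> p" "\<exists>v\<in>elts y. r \<sqsubseteq> snd v \<and> r ||- (x \<^bold>= fst v)"
    then obtain v where v: "v \<in> elts y" "r \<sqsubseteq> snd v" "r ||- (x \<^bold>= fst v)" by blast
    then have "r ||- (fst v \<^bold>\<in> y')" using y r by (simp add: fr_Eql[of y y' p])
    then show "r ||- (x \<^bold>\<in> y')" using v eq_sym mem_cong1 by blast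
  qed
qed

text \<open>\<open>fr_Eql\<close> tests only the names listed in \<open>x\<close> and
  \<open>y\<close>; this version tests all names, which is what the quantifiers of the formulas
  range over.\<close>

lemma fr_ext: "p ||- (x \<^bold>= y) \<longleftrightarrow> (\<forall>z. feq p (z \<^bold>\<in> x) (z \<^bold>\<in> y))"
proof
  assume "p ||- (x \<^bold>= y)"
  then show "\<forall>z. feq p (z \<^bold>\<in> x) (z \<^bold>\<in> y)"
    unfolding feq_def using mem_cong2 forces_mono eq_sym by blast
next
  assume "\<forall>z. feq p (z \<^bold>\<in> x) (z \<^bold>\<in> y)"
  then show "p ||- (x \<^bold>= y)"
    unfolding fr_Eql feq_def using elts_mem by blast
qed

section \<open>Substitution of forced equals\<close>

text \<open>One rule for each connective and each defined notion, so that \<open>intro fcong\<close>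
  can follow the build-up of a formula.\<close>

named_theorems fcong

declare eq_refl [fcong]

lemma feq_Mem [fcong]: "p ||- (x \<^bold>= x') \<Longrightarrow> p ||- (y \<^bold>= y') \<Longrightarrow> feq p (x \<^bold>\<in> y) (x' \<^bold>\<in> y')"
  unfolding feq_def by (blast intro: mem_cong1 mem_cong2 forces_mono eq_sym)

lemma feq_Eql [fcong]: "p ||- (x \<^bold>= x') \<Longrightarrow> p ||- (y \<^bold>= y') \<Longrightarrow> feq p (x \<^bold>= y) (x' \<^bold>= y')"
  unfolding feq_def by (blast intro: eq_trans forces_mono eq_sym)

lemma feq_Neg [fcong]: "feq p A B \<Longrightarrow> feq p (\<^bold>\<not> A) (\<^bold>\<not> B)"
  unfolding feq_def using le_trans by simp

lemma feq_Conj [fcong]: "feq p A B \<Longrightarrow> feq p A' B' \<Longrightarrow> feq p (A \<^bold>\<and> A') (B \<^bold>\<and> B')"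
  unfolding feq_def by simp

lemma feq_Forall [fcong]: "(\<And>x. feq p (A x) (B x)) \<Longrightarrow> feq p (Forall A) (Forall B)"
  unfolding feq_def by simp

lemma feq_Disj [fcong]: "feq p A B \<Longrightarrow> feq p A' B' \<Longrightarrow> feq p (A \<^bold>\<or> A') (B \<^bold>\<or> B')"
  unfolding Disj_def by (intro fcong)

lemma feq_Imp [fcong]: "feq p A B \<Longrightarrow> feq p A' B' \<Longrightarrow> feq p (A \<^bold>\<longrightarrow> A') (B \<^bold>\<longrightarrow> B')"
  unfolding Imp_def by (intro fcong)

lemma feq_Equ [fcong]: "feq p A B \<Longrightarrow> feq p A' B' \<Longrightarrow> feq p (A \<^bold>\<longleftrightarrow> A') (B \<^bold>\<longleftrightarrow> B')"
  unfolding Equ_def by (intro fcong)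

lemma feq_Exists [fcong]: "(\<And>x. feq p (A x) (B x)) \<Longrightarrow> feq p (Exists A) (Exists B)"
  unfolding Exists_def by (intro fcong)

lemma feq_AllIn [fcong]:
  "p ||- (a \<^bold>= b) \<Longrightarrow> (\<And>x. feq p (A x) (B x)) \<Longrightarrow> feq p (AllIn a A) (AllIn b B)"
  unfolding AllIn_def by (intro fcong)

lemma feq_ExIn [fcong]:
  "p ||- (a \<^bold>= b) \<Longrightarrow> (\<And>x. feq p (A x) (B x)) \<Longrightarrow> feq p (ExIn a A) (ExIn b B)"
  unfolding ExIn_def by (intro fcong)

lemma feq_subset [fcong]:
  "p ||- (x \<^bold>= x') \<Longrightarrow> p ||- (y \<^bold>= y') \<Longrightarrow> feq p (fm_subset x y) (fm_subset x' y')"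
  unfolding fm_subset_def by (intro fcong)

lemma feq_upair [fcong]:
  "p ||- (z \<^bold>= z') \<Longrightarrow> p ||- (x \<^bold>= x') \<Longrightarrow> p ||- (y \<^bold>= y') \<Longrightarrow> feq p (fm_upair z x y) (fm_upair z' x' y')"
  unfolding fm_upair_def by (intro fcong)

lemma feq_pair [fcong]:
  "p ||- (z \<^bold>= z') \<Longrightarrow> p ||- (x \<^bold>= x') \<Longrightarrow> p ||- (y \<^bold>= y') \<Longrightarrow> feq p (fm_pair z x y) (fm_pair z' x' y')"
  unfolding fm_pair_def by (intro fcong)

lemma feq_rel [fcong]:
  "p ||- (z \<^bold>= z') \<Longrightarrow> p ||- (x \<^bold>= x') \<Longrightarrow> p ||- (y \<^bold>= y') \<Longrightarrow> feq p (fm_rel z x y) (fm_rel z' x' y')"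
  unfolding fm_rel_def by (intro fcong)

lemma feq_less [fcong]:
  "p ||- (z \<^bold>= z') \<Longrightarrow> p ||- (x \<^bold>= x') \<Longrightarrow> p ||- (y \<^bold>= y') \<Longrightarrow> feq p (fm_less z x y) (fm_less z' x' y')"
  unfolding fm_less_def by (intro fcong)

lemma feq_transitive [fcong]: "p ||- (x \<^bold>= x') \<Longrightarrow> feq p (fm_transitive x) (fm_transitive x')"
  unfolding fm_transitive_def by (intro fcong)

lemma feq_ordinal [fcong]: "p ||- (x \<^bold>= x') \<Longrightarrow> feq p (fm_ordinal x) (fm_ordinal x')"
  unfolding fm_ordinal_def by (intro fcong)

lemma feq_succ [fcong]:
  "p ||- (x \<^bold>= x') \<Longrightarrow> p ||- (y \<^bold>= y') \<Longrightarrow> feq p (fm_succ x y) (fm_succ x' y')"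
  unfolding fm_succ_def by (intro fcong)

lemma feq_empty [fcong]: "p ||- (x \<^bold>= x') \<Longrightarrow> feq p (fm_empty x) (fm_empty x')"
  unfolding fm_empty_def by (intro fcong)

lemma feq_omega [fcong]: "p ||- (x \<^bold>= x') \<Longrightarrow> feq p (fm_omega x) (fm_omega x')"
  unfolding fm_omega_def by (intro fcong)

lemma feq_function_on [fcong]:
  "p ||- (x \<^bold>= x') \<Longrightarrow> p ||- (y \<^bold>= y') \<Longrightarrow> feq p (fm_function_on x y) (fm_function_on x' y')"
  unfolding fm_function_on_def by (intro fcong)

lemma feq_injection [fcong]:
  "p ||- (z \<^bold>= z') \<Longrightarrow> p ||- (x \<^bold>= x') \<Longrightarrow> p ||- (y \<^bold>= y') \<Longrightarrow>
    feq p (fm_injection z x y) (fm_injection z' x' y')"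
  unfolding fm_injection_def by (intro fcong)

lemma feq_cardinal [fcong]: "p ||- (x \<^bold>= x') \<Longrightarrow> feq p (fm_cardinal x) (fm_cardinal x')"
  unfolding fm_cardinal_def by (intro fcong)

lemma feq_finite [fcong]: "p ||- (x \<^bold>= x') \<Longrightarrow> feq p (fm_finite x) (fm_finite x')"
  unfolding fm_finite_def by (intro fcong)

lemma feq_infinite_cardinal [fcong]:
  "p ||- (x \<^bold>= x') \<Longrightarrow> feq p (fm_infinite_cardinal x) (fm_infinite_cardinal x')"
  unfolding fm_infinite_cardinal_def by (intro fcong)

lemma feq_level [fcong]:
  "p ||- (z \<^bold>= z') \<Longrightarrow> p ||- (x \<^bold>= x') \<Longrightarrow> p ||- (y \<^bold>= y') \<Longrightarrow> feq p (fm_level z x y) (fm_level z' x' y')"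
  unfolding fm_level_def by (intro fcong)

end

section \<open>Canonical names\<close>

text \<open>This is what \<open>elts_mk_name\<close> asks of a set of pairs. The argument of type
  \<open>itself\<close> names the index type, which \<open>S\<close> does not determine.\<close>

definition small_for :: "'i itself \<Rightarrow> 'b set \<Rightarrow> bool" where
  "small_for ity S \<longleftrightarrow> |S| \<le>o |UNIV :: 'i set|"

text \<open>An infinite index type makes smallness closed under products and unions of two sets; the
  bound on the number of conditions keeps a small set of names small after pairing it with all
  conditions.\<close>

locale forcing_names = forcing_rel P ity
  for P :: "'p rel" and ity :: "'i itself" +
  assumes inf_index: "infinite (UNIV :: 'i set)"
    and card_forcing: "|Field P| \<le>o |UNIV :: 'i set|"
begin

abbreviation small :: "'b set \<Rightarrow> bool" where
  "small S \<equiv> small_for ity S"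

lemma small_image: "small S \<Longrightarrow> small (f ` S)"
  unfolding small_for_def using card_of_image ordLeq_transitive by blast

lemma small_subset: "small S \<Longrightarrow> S' \<subseteq> S \<Longrightarrow> small S'"
  unfolding small_for_def using card_of_mono1 ordLeq_transitive by blast

lemma small_finite: "finite S \<Longrightarrow> small S"
  unfolding small_for_def
  using inf_index finite_ordLess_infinite[of "|S|" "|UNIV :: 'i set|"] ordLess_imp_ordLeq
  by (auto simp: Field_card_of card_of_well_order_on)

lemma small_Times: "small S \<Longrightarrow> small S' \<Longrightarrow> small (S \<times> S')"
  unfolding small_for_def
  using inf_index by (intro card_of_Times_ordLeq_infinite_Field) (auto simp: Field_card_of card_of_card_order_on)

lemma small_Un: "small S \<Longrightarrow> small S' \<Longrightarrow> small (S \<union> S')"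
  unfolding small_for_def
  using inf_index by (intro card_of_Un_ordLeq_infinite_Field) (auto simp: Field_card_of card_of_card_order_on)

text \<open>Each member is paired with every condition, so membership does not depend on the generic
  filter. The elements of \<open>S\<close> are themselves names and need not be canonical.\<close>

definition chk :: "('i, 'p) name set \<Rightarrow> ('i, 'p) name" where
  "chk S = mk_name (S \<times> Field P)"

lemma elts_chk: "small S \<Longrightarrow> elts (chk S) = S \<times> Field P"
  unfolding chk_def using small_Times[of S "Field P"] card_forcing
  by (intro elts_mk_name) (simp add: small_for_def)

lemma mem_chk:
  assumes "small S"
  shows "p ||- (x \<^bold>\<in> chk S) \<longleftrightarrow> dens p (\<lambda>r. \<exists>u\<in>S. r ||- (x \<^bold>= u))"
  unfolding fr_Mem elts_chk[OF assms]
proof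
  assume "dens p (\<lambda>r. \<exists>v\<in>S \<times> Field P. r \<sqsubseteq> snd v \<and> r ||- x \<^bold>= fst v)"
  then show "dens p (\<lambda>r. \<exists>u\<in>S. r ||- x \<^bold>= u)"
    by (rule dens_imp) (metis mem_Times_iff)
next
  assume "dens p (\<lambda>r. \<exists>u\<in>S. r ||- x \<^bold>= u)"
  then show "dens p (\<lambda>r. \<exists>v\<in>S \<times> Field P. r \<sqsubseteq> snd v \<and> r ||- x \<^bold>= fst v)"
  proof (rule dens_imp)
    fix r assume "r \<sqsubseteq> p" "\<exists>u\<in>S. r ||- x \<^bold>= u"
    moreover have "r \<sqsubseteq> r" "r \<in> Field P"
      using le_refl1 FieldI1 \<open>r \<sqsubseteq> p\<close> by fast+
    ultimately obtain u where "u \<in> S" "r ||- x \<^bold>= u" "r \<sqsubseteq> r" "r \<in> Field P"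
      by blast
    then show "\<exists>v\<in>S \<times> Field P. r \<sqsubseteq> snd v \<and> r ||- x \<^bold>= fst v"
      by (intro bexI[of _ "(u, r)"]) simp_all
  qed
qed

lemma mem_chkI: "small S \<Longrightarrow> u \<in> S \<Longrightarrow> p ||- (u \<^bold>\<in> chk S)"
  unfolding mem_chk by (rule densI) (use eq_refl in blast)

section \<open>Quantifiers bounded by ground model sets of names\<close>

text \<open>A formula in one variable is an arbitrary function on names and might depend on the name
  instead of the set that it names; this excludes such functions.\<close>

definition resp :: "(('i, 'p) name \<Rightarrow> ('i, 'p) name fm) \<Rightarrow> bool" where
  "resp A \<longleftrightarrow> (\<forall>x x' p. p ||- (x \<^bold>= x') \<longrightarrow> feq p (A x) (A x'))"

lemma respI [fcong]: "(\<And>x x' p. p ||- (x \<^bold>= x') \<Longrightarrow> feq p (A x) (A x')) \<Longrightarrow> resp A"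
  unfolding resp_def by blast

lemma resp_fr: "resp A \<Longrightarrow> p ||- (x \<^bold>= x') \<Longrightarrow> p ||- A x' \<Longrightarrow> p ||- A x"
  unfolding resp_def using feq_fr eq_sym by blast

text \<open>A guard confines \<open>x\<close> to ground model values, chosen densely. Membership in
  \<open>chk S\<close> is one, and so is lying on a given level of the poset; a quantifier
  relativized to a guard becomes a quantifier over \<open>S\<close>.\<close>

definition guard :: "(('i, 'p) name \<Rightarrow> ('i, 'p) name fm) \<Rightarrow> ('i, 'p) name set \<Rightarrow> bool" where
  "guard G S \<longleftrightarrow> (\<forall>x q. q ||- G x \<longrightarrow> dens q (\<lambda>r. \<exists>u\<in>S. r ||- (x \<^bold>= u)))"

lemma guard_chk: "small S \<Longrightarrow> guard (\<lambda>x. x \<^bold>\<in> chk S) S"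
  unfolding guard_def by (simp add: mem_chk)

lemma Forall_guardI:
  assumes "guard G S" "resp A" "\<And>u q. u \<in> S \<Longrightarrow> q \<sqsubseteq> p \<Longrightarrow> q ||- G u \<Longrightarrow> q ||- A u" "resp G"
  shows "p ||- (\<^bold>\<forall>x. G x \<^bold>\<longrightarrow> A x)"
  unfolding forces.simps(3-5)
proof
  fix x
  show "p ||- (G x \<^bold>\<longrightarrow> A x)" unfolding fr_Imp
  proof (intro allI impI)
    fix q assume q: "q \<sqsubseteq> p" "q ||- G x"
    then have "dens q (\<lambda>r. \<exists>u\<in>S. r ||- (x \<^bold>= u))" using assms(1) by (simp add: guard_def)
    then show "q ||- A x"
    proof (rule forces_bind)
      fix r assume r: "r \<sqsubseteq> q" "\<exists>u\<in>S. r ||- x \<^bold>= u"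
      then obtain u where u: "u \<in> S" "r ||- x \<^bold>= u" by blast
      have "r ||- G u" using resp_fr[OF assms(4) eq_sym[OF u(2)]] forces_mono[OF q(2) r(1)] .
      then show "r ||- A x"
        using resp_fr[OF assms(2) u(2)] assms(3)[OF u(1) le_trans[OF r(1) q(1)]] by blast
    qed
  qed
qed

lemma AllIn_chk:
  assumes "small S" "resp A"
  shows "p ||- AllIn (chk S) A \<longleftrightarrow> (\<forall>u\<in>S. p ||- A u)"
proof
  assume *: "p ||- AllIn (chk S) A"
  show "\<forall>u\<in>S. p ||- A u"
  proof
    fix u assume "u \<in> S"
    show "p ||- A u"
      by (rule forces_dens, rule densI) (use * mem_chkI[OF assms(1) \<open>u \<in> S\<close>] in \<open>auto simp: fr_AllIn\<close>)
  qed
next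
  assume *: "\<forall>u\<in>S. p ||- A u"
  show "p ||- AllIn (chk S) A" unfolding AllIn_def
    by (rule Forall_guardI[OF guard_chk[OF assms(1)] assms(2)])
       (use * forces_mono in \<open>auto intro!: fcong\<close>)
qed

lemma ExIn_chk:
  assumes "small S" "resp A"
  shows "p ||- ExIn (chk S) A \<longleftrightarrow> dens p (\<lambda>r. \<exists>u\<in>S. r ||- A u)"
proof
  assume "p ||- ExIn (chk S) A"
  then have "dens p (\<lambda>r. \<exists>x. r ||- (x \<^bold>\<in> chk S) \<and> r ||- A x)" by (simp add: fr_ExIn)
  then show "dens p (\<lambda>r. \<exists>u\<in>S. r ||- A u)"
  proof (rule dens_bind)
    fix r assume "\<exists>x. r ||- (x \<^bold>\<in> chk S) \<and> r ||- A x"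
    then obtain x where x: "r ||- (x \<^bold>\<in> chk S)" "r ||- A x" by blast
    show "dens r (\<lambda>r. \<exists>u\<in>S. r ||- A u)"
      by (rule dens_imp[OF x(1)[unfolded mem_chk[OF assms(1)]]])
         (use resp_fr[OF assms(2)] x(2) forces_mono eq_sym in blast)
  qed
next
  assume "dens p (\<lambda>r. \<exists>u\<in>S. r ||- A u)"
  then show "p ||- ExIn (chk S) A"
    unfolding fr_ExIn by (rule dens_imp) (use mem_chkI[OF assms(1)] in blast)
qed

lemma eq_chkI:
  assumes "small S" "small S'"
    "\<And>u. u \<in> S \<Longrightarrow> p ||- (u \<^bold>\<in> chk S')" "\<And>u. u \<in> S' \<Longrightarrow> p ||- (u \<^bold>\<in> chk S)"
  shows "p ||- (chk S \<^bold>= chk S')"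
  unfolding fr_Eql elts_chk[OF assms(1)] elts_chk[OF assms(2)]
  by (auto intro: forces_mono[OF assms(3)] forces_mono[OF assms(4)])

section \<open>Unordered and ordered pairs\<close>

lemma eq_chk2:
  assumes "p ||- (x \<^bold>= x')" "p ||- (y \<^bold>= y')"
  shows "p ||- (chk {x, y} \<^bold>= chk {x', y'})"
proof (rule eq_chkI)
  fix u assume "u \<in> {x, y}"
  then show "p ||- (u \<^bold>\<in> chk {x', y'})"
    using assms eq_sym mem_cong1 mem_chkI[of "{x', y'}"] small_finite by (metis finite.simps insert_iff singletonD)
next
  fix u assume "u \<in> {x', y'}"
  then show "p ||- (u \<^bold>\<in> chk {x, y})"
    using assms mem_cong1 mem_chkI[of "{x, y}"] small_finite by (metis finite.simps insert_iff singletonD)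
qed (auto intro: small_finite)

lemma mem_chk1: "p ||- (z \<^bold>\<in> chk {x}) \<longleftrightarrow> p ||- (z \<^bold>= x)"
  by (simp add: mem_chk small_finite)

lemma mem_chk2: "p ||- (z \<^bold>\<in> chk {x, y}) \<longleftrightarrow> dens p (\<lambda>r. r ||- (z \<^bold>= x) \<or> r ||- (z \<^bold>= y))"
  by (simp add: mem_chk small_finite)

lemma feq_mem_chk2: "feq p (w \<^bold>\<in> chk {x, y}) (w \<^bold>= x \<^bold>\<or> w \<^bold>= y)"
  unfolding feq_def mem_chk2 fr_Disj by blast

lemma fr_upair: "p ||- fm_upair z x y \<longleftrightarrow> p ||- (z \<^bold>= chk {x, y})"
proof -
  have "feq p (w \<^bold>\<in> z) (w \<^bold>= x \<^bold>\<or> w \<^bold>= y) \<longleftrightarrow> feq p (w \<^bold>\<in> z) (w \<^bold>\<in> chk {x, y})" for w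
    using feq_mem_chk2[of p w x y] unfolding feq_def by simp
  then show ?thesis
    unfolding fm_upair_def forces.simps(3-5) fr_Equ fr_ext by simp
qed

definition pr :: "('i, 'p) name \<Rightarrow> ('i, 'p) name \<Rightarrow> ('i, 'p) name" where
  "pr x y = chk {chk {x}, chk {x, y}}"

lemma fr_pair: "p ||- fm_pair z x y \<longleftrightarrow> p ||- (z \<^bold>= pr x y)"
proof
  assume "p ||- fm_pair z x y"
  then have "dens p (\<lambda>r. \<exists>u. dens r (\<lambda>r. \<exists>v. r ||- (u \<^bold>= chk {x}) \<and> r ||- (v \<^bold>= chk {x, y}) \<and> r ||- (z \<^bold>= chk {u, v})))"
    unfolding fm_pair_def fr_Exists by (simp add: fr_upair)
  then show "p ||- (z \<^bold>= pr x y)"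
  proof (rule forces_bind, elim exE)
    fix r u assume "dens r (\<lambda>r. \<exists>v. r ||- (u \<^bold>= chk {x}) \<and> r ||- (v \<^bold>= chk {x, y}) \<and> r ||- (z \<^bold>= chk {u, v}))"
    then show "r ||- (z \<^bold>= pr x y)"
      by (rule forces_bind) (use eq_chk2 eq_trans in \<open>unfold pr_def, blast\<close>)
  qed
next
  assume "p ||- (z \<^bold>= pr x y)"
  then show "p ||- fm_pair z x y"
    unfolding fm_pair_def
    by (intro fr_ExistsI[where x = "chk {x}"] fr_ExistsI[where x = "chk {x, y}"])
       (simp add: fr_upair pr_def eq_refl)
qed

lemma pr_cong: "p ||- (x \<^bold>= x') \<Longrightarrow> p ||- (y \<^bold>= y') \<Longrightarrow> p ||- (pr x y \<^bold>= pr x' y')"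
  unfolding pr_def using eq_chk2 eq_chk2[of x x' p x x'] by simp

lemma dens_disjI1: "r ||- A \<Longrightarrow> dens r (\<lambda>r. r ||- A \<or> Q r)"
  using forces_mono by (intro densI) blast

lemma chk1_eqD: "p ||- (chk {x} \<^bold>= chk {x', y'}) \<Longrightarrow> p ||- (x' \<^bold>= x) \<and> p ||- (y' \<^bold>= x)"
proof -
  assume e: "p ||- (chk {x} \<^bold>= chk {x', y'})"
  have "p ||- (x' \<^bold>\<in> chk {x', y'})" "p ||- (y' \<^bold>\<in> chk {x', y'})"
    by (auto intro!: mem_chkI small_finite)
  then show ?thesis using mem_cong2[OF eq_sym[OF e]] by (simp add: mem_chk1)
qed

text \<open>The usual argument for Kuratowski pairs, with each case distinction on the members of a
  two-element set valid only densely.\<close>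

lemma pr_eqD:
  assumes e: "p ||- (pr x y \<^bold>= pr x' y')"
  shows "p ||- (x \<^bold>= x')" "p ||- (y \<^bold>= y')"
proof -
  have fin: "small {a, b}" for a b :: "('i, 'p) name" by (simp add: small_finite)
  have "p ||- (chk {x} \<^bold>\<in> pr x y)" unfolding pr_def by (auto intro!: mem_chkI fin)
  then have "p ||- (chk {x} \<^bold>\<in> pr x' y')" using e mem_cong2 by blast
  then show x: "p ||- (x \<^bold>= x')"
    unfolding pr_def mem_chk2
    by (rule forces_bind) (use chk1_eqD[of x x' x'] chk1_eqD[of x x' y'] eq_sym in auto)
  have aux: "dens r (\<lambda>r. r ||- (b \<^bold>= a') \<or> r ||- (b \<^bold>= b'))"
    if "r ||- (chk {a, b} \<^bold>= chk {a', b'})" for a b a' b' r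
  proof -
    have "r ||- (b \<^bold>\<in> chk {a, b})" by (auto intro!: mem_chkI fin)
    from mem_cong2[OF that this] show ?thesis by (simp add: mem_chk2)
  qed
  have "p ||- (chk {x', y'} \<^bold>\<in> pr x' y')" unfolding pr_def by (auto intro!: mem_chkI fin)
  then have "p ||- (chk {x', y'} \<^bold>\<in> pr x y)" using e mem_cong2 eq_sym by blast
  then have y': "dens p (\<lambda>r. r ||- (y' \<^bold>= x) \<or> r ||- (y' \<^bold>= y))"
    unfolding pr_def mem_chk2
    by (rule dens_bind) (use aux[of x' y' x x] aux[of x' y' x y] in \<open>auto intro: dens_disjI1\<close>)
  have "p ||- (chk {x, y} \<^bold>\<in> pr x y)" unfolding pr_def by (auto intro!: mem_chkI fin)
  then have "p ||- (chk {x, y} \<^bold>\<in> pr x' y')" using e mem_cong2 by blast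
  then have y: "dens p (\<lambda>r. r ||- (y \<^bold>= x') \<or> r ||- (y \<^bold>= y'))"
    unfolding pr_def mem_chk2
    by (rule dens_bind) (use aux[of x y x' x'] aux[of x y x' y'] in \<open>auto intro: dens_disjI1\<close>)
  show "p ||- (y \<^bold>= y')"
  proof (rule forces_bind[OF y])
    fix r assume r: "r \<sqsubseteq> p" and d: "r ||- (y \<^bold>= x') \<or> r ||- (y \<^bold>= y')"
    from d show "r ||- (y \<^bold>= y')"
    proof
      assume yx: "r ||- (y \<^bold>= x')"
      \<comment> \<open>Here \<open>y\<close> equals \<open>x'\<close>, hence \<open>x\<close>, and
        then either alternative for \<open>y'\<close> makes it equal to \<open>y\<close>. This is
        why \<open>y'\<close> was located in \<open>{x, y}\<close> as well.\<close>
      show ?thesis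
      proof (rule forces_bind[OF dens_mono[OF y' r]])
        fix r' assume r': "r' \<sqsubseteq> r" and "r' ||- (y' \<^bold>= x) \<or> r' ||- (y' \<^bold>= y)"
        moreover have "r' ||- (x \<^bold>= y)"
          using forces_mono[OF x le_trans[OF r' r]] eq_sym[OF forces_mono[OF yx r']] eq_trans by blast
        ultimately show "r' ||- (y \<^bold>= y')" using eq_trans eq_sym by blast
      qed
    qed
  qed
qed

lemma fr_rel: "p ||- fm_rel R x y \<longleftrightarrow> p ||- (pr x y \<^bold>\<in> R)"
proof
  assume "p ||- fm_rel R x y"
  then have "dens p (\<lambda>r. \<exists>z. r ||- (z \<^bold>= pr x y) \<and> r ||- (z \<^bold>\<in> R))"
    unfolding fm_rel_def fr_Exists by (simp add: fr_pair)
  then show "p ||- (pr x y \<^bold>\<in> R)"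
    by (rule forces_bind) (use mem_cong1 in blast)
next
  assume "p ||- (pr x y \<^bold>\<in> R)"
  then show "p ||- fm_rel R x y"
    unfolding fm_rel_def by (intro fr_ExistsI[where x = "pr x y"]) (simp add: fr_pair eq_refl)
qed

section \<open>Discrete families of names, and graphs of ground model functions\<close>

text \<open>No condition identifies two members of the family. Forced equality then reflects real
  equality, and ground model functions and injections keep their properties in the
  extension.\<close>

definition discrete :: "('b \<Rightarrow> ('i, 'p) name) \<Rightarrow> 'b set \<Rightarrow> bool" where
  "discrete f A \<longleftrightarrow> (\<forall>a\<in>A. \<forall>b\<in>A. \<forall>p\<in>Field P. p ||- (f a \<^bold>= f b) \<longrightarrow> a = b)"

lemma discreteD: "discrete f A \<Longrightarrow> a \<in> A \<Longrightarrow> b \<in> A \<Longrightarrow> p \<in> Field P \<Longrightarrow> p ||- (f a \<^bold>= f b) \<longleftrightarrow> a = b"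
  unfolding discrete_def using eq_refl by blast

lemma discrete_mem:
  assumes "discrete f A" "B \<subseteq> A" "a \<in> A" "p \<in> Field P" "small B"
  shows "p ||- (f a \<^bold>\<in> chk (f ` B)) \<longleftrightarrow> a \<in> B"
proof
  assume "p ||- (f a \<^bold>\<in> chk (f ` B))"
  then have "dens p (\<lambda>r. \<exists>u\<in>f ` B. r ||- (f a \<^bold>= u))" by (simp add: mem_chk small_image assms)
  then obtain r b where "r \<sqsubseteq> p" "b \<in> B" "r ||- (f a \<^bold>= f b)" "r \<in> Field P"
    using densD[OF _ le_refl[OF assms(4)]] by (blast intro: FieldI1)
  then show "a \<in> B" using assms discreteD[of f A a b r] by auto
qed (auto intro!: mem_chkI small_image assms)

definition graph :: "('b \<Rightarrow> ('i, 'p) name) \<Rightarrow> ('b \<Rightarrow> ('i, 'p) name) \<Rightarrow> 'b set \<Rightarrow> ('i, 'p) name" where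
  "graph f g A = chk ((\<lambda>a. pr (f a) (g a)) ` A)"

lemma rel_graph:
  assumes "small A"
  shows "p ||- fm_rel (graph f g A) x y \<longleftrightarrow> dens p (\<lambda>r. \<exists>a\<in>A. r ||- (x \<^bold>= f a) \<and> r ||- (y \<^bold>= g a))"
proof -
  have "r ||- (pr x y \<^bold>= pr (f a) (g a)) \<longleftrightarrow> r ||- (x \<^bold>= f a) \<and> r ||- (y \<^bold>= g a)" for r a
    using pr_eqD pr_cong by blast
  then show ?thesis unfolding fr_rel graph_def by (simp add: mem_chk small_image assms)
qed

text \<open>Discreteness is asked of the arguments, where it makes the graph single-valued; some
  condition may well identify two of the values.\<close>

lemma rel_graph_at:
  assumes "small A" "discrete f A" "a \<in> A"
  shows "p ||- fm_rel (graph f g A) (f a) y \<longleftrightarrow> p ||- (y \<^bold>= g a)"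
  unfolding rel_graph[OF assms(1)]
proof
  assume "dens p (\<lambda>r. \<exists>b\<in>A. r ||- (f a \<^bold>= f b) \<and> r ||- (y \<^bold>= g b))"
  then show "p ||- (y \<^bold>= g a)"
  proof (rule forces_bind)
    fix r assume "r \<sqsubseteq> p" "\<exists>b\<in>A. r ||- (f a \<^bold>= f b) \<and> r ||- (y \<^bold>= g b)"
    then show "r ||- (y \<^bold>= g a)"
      using discreteD[OF assms(2,3)] FieldI1 by metis
  qed
next
  assume "p ||- (y \<^bold>= g a)"
  then show "dens p (\<lambda>r. \<exists>b\<in>A. r ||- (f a \<^bold>= f b) \<and> r ||- (y \<^bold>= g b))"
    using assms(3) eq_refl forces_mono by (intro densI) blast
qed

lemma function_on_graph:
  assumes "small A" "discrete f A"
  shows "p ||- fm_function_on (graph f g A) (chk (f ` A))"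
proof -
  have 1: "p ||- AllIn (graph f g A) (\<lambda>z. ExIn (chk (f ` A)) (\<lambda>a. \<^bold>\<exists>b. fm_pair z a b))"
    unfolding graph_def
  proof (subst AllIn_chk)
    show "\<forall>u\<in>(\<lambda>a. pr (f a) (g a)) ` A. p ||- ExIn (chk (f ` A)) (\<lambda>a. \<^bold>\<exists>b. fm_pair u a b)"
    proof
      fix u assume "u \<in> (\<lambda>a. pr (f a) (g a)) ` A"
      then obtain a where a: "a \<in> A" "u = pr (f a) (g a)" by blast
      show "p ||- ExIn (chk (f ` A)) (\<lambda>a. \<^bold>\<exists>b. fm_pair u a b)"
        by (rule fr_ExInI[where x = "f a"], use a assms in \<open>auto intro!: mem_chkI small_image\<close>)
           (rule fr_ExistsI[where x = "g a"], simp add: fr_pair eq_refl)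
    qed
  qed (auto intro!: fcong small_image assms)
  have 2: "p ||- AllIn (chk (f ` A)) (\<lambda>a. \<^bold>\<exists>b. fm_rel (graph f g A) a b \<^bold>\<and>
      (\<^bold>\<forall>c. fm_rel (graph f g A) a c \<^bold>\<longrightarrow> c \<^bold>= b))"
  proof (subst AllIn_chk)
    show "\<forall>u\<in>f ` A. p ||- (\<^bold>\<exists>b. fm_rel (graph f g A) u b \<^bold>\<and> (\<^bold>\<forall>c. fm_rel (graph f g A) u c \<^bold>\<longrightarrow> c \<^bold>= b))"
    proof
      fix u assume "u \<in> f ` A"
      then obtain a where a: "a \<in> A" "u = f a" by blast
      show "p ||- (\<^bold>\<exists>b. fm_rel (graph f g A) u b \<^bold>\<and> (\<^bold>\<forall>c. fm_rel (graph f g A) u c \<^bold>\<longrightarrow> c \<^bold>= b))"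
        by (rule fr_ExistsI[where x = "g a"]) (simp add: a rel_graph_at assms eq_refl fr_Imp)
    qed
  qed (auto intro!: fcong small_image assms)
  show ?thesis unfolding fm_function_on_def using 1 2 by simp
qed

lemma injection_graph:
  assumes "small A" "discrete f A" "discrete h B" "small B" "inj_on g A" "g ` A \<subseteq> B"
  shows "p ||- fm_injection (graph f (\<lambda>a. h (g a)) A) (chk (f ` A)) (chk (h ` B))"
proof -
  let ?F = "graph f (\<lambda>a. h (g a)) A"
  have 2: "p ||- AllIn (chk (f ` A)) (\<lambda>a. \<^bold>\<forall>b. fm_rel ?F a b \<^bold>\<longrightarrow> b \<^bold>\<in> chk (h ` B))"
  proof (subst AllIn_chk)
    have "q ||- (b \<^bold>\<in> chk (h ` B))" if "a \<in> A" "q ||- (b \<^bold>= h (g a))" for a b q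
      using mem_cong1[OF eq_sym[OF that(2)]] mem_chkI[of "h ` B"] that assms small_image by blast
    then show "\<forall>u\<in>f ` A. p ||- (\<^bold>\<forall>b. fm_rel ?F u b \<^bold>\<longrightarrow> b \<^bold>\<in> chk (h ` B))"
      by (auto simp: rel_graph_at assms fr_Imp)
  qed (auto intro!: fcong small_image assms)
  have 3: "p ||- AllIn (chk (f ` A)) (\<lambda>a. AllIn (chk (f ` A)) (\<lambda>a'. \<^bold>\<forall>b. fm_rel ?F a b \<^bold>\<and> fm_rel ?F a' b \<^bold>\<longrightarrow> a \<^bold>= a'))"
  proof (subst AllIn_chk)
    show "\<forall>u\<in>f ` A. p ||- AllIn (chk (f ` A)) (\<lambda>a'. \<^bold>\<forall>b. fm_rel ?F u b \<^bold>\<and> fm_rel ?F a' b \<^bold>\<longrightarrow> u \<^bold>= a')"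
    proof
      fix u assume "u \<in> f ` A"
      then obtain a where a: "a \<in> A" "u = f a" by blast
      have *: "q ||- (f a \<^bold>= f a')" if "a' \<in> A" "q \<sqsubseteq> p" "q ||- (b \<^bold>= h (g a))" "q ||- (b \<^bold>= h (g a'))" for a' b q
      proof -
        have "q ||- (h (g a) \<^bold>= h (g a'))" using that eq_sym eq_trans by blast
        \<comment> \<open>Values that are forced equal are the same element by discreteness of
          \<open>h\<close>; injectivity of \<open>g\<close> in the ground model then identifies the
          arguments.\<close>
        then have "g a = g a'"
          using discreteD[OF assms(3), of "g a" "g a'" q] that(1,2) a(1) assms(6) FieldI1 by fast
        then show ?thesis using assms(5) a that by (metis eq_refl inj_onD)
      qed
      show "p ||- AllIn (chk (f ` A)) (\<lambda>a'. \<^bold>\<forall>b. fm_rel ?F u b \<^bold>\<and> fm_rel ?F a' b \<^bold>\<longrightarrow> u \<^bold>= a')"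
      proof (subst AllIn_chk)
        show "\<forall>a'\<in>f ` A. p ||- (\<^bold>\<forall>b. fm_rel ?F u b \<^bold>\<and> fm_rel ?F a' b \<^bold>\<longrightarrow> u \<^bold>= a')"
          by (simp add: a fr_Imp rel_graph_at[OF assms(1,2)] del: dens_forces) (blast intro: *)
      qed (auto intro!: fcong small_image assms)
    qed
  qed (auto intro!: fcong small_image assms)
  show ?thesis unfolding fm_injection_def using 2 3 function_on_graph[OF assms(1,2)] by simp
qed

section \<open>Zero and successor\<close>

lemma fr_empty: "p ||- fm_empty (chk {})"
  by (simp add: fm_empty_def mem_chk small_finite dens_def) (blast dest: le_refl1)

lemma empty_unique: "p ||- fm_empty x \<Longrightarrow> p ||- (x \<^bold>= chk {})"
  unfolding fr_ext feq_def
proof (intro allI impI)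
  fix z q assume e: "p ||- fm_empty x" and q: "q \<sqsubseteq> p"
  have "\<not> q ||- (z \<^bold>\<in> x)" using e q by (simp add: fm_empty_def)
  moreover have "\<not> q ||- (z \<^bold>\<in> chk {})" using fr_empty[of p] q by (simp add: fm_empty_def)
  ultimately show "q ||- (z \<^bold>\<in> x) \<longleftrightarrow> q ||- (z \<^bold>\<in> chk {})" by simp
qed

lemma not_empty: "p ||- (x \<^bold>\<in> y) \<Longrightarrow> p ||- (\<^bold>\<not> fm_empty y)"
  unfolding fm_empty_def forces.simps(3-5) using forces_mono le_refl1 by blast

lemma fr_succ:
  assumes "small S"
  shows "p ||- fm_succ (chk (insert (chk S) S)) (chk S)"
proof -
  have s: "small (insert (chk S) S)"
    using small_Un[OF small_finite[of "{chk S}"] assms] by simp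
  show ?thesis
    unfolding fm_succ_def forces.simps(3-5) fr_Equ feq_def fr_Disj mem_chk[OF assms] mem_chk[OF s]
  proof (intro allI impI iffI)
    fix z q assume "dens q (\<lambda>r. \<exists>u\<in>insert (chk S) S. r ||- (z \<^bold>= u))"
    then show "dens q (\<lambda>r. dens r (\<lambda>r. \<exists>u\<in>S. r ||- (z \<^bold>= u)) \<or> r ||- (z \<^bold>= chk S))"
      by (rule dens_imp) (auto intro!: densI dest: forces_mono)
  next
    fix z q assume "dens q (\<lambda>r. dens r (\<lambda>r. \<exists>u\<in>S. r ||- (z \<^bold>= u)) \<or> r ||- (z \<^bold>= chk S))"
    then show "dens q (\<lambda>r. \<exists>u\<in>insert (chk S) S. r ||- (z \<^bold>= u))"
    proof (rule dens_bind, elim disjE)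
      fix r assume "dens r (\<lambda>r. \<exists>u\<in>S. r ||- (z \<^bold>= u))"
      then show "dens r (\<lambda>r. \<exists>u\<in>insert (chk S) S. r ||- (z \<^bold>= u))"
        by (rule dens_imp) blast
    next
      fix r assume "r ||- (z \<^bold>= chk S)"
      then show "dens r (\<lambda>r. \<exists>u\<in>insert (chk S) S. r ||- (z \<^bold>= u))"
        using forces_mono by (intro densI) blast
    qed
  qed
qed

lemma succ_unique: "p ||- fm_succ y x \<Longrightarrow> p ||- fm_succ y' x \<Longrightarrow> p ||- (y \<^bold>= y')"
  unfolding fm_succ_def fr_ext forces.simps(3-5) fr_Equ feq_def by simp

end

section \<open>Ordinals, finite sets and cardinals in the extension\<close>

text \<open>With all fibres countable, \<open>A\<close> would be a union of \<open>|B|\<close>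
  countable sets and no larger than \<open>B\<close>. Only cardinalities are compared, so
  \<open>|A|\<close> may be singular, as lambda may be.\<close>

lemma uncountable_fibre:
  assumes "uncountable A" "|B| <o |A|" "f ` A \<subseteq> B"
  obtains b where "b \<in> B" "uncountable {a \<in> A. f a = b}"
proof (rule ccontr)
  assume "\<not> thesis"
  then have c: "b \<in> B \<Longrightarrow> countable {a \<in> A. f a = b}" for b using that by blast
  have A: "A = (\<Union>b\<in>B. {a \<in> A. f a = b})" using assms(3) by blast
  \<comment> \<open>The product of \<open>|B|\<close> and omega is \<open>|B|\<close> only for
    infinite \<open>B\<close>; a finite \<open>B\<close> would make \<open>A\<close> countable
    outright.\<close>
  have "infinite B"
  proof
    assume "finite B"
    then have "countable (\<Union>b\<in>B. {a \<in> A. f a = b})" using c by (auto intro: countable_finite)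
    then show False using A assms(1) by simp
  qed
  have "|{a \<in> A. f a = b}| \<le>o |B|" if "b \<in> B" for b
  proof -
    have "|{a \<in> A. f a = b}| \<le>o |UNIV :: nat set|"
      using c[OF that] countableE card_of_ordLeq by (metis subset_UNIV)
    also have "|UNIV :: nat set| \<le>o |B|"
      using \<open>infinite B\<close> infinite_iff_card_of_nat by blast
    finally show ?thesis .
  qed
  then have "|\<Union>b\<in>B. {a \<in> A. f a = b}| \<le>o |B|"
    by (intro card_of_UNION_ordLeq_infinite[OF \<open>infinite B\<close>] ballI)
       (auto intro: ordIso_imp_ordLeq card_of_refl)
  then have "|A| \<le>o |B|" using A by simp
  then show False using assms(2) not_ordLess_ordLeq by blast
qed

text \<open>Ordinals below lambda are represented by elements of \<open>lam\<close>:
  \<open>a\<close> stands for the order type of \<open>below a\<close>.\<close>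

locale initial_segments =
  fixes lam :: "'a rel"
  assumes wo: "Well_order lam"
begin

abbreviation below :: "'a \<Rightarrow> 'a set" where
  "below a \<equiv> underS lam a"

lemma below_trans: "a \<in> below b \<Longrightarrow> b \<in> below c \<Longrightarrow> a \<in> below c"
  using wo unfolding well_order_on_def linear_order_on_def partial_order_on_def preorder_on_def
  by (auto simp: underS_def trans_def antisym_def)

lemma below_irrefl: "a \<notin> below a"
  by (simp add: underS_def)

lemma below_Field: "a \<in> below b \<Longrightarrow> a \<in> Field lam" "a \<in> below b \<Longrightarrow> b \<in> Field lam"
  by (auto simp: underS_def Field_def)

lemma below_total: "a \<in> Field lam \<Longrightarrow> b \<in> Field lam \<Longrightarrow> a \<noteq> b \<Longrightarrow> a \<in> below b \<or> b \<in> below a"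
  using wo unfolding well_order_on_def linear_order_on_def total_on_def underS_def by auto

lemma below_induct: "(\<And>a. (\<And>b. b \<in> below a \<Longrightarrow> Q b) \<Longrightarrow> Q a) \<Longrightarrow> Q a"
proof -
  assume step: "\<And>a. (\<And>b. b \<in> below a \<Longrightarrow> Q b) \<Longrightarrow> Q a"
  have "wf (lam - Id)" using wo by (simp add: well_order_on_def)
  then show ?thesis
    by (induction a rule: wf_induct_rule) (rule step, auto simp: underS_def)
qed

end

text \<open>The last two assumptions say that \<open>w\<close> has rank omega and that
  \<open>e n\<close> is the element of rank \<open>n\<close>.\<close>

locale ordinal_names = forcing_names P ity + initial_segments lam
  for P :: "'p rel" and ity :: "'i itself" and lam :: "'a rel" +
  fixes w :: 'a and e :: "nat \<Rightarrow> 'a"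
  assumes card_a: "|UNIV :: 'a set| \<le>o |UNIV :: 'i set|"
    and w_field: "w \<in> Field lam"
    and underS_w: "underS lam w = range e"
    and underS_e: "underS lam (e n) = e ` {..<n}"
begin

lemma small_a: "small (A :: 'a set)"
  using small_subset[of "UNIV :: 'a set" A] card_a by (simp add: small_for_def)

definition ordn :: "'a \<Rightarrow> ('i, 'p) name" where
  "ordn = check_elem P lam"

lemma ordn_chk: "ordn a = chk (ordn ` below a)"
  unfolding ordn_def chk_def by (rule check_elem_unfold[OF wo])

lemma small_ordn: "small (ordn ` A)"
  by (intro small_image small_a)

text \<open>If \<open>a\<close> and a smaller \<open>b\<close> were forced equal, then
  \<open>b\<close> would be forced into itself, and a stronger condition would equate
  \<open>b\<close> with some smaller \<open>c\<close>, against the induction hypothesis for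
  \<open>b\<close>.\<close>

lemma discrete_ordn: "discrete ordn (Field lam)"
proof -
  have *: "\<forall>b\<in>below a. \<forall>r\<in>Field P. \<not> r ||- (ordn a \<^bold>= ordn b)" for a
  proof (induction a rule: below_induct)
    case (1 a)
    show ?case
    proof (intro ballI notI)
      fix b r assume b: "b \<in> below a" and r: "r \<in> Field P" "r ||- (ordn a \<^bold>= ordn b)"
      have "r ||- (ordn b \<^bold>\<in> chk (ordn ` below a))" using b by (intro mem_chkI small_ordn) auto
      then have "r ||- (ordn b \<^bold>\<in> ordn b)" using mem_cong2[OF r(2)] by (simp add: ordn_chk[symmetric])
      then have "r ||- (ordn b \<^bold>\<in> chk (ordn ` below b))" by (simp add: ordn_chk[symmetric])
      then have "dens r (\<lambda>r. \<exists>u\<in>ordn ` below b. r ||- (ordn b \<^bold>= u))" by (simp add: mem_chk small_ordn)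
      then obtain r' c where "r' \<sqsubseteq> r" "c \<in> below b" "r' ||- (ordn b \<^bold>= ordn c)"
        using densD[OF _ le_refl[OF r(1)]] by blast
      then show False using 1[OF b] FieldI1 by metis
    qed
  qed
  show ?thesis unfolding discrete_def
  proof (intro ballI impI)
    fix a b r assume ab: "a \<in> Field lam" "b \<in> Field lam" and r: "r \<in> Field P" "r ||- (ordn a \<^bold>= ordn b)"
    show "a = b"
      using below_total[OF ab] * r eq_sym by blast
  qed
qed

lemma discrete_ordn': "A \<subseteq> Field lam \<Longrightarrow> discrete ordn A"
  using discrete_ordn unfolding discrete_def by blast

lemma below_sub: "below a \<subseteq> Field lam"
  using below_Field by blast

lemma ordn_eq: "a \<in> Field lam \<Longrightarrow> b \<in> Field lam \<Longrightarrow> p \<in> Field P \<Longrightarrow> p ||- (ordn a \<^bold>= ordn b) \<longleftrightarrow> a = b"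
  by (rule discreteD[OF discrete_ordn])

lemma ordn_mem: "a \<in> Field lam \<Longrightarrow> p \<in> Field P \<Longrightarrow> p ||- (ordn a \<^bold>\<in> ordn b) \<longleftrightarrow> a \<in> below b"
  by (subst ordn_chk[of b]) (rule discrete_mem[OF discrete_ordn below_sub _ _ small_a])

lemma ordn_memI: "a \<in> below b \<Longrightarrow> p ||- (ordn a \<^bold>\<in> ordn b)"
  by (subst ordn_chk[of b]) (auto intro!: mem_chkI small_ordn)

lemma AllIn_ordn: "resp A \<Longrightarrow> p ||- AllIn (ordn b) A \<longleftrightarrow> (\<forall>a\<in>below b. p ||- A (ordn a))"
  by (subst ordn_chk[of b]) (auto simp: AllIn_chk small_ordn)

lemma ExIn_ordn: "resp A \<Longrightarrow> p ||- ExIn (ordn b) A \<longleftrightarrow> dens p (\<lambda>r. \<exists>a\<in>below b. r ||- A (ordn a))"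
  by (subst ordn_chk[of b]) (auto simp: ExIn_chk small_ordn)

text \<open>Stated for downward closed sets, because lambda is the order type of the whole field and
  is not \<open>ordn a\<close> for any \<open>a\<close> in it.\<close>

lemma ordinal_chk:
  assumes "\<And>a b. a \<in> below b \<Longrightarrow> b \<in> A \<Longrightarrow> a \<in> A"
  shows "p ||- fm_ordinal (chk (ordn ` A))"
proof -
  have 1: "p ||- fm_transitive (chk (ordn ` A))"
    unfolding fm_transitive_def fm_subset_def
  proof (subst AllIn_chk)
    show "\<forall>u\<in>ordn ` A. p ||- AllIn u (\<lambda>z. z \<^bold>\<in> chk (ordn ` A))"
      using assms by (auto intro!: mem_chkI small_ordn simp: AllIn_ordn fcong)
  qed (auto intro!: fcong small_ordn)
  have 2: "p ||- AllIn (chk (ordn ` A)) fm_transitive"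
    unfolding fm_transitive_def fm_subset_def
  proof (subst AllIn_chk)
    show "\<forall>u\<in>ordn ` A. p ||- AllIn u (\<lambda>y. AllIn y (\<lambda>z. z \<^bold>\<in> u))"
      using below_trans by (auto intro!: ordn_memI simp: AllIn_ordn fcong)
  qed (auto intro!: fcong small_ordn)
  show ?thesis unfolding fm_ordinal_def using 1 2 by simp
qed

lemma ordinal_ordn: "p ||- fm_ordinal (ordn a)"
  by (subst ordn_chk) (rule ordinal_chk, rule below_trans)

lemma succ_ordn: "below b = insert a (below a) \<Longrightarrow> p ||- fm_succ (ordn b) (ordn a)"
  using fr_succ[OF small_ordn[of "below a"], of p] ordn_chk[of b] by (simp add: ordn_chk[symmetric])

lemma succ_ordnD:
  assumes "p ||- fm_succ (ordn b) (ordn a)" "a \<in> Field lam" "b \<in> Field lam" "p \<in> Field P"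
  shows "below b = insert a (below a)"
proof (rule set_eqI)
  fix c
  show "c \<in> below b \<longleftrightarrow> c \<in> insert a (below a)"
  proof (cases "c \<in> Field lam")
    case True
    have "feq p (ordn c \<^bold>\<in> ordn b) (ordn c \<^bold>\<in> ordn a \<^bold>\<or> ordn c \<^bold>= ordn a)"
      using assms(1) by (simp add: fm_succ_def fr_Equ)
    then have "p ||- (ordn c \<^bold>\<in> ordn b) \<longleftrightarrow> p ||- (ordn c \<^bold>\<in> ordn a \<^bold>\<or> ordn c \<^bold>= ordn a)"
      using le_refl[OF assms(4)] by (simp add: feq_def)
    \<comment> \<open>All conditions below \<open>p\<close> decide both atomic formulas in the same
      way, so the density in the clause for disjunction disappears.\<close>
    moreover have "r ||- (ordn c \<^bold>\<in> ordn a) \<or> r ||- (ordn c \<^bold>= ordn a) \<longleftrightarrow> c \<in> insert a (below a)"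
      if "r \<sqsubseteq> p" for r
      using that True assms(2,3) by (auto simp: ordn_mem ordn_eq FieldI1)
    then have "p ||- (ordn c \<^bold>\<in> ordn a \<^bold>\<or> ordn c \<^bold>= ordn a) \<longleftrightarrow> c \<in> insert a (below a)"
      unfolding fr_Disj dens_def using le_refl[OF assms(4)] le_trans le_refl1 by meson
    ultimately show ?thesis using True assms(4) by (simp add: ordn_mem)
  next
    case False
    then show ?thesis using assms(2) below_Field by blast
  qed
qed

section \<open>The ordinal omega\<close>

lemma e_below: "e n \<in> below w" by (simp add: underS_w)

lemma e_Field: "e n \<in> Field lam" using e_below below_Field by blast

lemma e_inj: "e i = e j \<Longrightarrow> i = j"
proof -
  have *: "e i \<noteq> e j" if "i < j" for i j
  proof -
    have "e i \<in> below (e j)" using that underS_e[of j] by blast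
    then show ?thesis using below_irrefl by metis
  qed
  then show "e i = e j \<Longrightarrow> i = j" by (metis linorder_neqE_nat)
qed

lemma below_e_Suc: "below (e (Suc n)) = insert (e n) (below (e n))"
  by (simp add: underS_e lessThan_Suc)

lemma omega_ordn: "p ||- fm_omega (ordn w)"
proof -
  have 1: "p ||- (\<^bold>\<not> fm_empty (ordn w))"
    by (rule not_empty[OF ordn_memI[OF e_below[of 0]]])
  have 2: "p ||- AllIn (ordn w) (\<lambda>x. ExIn (ordn w) (\<lambda>y. fm_succ y x))"
  proof (subst AllIn_ordn)
    have "p ||- ExIn (ordn w) (\<lambda>y. fm_succ y (ordn (e n)))" for n
      by (rule fr_ExInI[where x = "ordn (e (Suc n))"]) (auto intro: ordn_memI e_below succ_ordn[OF below_e_Suc])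
    then show "\<forall>a\<in>below w. p ||- ExIn (ordn w) (\<lambda>y. fm_succ y (ordn a))"
      by (auto simp: underS_w)
  qed (auto intro!: fcong)
  have 3: "p ||- AllIn (ordn w) (\<lambda>x. fm_empty x \<^bold>\<or> ExIn x (\<lambda>y. fm_succ x y))"
  proof (subst AllIn_ordn)
    have "p ||- (fm_empty (ordn (e n)) \<^bold>\<or> ExIn (ordn (e n)) (\<lambda>y. fm_succ (ordn (e n)) y))" for n
    proof (cases n)
      case 0
      have "ordn (e 0) = chk {}" by (subst ordn_chk) (simp add: underS_e)
      then have "q ||- fm_empty (ordn (e 0))" for q using fr_empty by simp
      then show ?thesis unfolding fr_Disj 0 by (intro densI) blast
    next
      case (Suc k)
      have "q ||- ExIn (ordn (e n)) (\<lambda>y. fm_succ (ordn (e n)) y)" for q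
        by (rule fr_ExInI[where x = "ordn (e k)"])
           (auto intro!: ordn_memI succ_ordn[OF below_e_Suc] simp: Suc below_e_Suc)
      then show ?thesis unfolding fr_Disj by (intro densI) blast
    qed
    then show "\<forall>a\<in>below w. p ||- (fm_empty (ordn a) \<^bold>\<or> ExIn (ordn a) (\<lambda>y. fm_succ (ordn a) y))"
      by (auto simp: underS_w)
  qed (auto intro!: fcong)
  show ?thesis unfolding fm_omega_def using 1 2 3 ordinal_ordn by simp
qed

text \<open>\<open>fm_finite\<close> quantifies over an unspecified omega, so any set satisfying
  \<open>fm_omega\<close> has to be brought back to \<open>ordn w\<close>. One inclusion uses that a
  member of \<open>x\<close> is zero or the successor of one of its own members, the other that
  \<open>x\<close> is nonempty, transitive and closed under successor.\<close>

lemma omega_unique: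
  assumes om: "p ||- fm_omega x"
  shows "p ||- (x \<^bold>= ordn w)"
proof -
  have tr: "q ||- (z \<^bold>\<in> x)" if "q \<sqsubseteq> p" "q ||- (y \<^bold>\<in> x)" "q ||- (z \<^bold>\<in> y)" for q y z
  proof -
    have "p ||- AllIn x (\<lambda>y. AllIn y (\<lambda>z. z \<^bold>\<in> x))"
      using om by (simp add: fm_omega_def fm_ordinal_def fm_transitive_def fm_subset_def)
    then have "q ||- AllIn y (\<lambda>z. z \<^bold>\<in> x)" using that(1,2) unfolding fr_AllIn[of x] by blast
    then show ?thesis using that(3) le_refl1[OF that(1)] unfolding fr_AllIn by blast
  qed
  have ne: "p ||- (\<^bold>\<not> fm_empty x)"
    and suc: "p ||- AllIn x (\<lambda>y. ExIn x (\<lambda>z. fm_succ z y))"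
    and pred: "p ||- AllIn x (\<lambda>y. fm_empty y \<^bold>\<or> ExIn y (\<lambda>z. fm_succ y z))"
    using om unfolding fm_omega_def forces.simps(3-5) by blast+
  \<comment> \<open>Induction on the name \<open>y\<close> stands in for foundation in the
    extension. The predecessor of \<open>y\<close> is an arbitrary name, so it is first replaced,
    densely, by a name listed in \<open>y\<close>.\<close>
  have sub: "\<forall>q. q \<sqsubseteq> p \<longrightarrow> q ||- (y \<^bold>\<in> x) \<longrightarrow> q ||- (y \<^bold>\<in> ordn w)" for y
  proof (induction y rule: wf_induct_rule[OF wf_subname])
    case (1 y)
    show ?case
    proof (intro allI impI)
      fix q assume q: "q \<sqsubseteq> p" "q ||- (y \<^bold>\<in> x)"
      then have "q ||- (fm_empty y \<^bold>\<or> ExIn y (\<lambda>z. fm_succ y z))" using pred unfolding fr_AllIn by blast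
      then have "dens q (\<lambda>r. r ||- fm_empty y \<or> r ||- ExIn y (\<lambda>z. fm_succ y z))" unfolding fr_Disj .
      then show "q ||- (y \<^bold>\<in> ordn w)"
      proof (rule forces_bind, elim disjE)
        fix r assume "r ||- fm_empty y"
        then have "r ||- (y \<^bold>= ordn (e 0))"
          using empty_unique by (subst ordn_chk) (simp add: underS_e)
        then show "r ||- (y \<^bold>\<in> ordn w)"
          using mem_cong1[OF eq_sym ordn_memI[OF e_below]] by blast
      next
        fix r assume r: "r \<sqsubseteq> q" and "r ||- ExIn y (\<lambda>z. fm_succ y z)"
        then have "dens r (\<lambda>r. \<exists>z. r ||- (z \<^bold>\<in> y) \<and> r ||- fm_succ y z)" unfolding fr_ExIn by blast
        then show "r ||- (y \<^bold>\<in> ordn w)"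
        proof (rule forces_bind, elim exE conjE)
          fix r1 z assume r1: "r1 \<sqsubseteq> r" and z: "r1 ||- (z \<^bold>\<in> y)" "r1 ||- fm_succ y z"
          have "dens r1 (\<lambda>r. \<exists>v\<in>elts y. r \<sqsubseteq> snd v \<and> r ||- (z \<^bold>= fst v))" using z(1) by (simp add: fr_Mem)
          then show "r1 ||- (y \<^bold>\<in> ordn w)"
          proof (rule forces_bind, elim bexE conjE)
            fix r2 v assume r2: "r2 \<sqsubseteq> r1" and v: "v \<in> elts y" "r2 \<sqsubseteq> snd v" "r2 ||- (z \<^bold>= fst v)"
            have r2p: "r2 \<sqsubseteq> p" and r2q: "r2 \<sqsubseteq> q" using r2 r1 r q(1) le_trans by blast+
            have "r2 ||- (fst v \<^bold>\<in> x)"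
              by (rule tr[OF r2p forces_mono[OF q(2) r2q] elts_mem[OF v(1,2)]])
            then have "r2 ||- (fst v \<^bold>\<in> ordn w)" using 1 v(1) r2p by blast
            then have "dens r2 (\<lambda>r. \<exists>u\<in>ordn ` below w. r ||- (fst v \<^bold>= u))"
              by (subst (asm) ordn_chk) (simp add: mem_chk small_ordn)
            then show "r2 ||- (y \<^bold>\<in> ordn w)"
            proof (rule forces_bind)
              fix r3 assume r3: "r3 \<sqsubseteq> r2" and "\<exists>u\<in>ordn ` below w. r3 ||- (fst v \<^bold>= u)"
              then obtain n where n: "r3 ||- (fst v \<^bold>= ordn (e n))" by (auto simp: underS_w)
              have "r3 ||- (z \<^bold>= ordn (e n))" using eq_trans[OF forces_mono[OF v(3) r3] n] .
              then have "feq r3 (fm_succ y z) (fm_succ y (ordn (e n)))" by (intro fcong)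
              then have "r3 ||- fm_succ y (ordn (e n))"
                using feq_fr forces_mono[OF z(2) le_trans[OF r3 r2]] by blast
              then have "r3 ||- (y \<^bold>= ordn (e (Suc n)))"
                using succ_unique succ_ordn[OF below_e_Suc] by blast
              then show "r3 ||- (y \<^bold>\<in> ordn w)"
                using mem_cong1[OF eq_sym ordn_memI[OF e_below]] by blast
            qed
          qed
        qed
      qed
    qed
  qed
  have mem_n: "p ||- (ordn (e n) \<^bold>\<in> x)" for n
  proof (induction n)
    case 0
    show ?case
    proof (rule forces_dens, rule densI_ex)
      fix q assume q: "q \<sqsubseteq> p"
      then have "\<not> q ||- fm_empty x" using ne by simp
      then obtain z r where r: "r \<sqsubseteq> q" "r ||- (z \<^bold>\<in> x)" by (auto simp: fm_empty_def)
      then have "r ||- (z \<^bold>\<in> ordn w)" using sub le_trans q by blast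
      then have "dens r (\<lambda>r. \<exists>u\<in>ordn ` below w. r ||- (z \<^bold>= u))"
        by (subst (asm) ordn_chk) (simp add: mem_chk small_ordn)
      then obtain r' n where r': "r' \<sqsubseteq> r" "r' ||- (z \<^bold>= ordn (e n))"
        using densD[OF _ le_refl1[OF r(1)]] unfolding underS_w by blast
      have m: "r' ||- (ordn (e n) \<^bold>\<in> x)" using mem_cong1[OF r'(2)] forces_mono[OF r(2) r'(1)] by blast
      \<comment> \<open>By the inclusion already shown, the member found in \<open>x\<close> is some
        \<open>e n\<close>; transitivity of \<open>x\<close> leads from there down to zero.\<close>
      have "r' ||- (ordn (e 0) \<^bold>\<in> x)"
      proof (cases "n = 0")
        case False
        then have "e 0 \<in> below (e n)" by (auto simp: underS_e)
        then show ?thesis using tr[OF _ m ordn_memI] le_trans r r' q by blast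
      qed (use m in simp)
      then show "\<exists>r. r \<sqsubseteq> q \<and> r ||- (ordn (e 0) \<^bold>\<in> x)" using le_trans r r' by blast
    qed
  next
    case (Suc n)
    have "p ||- ExIn x (\<lambda>z. fm_succ z (ordn (e n)))"
      by (rule forces_dens, rule densI) (use suc forces_mono[OF Suc] in \<open>unfold fr_AllIn, blast\<close>)
    then have "dens p (\<lambda>r. \<exists>z. r ||- (z \<^bold>\<in> x) \<and> r ||- fm_succ z (ordn (e n)))" unfolding fr_ExIn .
    then show ?case
      by (rule forces_bind) (use mem_cong1 succ_unique succ_ordn[OF below_e_Suc] in blast)
  qed
  have "q ||- (u \<^bold>\<in> x)" if "q \<sqsubseteq> p" "q ||- (u \<^bold>\<in> chk (ordn ` below w))" for q u
    by (rule forces_bind[OF that(2)[unfolded mem_chk[OF small_ordn]]]) (use forces_mono[OF mem_n] le_trans that(1) mem_cong1 eq_sym in \<open>unfold underS_w, blast\<close>)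
  then have "feq p (z \<^bold>\<in> x) (z \<^bold>\<in> ordn w)" for z
    unfolding feq_def using sub by (subst ordn_chk) (auto simp: ordn_chk[symmetric])
  then show ?thesis unfolding fr_ext by blast
qed

section \<open>Finite and infinite sets in the extension\<close>

lemma finiteI: "p ||- fm_injection f X (ordn (e n)) \<Longrightarrow> p ||- fm_finite X"
  unfolding fm_finite_def
  by (rule fr_ExistsI[where x = "ordn w"], unfold forces.simps(3-5), intro conjI omega_ordn,
      rule fr_ExInI[OF ordn_memI[OF e_below]], rule fr_ExistsI)

lemma finiteD:
  assumes "p ||- fm_finite X"
  shows "dens p (\<lambda>r. \<exists>n f. r ||- fm_injection f X (ordn (e n)))"
proof -
  have "dens p (\<lambda>r. \<exists>x. r ||- fm_omega x \<and> r ||- ExIn x (\<lambda>n. \<^bold>\<exists>f. fm_injection f X n))"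
    using assms by (simp add: fm_finite_def fr_Exists)
  then show ?thesis
  proof (rule dens_bind, elim exE conjE)
    fix r x assume x: "r ||- fm_omega x" "r ||- ExIn x (\<lambda>n. \<^bold>\<exists>f. fm_injection f X n)"
    have "feq r (ExIn x (\<lambda>n. \<^bold>\<exists>f. fm_injection f X n)) (ExIn (ordn w) (\<lambda>n. \<^bold>\<exists>f. fm_injection f X n))"
      using omega_unique[OF x(1)] by (intro fcong)
    then have "r ||- ExIn (ordn w) (\<lambda>n. \<^bold>\<exists>f. fm_injection f X n)" using x(2) feq_fr by blast
    then have "dens r (\<lambda>r. \<exists>a\<in>below w. r ||- (\<^bold>\<exists>f. fm_injection f X (ordn a)))"
      by (subst (asm) ExIn_ordn) (auto intro!: fcong)
    then show "dens r (\<lambda>r. \<exists>n f. r ||- fm_injection f X (ordn (e n)))"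
    proof (rule dens_bind)
      fix r assume "\<exists>a\<in>below w. r ||- (\<^bold>\<exists>f. fm_injection f X (ordn a))"
      then obtain n where "r ||- (\<^bold>\<exists>f. fm_injection f X (ordn (e n)))" by (auto simp: underS_w)
      then show "dens r (\<lambda>r. \<exists>n f. r ||- fm_injection f X (ordn (e n)))"
        unfolding fr_Exists by (rule dens_imp) blast
    qed
  qed
qed

lemma injection_value:
  assumes "p ||- fm_injection f X Y" "p ||- (u \<^bold>\<in> X)"
  shows "dens p (\<lambda>r. \<exists>b. r ||- fm_rel f u b \<and> r ||- (b \<^bold>\<in> Y))"
proof (rule densI_ex)
  fix q assume q: "q \<sqsubseteq> p"
  have "p ||- AllIn X (\<lambda>a. \<^bold>\<exists>b. fm_rel f a b \<^bold>\<and> (\<^bold>\<forall>c. fm_rel f a c \<^bold>\<longrightarrow> c \<^bold>= b))"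
    using assms(1) by (simp add: fm_injection_def fm_function_on_def)
  then have "q ||- (\<^bold>\<exists>b. fm_rel f u b \<^bold>\<and> (\<^bold>\<forall>c. fm_rel f u c \<^bold>\<longrightarrow> c \<^bold>= b))"
    using q forces_mono[OF assms(2) q] unfolding fr_AllIn by blast
  then obtain r b where r: "r \<sqsubseteq> q" "r ||- fm_rel f u b"
    unfolding fr_Exists dens_def using le_refl1[OF q] by fastforce
  have "p ||- AllIn X (\<lambda>a. \<^bold>\<forall>b. fm_rel f a b \<^bold>\<longrightarrow> b \<^bold>\<in> Y)"
    using assms(1) unfolding fm_injection_def forces.simps(3-5) by blast
  then have "q ||- (\<^bold>\<forall>b. fm_rel f u b \<^bold>\<longrightarrow> b \<^bold>\<in> Y)"
    using q forces_mono[OF assms(2) q] unfolding fr_AllIn by blast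
  then have "r ||- (b \<^bold>\<in> Y)" using r by (simp add: fr_Imp)
  then show "\<exists>r. r \<sqsubseteq> q \<and> (\<exists>b. r ||- fm_rel f u b \<and> r ||- (b \<^bold>\<in> Y))" using r by blast
qed

lemma injection_inj:
  assumes "p ||- fm_injection f X Y" "q \<sqsubseteq> p" "q ||- (u \<^bold>\<in> X)" "q ||- (v \<^bold>\<in> X)"
    "q ||- fm_rel f u b" "q ||- fm_rel f v b"
  shows "q ||- (u \<^bold>= v)"
proof -
  have "p ||- AllIn X (\<lambda>a. AllIn X (\<lambda>a'. \<^bold>\<forall>b. fm_rel f a b \<^bold>\<and> fm_rel f a' b \<^bold>\<longrightarrow> a \<^bold>= a'))"
    using assms(1) unfolding fm_injection_def forces.simps(3-5) by blast
  then have "q ||- AllIn X (\<lambda>a'. \<^bold>\<forall>b. fm_rel f u b \<^bold>\<and> fm_rel f a' b \<^bold>\<longrightarrow> u \<^bold>= a')"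
    using assms(2,3) unfolding fr_AllIn[of X] by blast
  then have "q ||- (\<^bold>\<forall>b. fm_rel f u b \<^bold>\<and> fm_rel f v b \<^bold>\<longrightarrow> u \<^bold>= v)"
    using assms(2,4) le_refl1 unfolding fr_AllIn[of X] by blast
  then show ?thesis using assms le_refl1 by (simp add: fr_Imp)
qed

text \<open>The sets of size \<open>N\<close> may change with \<open>N\<close> and with the
  condition, since the sets of predecessors in the generic order are not in the ground model. An
  injection into \<open>n\<close> contradicts the pigeonhole principle once its values at
  \<open>n + 1\<close> distinct members are decided.\<close>

lemma not_finiteI:
  assumes "\<And>q N. q \<sqsubseteq> p \<Longrightarrow> \<exists>r f. \<exists>A :: 'b set. r \<sqsubseteq> q \<and> finite A \<and> card A = N \<and>
    discrete f A \<and> (\<forall>a\<in>A. r ||- (f a \<^bold>\<in> X))"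
  shows "p ||- (\<^bold>\<not> fm_finite X)"
  unfolding fr_Neg
proof (intro allI impI notI)
  fix q assume q: "q \<sqsubseteq> p" "q ||- fm_finite X"
  then obtain q1 n F where q1: "q1 \<sqsubseteq> q" and F: "q1 ||- fm_injection F X (ordn (e n))"
    using densD[OF finiteD le_refl1[OF q(1)]] by blast
  obtain r f and A :: "'b set" where r: "r \<sqsubseteq> q1" and A: "finite A" "card A = Suc n"
    and f: "discrete f A" "\<forall>a\<in>A. r ||- (f a \<^bold>\<in> X)"
    using assms[OF le_trans[OF q1 q(1)], of "Suc n"] by blast
  have "\<exists>r' k. r' \<sqsubseteq> r \<and> (\<forall>a\<in>B. k a < n \<and> r' ||- fm_rel F (f a) (ordn (e (k a))))" if "B \<subseteq> A" for B
    using finite_subset[OF that A(1)] that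
  proof (induction B rule: finite_induct)
    case empty
    then show ?case using le_refl1[OF r] by blast
  next
    case (insert a B)
    then obtain r' k where r': "r' \<sqsubseteq> r" "\<forall>a\<in>B. k a < n \<and> r' ||- fm_rel F (f a) (ordn (e (k a)))"
      by blast
    have "a \<in> A" using insert.prems by blast
    then have "r' ||- (f a \<^bold>\<in> X)" using f(2) forces_mono[OF _ r'(1)] by blast
    from densD[OF injection_value[OF forces_mono[OF F le_trans[OF r'(1) r]] this] le_refl1[OF r'(1)]]
    obtain r1 b where r1: "r1 \<sqsubseteq> r'" "r1 ||- fm_rel F (f a) b" "r1 ||- (b \<^bold>\<in> ordn (e n))" by blast
    from r1(3) have "dens r1 (\<lambda>r. \<exists>u\<in>ordn ` below (e n). r ||- (b \<^bold>= u))"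
      by (subst (asm) ordn_chk) (simp add: mem_chk small_ordn)
    then obtain r2 j where r2: "r2 \<sqsubseteq> r1" "j < n" "r2 ||- (b \<^bold>= ordn (e j))"
      using densD[OF _ le_refl1[OF r1(1)]] unfolding underS_e by blast
    have "feq r2 (fm_rel F (f a) b) (fm_rel F (f a) (ordn (e j)))"
      using r2 by (intro fcong)
    then have "r2 ||- fm_rel F (f a) (ordn (e j))"
      using feq_fr forces_mono[OF r1(2) r2(1)] by blast
    then have "\<forall>b\<in>insert a B. (k(a := j)) b < n \<and> r2 ||- fm_rel F (f b) (ordn (e ((k(a := j)) b)))"
      using r'(2) r2(2) forces_mono[OF _ le_trans[OF r2(1) r1(1)]] by simp
    then show ?case using le_trans[OF le_trans[OF r2(1) r1(1)] r'(1)] by blast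
  qed
  from this[OF subset_refl] obtain r' k where r': "r' \<sqsubseteq> r"
    and k: "\<forall>a\<in>A. k a < n \<and> r' ||- fm_rel F (f a) (ordn (e (k a)))" by blast
  have "\<not> inj_on k A"
    using card_inj_on_le[of k A "{..<n}"] A k by auto
  then obtain a b where ab: "a \<in> A" "b \<in> A" "a \<noteq> b" "k a = k b" by (auto simp: inj_on_def)
  have "r' ||- (f a \<^bold>= f b)"
  proof (rule injection_inj[OF F le_trans[OF r' r]])
    show "r' ||- (f a \<^bold>\<in> X)" "r' ||- (f b \<^bold>\<in> X)"
      using f(2) ab forces_mono[OF _ r'] by blast+
    show "r' ||- fm_rel F (f a) (ordn (e (k a)))" "r' ||- fm_rel F (f b) (ordn (e (k a)))"
      using k ab by metis+
  qed
  then show False using discreteD[OF f(1) ab(1,2)] FieldI1[OF r'] ab(3) by blast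
qed

lemma finite_chk:
  assumes "finite A" "discrete f A"
  shows "p ||- fm_finite (chk (f ` A))"
proof -
  obtain g where g: "bij_betw g A {..<card A}"
    using assms(1) by (metis ex_bij_betw_finite_nat atLeast0LessThan)
  have d: "discrete (\<lambda>n. ordn (e n)) {..<card A}"
    unfolding discrete_def using ordn_eq e_Field e_inj by blast
  have "p ||- fm_injection (graph f (\<lambda>a. ordn (e (g a))) A) (chk (f ` A)) (chk ((\<lambda>n. ordn (e n)) ` {..<card A}))"
    by (rule injection_graph[OF _ assms(2) d])
       (use g assms in \<open>auto simp: bij_betw_def intro: small_finite\<close>)
  moreover have "chk ((\<lambda>n. ordn (e n)) ` {..<card A}) = ordn (e (card A))"
    by (simp add: ordn_chk[of "e (card A)"] underS_e image_image)
  ultimately show ?thesis using finiteI by simp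
qed

lemma not_finite_chk:
  assumes "infinite A" "A \<subseteq> Field lam"
  shows "p ||- (\<^bold>\<not> fm_finite (chk (ordn ` A)))"
proof (rule not_finiteI)
  fix q N assume q: "q \<sqsubseteq> p"
  obtain B where "finite B" "card B = N" "B \<subseteq> A"
    using infinite_arbitrarily_large[OF assms(1)] by blast
  then show "\<exists>r f. \<exists>B :: 'a set. r \<sqsubseteq> q \<and> finite B \<and> card B = N \<and> discrete f B \<and>
      (\<forall>a\<in>B. r ||- (f a \<^bold>\<in> chk (ordn ` A)))"
    using le_refl1[OF q] discrete_ordn'[of B] assms(2)
    by (intro exI[of _ q] exI[of _ ordn] exI[of _ B]) (auto intro!: mem_chkI small_ordn)
qed

section \<open>Cardinals in the extension\<close>

text \<open>An injection into a smaller ordinal, which is a natural number, would make omega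
  finite.\<close>

lemma infinite_cardinal_omega: "p ||- fm_infinite_cardinal (ordn w)"
proof -
  have inf: "infinite (below w)"
    using e_inj by (simp add: underS_w finite_image_iff inj_on_def)
  have nf: "q ||- (\<^bold>\<not> fm_finite (ordn w))" for q
    by (subst ordn_chk) (rule not_finite_chk[OF inf below_sub])
  have "p ||- AllIn (ordn w) (\<lambda>a. \<^bold>\<not> (\<^bold>\<exists>f. fm_injection f (ordn w) a))"
  proof (subst AllIn_ordn)
    show "\<forall>a\<in>below w. p ||- (\<^bold>\<not> (\<^bold>\<exists>f. fm_injection f (ordn w) (ordn a)))"
      unfolding fr_Neg
    proof (intro ballI allI impI notI)
      fix a q assume a: "a \<in> below w" and q: "q \<sqsubseteq> p" "q ||- (\<^bold>\<exists>f. fm_injection f (ordn w) (ordn a))"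
      obtain n where n: "a = e n" using a by (auto simp: underS_w)
      obtain r f where r: "r \<sqsubseteq> q" "r ||- fm_injection f (ordn w) (ordn a)"
        using q(2) le_refl1[OF q(1)] unfolding fr_Exists dens_def by blast
      then show False using finiteI[of f "ordn w" n r] nf[of r] le_refl1 unfolding n fr_Neg by blast
    qed
  qed (auto intro!: fcong)
  then show ?thesis
    unfolding fm_infinite_cardinal_def fm_cardinal_def forces.simps(3-5)[of P] using ordinal_ordn nf by simp
qed

text \<open>Conditions that decide the values of \<open>f\<close> at the points of an uncountable fibre form an antichain.\<close>

lemma no_injection:
  assumes "ccc P" "uncountable A" "|B| <o |A|" "A \<subseteq> Field lam" "B \<subseteq> Field lam"
  shows "p ||- (\<^bold>\<not> (\<^bold>\<exists>f. fm_injection f (chk (ordn ` A)) (chk (ordn ` B))))"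
  unfolding fr_Neg
proof (intro allI impI notI)
  fix q0 assume q0: "q0 \<sqsubseteq> p" "q0 ||- (\<^bold>\<exists>f. fm_injection f (chk (ordn ` A)) (chk (ordn ` B)))"
  then obtain q f where q: "q \<sqsubseteq> q0" and f: "q ||- fm_injection f (chk (ordn ` A)) (chk (ordn ` B))"
    using le_refl1[OF q0(1)] unfolding fr_Exists dens_def by blast
  have mem: "r ||- (ordn a \<^bold>\<in> chk (ordn ` A))" if "a \<in> A" for a r
    using that by (auto intro!: mem_chkI small_ordn)
  have "\<exists>r b. r \<sqsubseteq> q \<and> b \<in> B \<and> r ||- fm_rel f (ordn a) (ordn b)" if a: "a \<in> A" for a
  proof -
    from densD[OF injection_value[OF f mem[OF a]] le_refl1[OF q]]
    obtain r y where r: "r \<sqsubseteq> q" "r ||- fm_rel f (ordn a) y" "r ||- (y \<^bold>\<in> chk (ordn ` B))" by blast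
    then obtain r' b where r': "r' \<sqsubseteq> r" "b \<in> B" "r' ||- (y \<^bold>= ordn b)"
      using densD[OF _ le_refl1[OF r(1)]] unfolding mem_chk[OF small_ordn] by blast
    have "feq r' (fm_rel f (ordn a) y) (fm_rel f (ordn a) (ordn b))"
      using r' by (intro fcong)
    then show ?thesis using feq_fr forces_mono[OF r(2) r'(1)] r' le_trans[OF r'(1) r(1)] by blast
  qed
  then obtain R g where R: "\<And>a. a \<in> A \<Longrightarrow> R a \<sqsubseteq> q" and g: "\<And>a. a \<in> A \<Longrightarrow> g a \<in> B"
    and Rg: "\<And>a. a \<in> A \<Longrightarrow> R a ||- fm_rel f (ordn a) (ordn (g a))"
    by metis
  have gAB: "g ` A \<subseteq> B" using g by (rule image_subsetI)
  obtain b where b: "uncountable {a \<in> A. g a = b}" (is "uncountable ?C")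
    by (rule uncountable_fibre[OF assms(2,3) gAB], rule that)
  have eq: "a = a'" if "a \<in> ?C" "a' \<in> ?C" "r \<sqsubseteq> R a" "r \<sqsubseteq> R a'" for a a' r
  proof -
    have ab: "a \<in> A" "a' \<in> A" "g a = b" "g a' = b" using that by auto
    have "r ||- fm_rel f (ordn a) (ordn b)" "r ||- fm_rel f (ordn a') (ordn b)"
      using Rg[OF ab(1)] Rg[OF ab(2)] forces_mono[OF _ that(3)] forces_mono[OF _ that(4)] ab(3,4)
      by auto
    moreover have "r \<sqsubseteq> q" by (rule le_trans[OF that(3) R[OF ab(1)]])
    ultimately have "r ||- (ordn a \<^bold>= ordn a')"
      using injection_inj[OF f] mem[OF ab(1)] mem[OF ab(2)] by blast
    then show ?thesis using ordn_eq ab(1,2) assms(4) FieldI1[OF that(3)] by blast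
  qed
  have inj: "inj_on R ?C"
  proof (rule inj_onI)
    fix a a' assume a: "a \<in> ?C" "a' \<in> ?C" and "R a = R a'"
    moreover have "R a \<sqsubseteq> R a" by (rule le_refl1[OF R]) (use a(1) in simp)
    ultimately show "a = a'" using eq[OF a] by simp
  qed
  have "R ` ?C \<subseteq> Field P" using FieldI1[OF R] by blast
  moreover have "pairwise (\<lambda>p q. \<not> compatible P p q) (R ` ?C)"
    unfolding pairwise_def compatible_def using eq by blast
  ultimately have "countable (R ` ?C)" using assms(1) unfolding ccc_def by blast
  then show False using countable_image_inj_on[OF _ inj] b by blast
qed

text \<open>Preservation of cardinals by the chain condition. Taking a downward closed set
  \<open>A\<close> in place of an element lets it serve both omega1 and lambda itself.\<close>

lemma infinite_cardinal_chk:
  assumes "ccc P" "uncountable A" "A \<subseteq> Field lam"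
    and "\<And>a b. a \<in> below b \<Longrightarrow> b \<in> A \<Longrightarrow> a \<in> A"
    and "\<And>a. a \<in> A \<Longrightarrow> |below a| <o |A|"
  shows "p ||- fm_infinite_cardinal (chk (ordn ` A))"
proof -
  have "p ||- AllIn (chk (ordn ` A)) (\<lambda>a. \<^bold>\<not> (\<^bold>\<exists>f. fm_injection f (chk (ordn ` A)) a))"
  proof (subst AllIn_chk)
    show "\<forall>u\<in>ordn ` A. p ||- (\<^bold>\<not> (\<^bold>\<exists>f. fm_injection f (chk (ordn ` A)) u))"
    proof
      fix u assume "u \<in> ordn ` A"
      then obtain a where a: "a \<in> A" "u = chk (ordn ` below a)" using ordn_chk by blast
      show "p ||- (\<^bold>\<not> (\<^bold>\<exists>f. fm_injection f (chk (ordn ` A)) u))"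
        unfolding a(2) by (rule no_injection[OF assms(1,2) assms(5)[OF a(1)] assms(3) below_sub])
    qed
  qed (auto intro!: fcong small_ordn)
  moreover have "p ||- fm_ordinal (chk (ordn ` A))"
    by (rule ordinal_chk) (rule assms(4))
  moreover have "p ||- (\<^bold>\<not> fm_finite (chk (ordn ` A)))"
    by (rule not_finite_chk[OF uncountable_infinite[OF assms(2)] assms(3)])
  ultimately show ?thesis
    unfolding fm_infinite_cardinal_def fm_cardinal_def forces.simps(4) by (intro conjI)
qed

end

section \<open>The skeleton named by a generic order\<close>

text \<open>The interface between forcing and combinatorics: a condition \<open>p\<close>
  contributes a finite piece \<open>le p\<close> of the order. \<open>le_restrict\<close> and
  \<open>le_meet\<close> freeze the order and the meets of the elements already present, while
  \<open>le_add\<close> and \<open>le_inf\<close> are the two density facts. The element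
  \<open>m1\<close> is the successor of \<open>m\<close>, hence the length of the sequence of
  cardinals.\<close>

locale generic_skeleton = ordinal_names P ity lam w e
  for P :: "'p rel" and ity :: "'i itself" and lam :: "'a rel" and w :: 'a and e :: "nat \<Rightarrow> 'a" +
  fixes m m1 :: 'a and le :: "'p \<Rightarrow> ('a \<times> 'a) rel" and T :: "('a \<times> 'a) set"
  assumes ccc: "ccc P"
    and uncountable_m: "uncountable (underS lam m)"
    and countable_below_m: "\<And>a. a \<in> underS lam m \<Longrightarrow> countable (underS lam a)"
    and m1_field: "m1 \<in> Field lam" and below_m1: "underS lam m1 = insert m (underS lam m)"
    and card_below: "\<And>a. a \<in> Field lam \<Longrightarrow> |underS lam a| <o |Field lam|"
    and T_iff: "\<And>t. t \<in> T \<longleftrightarrow> fst t \<in> underS lam m \<and> snd t \<in> underS lam w \<or>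
      fst t = m \<and> snd t \<in> Field lam"
    and le_mono: "\<And>p q. (q, p) \<in> P \<Longrightarrow> le p \<subseteq> le q"
    and le_T: "\<And>p. p \<in> Field P \<Longrightarrow> Field (le p) \<subseteq> T"
    and le_finite: "\<And>p. p \<in> Field P \<Longrightarrow> finite (le p)"
    and le_po: "\<And>p. p \<in> Field P \<Longrightarrow> Partial_order (le p)"
    and le_restrict: "\<And>p q x y. (q, p) \<in> P \<Longrightarrow> x \<in> Field (le p) \<Longrightarrow> y \<in> Field (le p) \<Longrightarrow>
      (x, y) \<in> le q \<Longrightarrow> (x, y) \<in> le p"
    and le_meet: "\<And>p q x y u. (q, p) \<in> P \<Longrightarrow> x \<in> Field (le p) \<Longrightarrow> y \<in> Field (le p) \<Longrightarrow> x \<noteq> y \<Longrightarrow>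
      (u, x) \<in> le q \<Longrightarrow> (u, y) \<in> le q \<Longrightarrow> \<exists>v. (u, v) \<in> le q \<and> (v, x) \<in> le p \<and> (v, y) \<in> le p"
    and le_level: "\<And>p x y. p \<in> Field P \<Longrightarrow> (x, y) \<in> le p \<Longrightarrow> x \<noteq> y \<Longrightarrow> fst x \<in> underS lam (fst y)"
    and le_bone1: "\<And>p u x y. p \<in> Field P \<Longrightarrow> (u, x) \<in> le p \<Longrightarrow> (u, y) \<in> le p \<Longrightarrow>
      fst x = fst y \<Longrightarrow> fst x \<in> underS lam m \<Longrightarrow> x = y"
    and le_bone2: "\<And>p x y g. p \<in> Field P \<Longrightarrow> (y, x) \<in> le p \<Longrightarrow> y \<noteq> x \<Longrightarrow> fst x \<in> underS lam m \<Longrightarrow>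
      underS lam (fst x) = insert g (underS lam g) \<Longrightarrow> \<exists>z. fst z = g \<and> (y, z) \<in> le p \<and> (z, x) \<in> le p"
    and le_add: "\<And>p t. p \<in> Field P \<Longrightarrow> t \<in> T \<Longrightarrow> \<exists>q. (q, p) \<in> P \<and> t \<in> Field (le q)"
    and le_inf: "\<And>p t a. p \<in> Field P \<Longrightarrow> t \<in> Field (le p) \<Longrightarrow> a \<in> underS lam (fst t) \<Longrightarrow>
      \<exists>q s. (q, p) \<in> P \<and> fst s = a \<and> s \<notin> Field (le p) \<and> (s, t) \<in> le q"
begin

lemma m_field: "m \<in> Field lam"
  using below_m1 below_Field(1)[of m m1] by blast

lemma w_below_m: "w \<in> below m"
proof -
  have "countable (below w)" by (simp add: underS_w)
  then have "m \<noteq> w" using uncountable_m by blast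
  moreover have "m \<notin> below w"
  proof
    assume "m \<in> below w"
    then have "below m \<subseteq> below w" using below_trans by blast
    then show False using uncountable_m \<open>countable (below w)\<close> countable_subset by blast
  qed
  ultimately show ?thesis using below_total[OF m_field w_field] by blast
qed

text \<open>An uncountable segment is not a countable one plus a point. So the successor of a level
  below \<open>m\<close> is again below \<open>m\<close>, within reach of
  \<open>le_bone2\<close>.\<close>

lemma m_limit: "g \<in> below m \<Longrightarrow> below m \<noteq> insert g (below g)"
  using uncountable_m countable_below_m by force

lemma below_m_sub: "insert m (below m) \<subseteq> Field lam"
  using m_field below_sub by blast

lemma le_reflD: "p \<in> Field P \<Longrightarrow> x \<in> Field (le p) \<Longrightarrow> (x, x) \<in> le p"
  using le_po[of p] by (auto simp: partial_order_on_def preorder_on_def refl_on_def)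

lemma le_transD: "p \<in> Field P \<Longrightarrow> (x, y) \<in> le p \<Longrightarrow> (y, z) \<in> le p \<Longrightarrow> (x, z) \<in> le p"
  using le_po[of p] unfolding partial_order_on_def preorder_on_def trans_def by blast

lemma le_antisymD: "p \<in> Field P \<Longrightarrow> (x, y) \<in> le p \<Longrightarrow> (y, x) \<in> le p \<Longrightarrow> x = y"
  using le_po[of p] unfolding partial_order_on_def antisym_def by blast

lemma le_inT: "p \<in> Field P \<Longrightarrow> (x, y) \<in> le p \<Longrightarrow> x \<in> T \<and> y \<in> T"
  using le_T[of p] by (auto simp: Field_def)

lemma le_monoD: "(x, y) \<in> le p \<Longrightarrow> q \<sqsubseteq> p \<Longrightarrow> (x, y) \<in> le q"
  using le_mono by blast

section \<open>Names for the levels, the sequence and the order\<close>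

definition lev :: "'a \<Rightarrow> ('a \<times> 'a) set" where
  "lev a = {t \<in> T. fst t = a}"

definition nm :: "'a \<times> 'a \<Rightarrow> ('i, 'p) name" where
  "nm t = pr (ordn (fst t)) (ordn (snd t))"

definition top_name :: "('i, 'p) name" where
  "top_name = chk (ordn ` Field lam)"

definition width :: "'a \<Rightarrow> ('i, 'p) name" where
  "width a = (if a = m then top_name else ordn w)"

definition seq_name :: "('i, 'p) name" where
  "seq_name = graph ordn width (insert m (below m))"

definition T_name :: "('i, 'p) name" where
  "T_name = chk (nm ` T)"

text \<open>A pair is attached to each condition whose finite order contains it, so this names the
  union of \<open>le p\<close> over the generic filter.\<close>

definition L_name :: "('i, 'p) name" where
  "L_name = mk_name ((\<lambda>z. (pr (nm (fst (fst z))) (nm (snd (fst z))), snd z)) `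
     {z. snd z \<in> Field P \<and> fst z \<in> le (snd z)})"

lemma small_T: "small (A :: ('a \<times> 'a) set)"
  using small_subset[OF small_Times[OF small_a small_a], of A UNIV UNIV] by simp

lemma elts_L: "v \<in> elts L_name \<longleftrightarrow> (\<exists>x y p. v = (pr (nm x) (nm y), p) \<and> p \<in> Field P \<and> (x, y) \<in> le p)"
proof -
  let ?Z = "{z. snd z \<in> Field P \<and> fst z \<in> le (snd z)}"
  let ?f = "\<lambda>z. (pr (nm (fst (fst z))) (nm (snd (fst z))), snd z)"
  have "small (UNIV \<times> Field P :: ((('a \<times> 'a) \<times> ('a \<times> 'a)) \<times> 'p) set)"
    using small_Times[OF small_Times[OF small_T small_T], of "Field P" UNIV UNIV] card_forcing
    by (simp add: small_for_def)
  then have "small ?Z"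
    by (rule small_subset) auto
  from small_image[OF this, of ?f] have "elts L_name = ?f ` ?Z"
    unfolding L_name_def by (intro elts_mk_name) (simp add: small_for_def)
  moreover have "v \<in> ?f ` ?Z" if "v = (pr (nm x) (nm y), p)" "p \<in> Field P" "(x, y) \<in> le p" for x y p
    using that by (intro image_eqI[of _ _ "((x, y), p)"]) simp_all
  moreover have "\<exists>x y p. v = (pr (nm x) (nm y), p) \<and> p \<in> Field P \<and> (x, y) \<in> le p" if "v \<in> ?f ` ?Z"
  proof -
    obtain z where z: "z \<in> ?Z" "v = ?f z" using \<open>v \<in> ?f ` ?Z\<close> by (rule imageE)
    then show ?thesis
      by (intro exI[of _ "fst (fst z)"] exI[of _ "snd (fst z)"] exI[of _ "snd z"]) simp
  qed
  ultimately show ?thesis by blast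
qed

lemma discrete_nm: "discrete nm T"
  unfolding discrete_def nm_def
proof (intro ballI impI)
  fix a b p assume ab: "a \<in> T" "b \<in> T" and p: "p \<in> Field P"
    and "p ||- (pr (ordn (fst a)) (ordn (snd a)) \<^bold>= pr (ordn (fst b)) (ordn (snd b)))"
  note pr_eqD[OF this(4)]
  moreover have "fst a \<in> Field lam" "fst b \<in> Field lam" "snd a \<in> Field lam" "snd b \<in> Field lam"
    using ab T_iff m_field below_Field by blast+
  ultimately show "a = b"
    using ordn_eq p by (simp add: prod_eq_iff)
qed

lemma nm_eq: "a \<in> T \<Longrightarrow> b \<in> T \<Longrightarrow> p \<in> Field P \<Longrightarrow> p ||- (nm a \<^bold>= nm b) \<longleftrightarrow> a = b"
  by (rule discreteD[OF discrete_nm])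

lemma rel_L: "p ||- fm_rel L_name x y \<longleftrightarrow>
    dens p (\<lambda>r. \<exists>a b. (a, b) \<in> le r \<and> r ||- (x \<^bold>= nm a) \<and> r ||- (y \<^bold>= nm b))"
proof -
  have 1: "r ||- (pr x y \<^bold>= pr (nm a) (nm b)) \<longleftrightarrow> r ||- (x \<^bold>= nm a) \<and> r ||- (y \<^bold>= nm b)" for r a b
    using pr_eqD pr_cong by blast
  have "(\<exists>v\<in>elts L_name. r \<sqsubseteq> snd v \<and> r ||- (pr x y \<^bold>= fst v)) \<longleftrightarrow>
      (\<exists>a b. (a, b) \<in> le r \<and> r ||- (x \<^bold>= nm a) \<and> r ||- (y \<^bold>= nm b))" if "r \<sqsubseteq> r" for r
  proof
    assume "\<exists>v\<in>elts L_name. r \<sqsubseteq> snd v \<and> r ||- (pr x y \<^bold>= fst v)"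
    then obtain a b s where "(a, b) \<in> le s" "r \<sqsubseteq> s" "r ||- (pr x y \<^bold>= pr (nm a) (nm b))"
      unfolding Bex_def elts_L by auto
    then show "\<exists>a b. (a, b) \<in> le r \<and> r ||- (x \<^bold>= nm a) \<and> r ||- (y \<^bold>= nm b)"
      using 1 le_monoD by blast
  next
    assume "\<exists>a b. (a, b) \<in> le r \<and> r ||- (x \<^bold>= nm a) \<and> r ||- (y \<^bold>= nm b)"
    then obtain a b where "(a, b) \<in> le r" "r ||- (pr x y \<^bold>= pr (nm a) (nm b))" using 1 by blast
    then show "\<exists>v\<in>elts L_name. r \<sqsubseteq> snd v \<and> r ||- (pr x y \<^bold>= fst v)"
      using that elts_L[of "(pr (nm a) (nm b), r)"] FieldI1[OF that]
      by (intro bexI[of _ "(pr (nm a) (nm b), r)"]) (simp, blast)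
  qed
  then show ?thesis unfolding fr_rel fr_Mem dens_def using le_refl1 by meson
qed

text \<open>Discreteness of \<open>nm\<close> turns the forced equalities of \<open>rel_L\<close>
  into real ones. This is the link by which properties of all \<open>le p\<close> pass to the
  generic order.\<close>

lemma rel_L_nm:
  assumes "a \<in> T" "b \<in> T"
  shows "p ||- fm_rel L_name (nm a) (nm b) \<longleftrightarrow> dens p (\<lambda>r. (a, b) \<in> le r)"
  unfolding rel_L
proof
  assume "dens p (\<lambda>r. \<exists>a' b'. (a', b') \<in> le r \<and> r ||- (nm a \<^bold>= nm a') \<and> r ||- (nm b \<^bold>= nm b'))"
  then show "dens p (\<lambda>r. (a, b) \<in> le r)"
  proof (rule dens_imp, elim exE conjE)
    fix r a' b' assume r: "r \<sqsubseteq> p" and "(a', b') \<in> le r" "r ||- (nm a \<^bold>= nm a')" "r ||- (nm b \<^bold>= nm b')"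
    then show "(a, b) \<in> le r"
      using nm_eq[OF assms(1)] nm_eq[OF assms(2)] le_inT FieldI1[OF r] by metis
  qed
next
  assume "dens p (\<lambda>r. (a, b) \<in> le r)"
  then show "dens p (\<lambda>r. \<exists>a' b'. (a', b') \<in> le r \<and> r ||- (nm a \<^bold>= nm a') \<and> r ||- (nm b \<^bold>= nm b'))"
    by (rule dens_imp) (use eq_refl in blast)
qed

lemma rel_L_nmI: "p \<in> Field P \<Longrightarrow> (a, b) \<in> le p \<Longrightarrow> p ||- fm_rel L_name (nm a) (nm b)"
  using le_inT[of p a b] by (subst rel_L_nm) (auto intro: densI le_monoD)

lemma less_L_nmI: "p \<in> Field P \<Longrightarrow> (a, b) \<in> le p \<Longrightarrow> a \<noteq> b \<Longrightarrow> p ||- fm_less L_name (nm a) (nm b)"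
  unfolding fm_less_def forces.simps(3-5)
  using rel_L_nmI le_inT[of p a b] nm_eq by (blast intro: FieldI1)

lemma less_L_nmD:
  assumes "p ||- fm_less L_name (nm a) (nm b)" "a \<in> T" "b \<in> T" "p \<in> Field P"
  shows "dens p (\<lambda>r. (a, b) \<in> le r)" "a \<noteq> b"
proof -
  show "dens p (\<lambda>r. (a, b) \<in> le r)" using assms by (simp add: fm_less_def rel_L_nm)
  have "\<not> p ||- (nm a \<^bold>= nm b)" using assms(1) le_refl[OF assms(4)] by (simp add: fm_less_def)
  then show "a \<noteq> b" using eq_refl by blast
qed

lemma seq_at: "a \<in> insert m (below m) \<Longrightarrow> p ||- fm_rel seq_name (ordn a) k \<longleftrightarrow> p ||- (k \<^bold>= width a)"
  unfolding seq_name_def by (rule rel_graph_at[OF small_a discrete_ordn'[OF below_m_sub]])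

lemma lev_eq: "a \<in> insert m (below m) \<Longrightarrow> lev a = {a} \<times> (if a = m then Field lam else below w)"
  by (auto simp: lev_def T_iff below_irrefl)

lemma width_chk: "width a = chk (ordn ` (if a = m then Field lam else below w))"
  unfolding width_def top_name_def using ordn_chk[of w] by simp

lemma level_seq:
  assumes "a \<in> insert m (below m)"
  shows "p ||- fm_level seq_name (ordn a) t \<longleftrightarrow> dens p (\<lambda>r. \<exists>u\<in>lev a. r ||- (t \<^bold>= nm u))"
proof -
  have "p ||- fm_level seq_name (ordn a) t \<longleftrightarrow> p ||- ExIn (width a) (\<lambda>x. fm_pair t (ordn a) x)"
  proof
    assume "p ||- fm_level seq_name (ordn a) t"
    then have "dens p (\<lambda>r. \<exists>k. r ||- (k \<^bold>= width a) \<and> r ||- ExIn k (\<lambda>x. fm_pair t (ordn a) x))"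
      unfolding fm_level_def fr_Exists by (simp add: seq_at[OF assms])
    then show "p ||- ExIn (width a) (\<lambda>x. fm_pair t (ordn a) x)"
    proof (rule forces_bind, elim exE conjE)
      fix r k assume k: "r ||- (k \<^bold>= width a)" and *: "r ||- ExIn k (\<lambda>x. fm_pair t (ordn a) x)"
      have "feq r (ExIn k (\<lambda>x. fm_pair t (ordn a) x)) (ExIn (width a) (\<lambda>x. fm_pair t (ordn a) x))"
        using k by (intro fcong)
      then show "r ||- ExIn (width a) (\<lambda>x. fm_pair t (ordn a) x)" using * feq_fr by blast
    qed
  next
    assume "p ||- ExIn (width a) (\<lambda>x. fm_pair t (ordn a) x)"
    then show "p ||- fm_level seq_name (ordn a) t"
      unfolding fm_level_def
      by (intro fr_ExistsI[where x = "width a"]) (simp add: seq_at[OF assms] eq_refl)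
  qed
  also have "\<dots> \<longleftrightarrow> dens p (\<lambda>r. \<exists>u\<in>lev a. r ||- (t \<^bold>= nm u))"
  proof -
    have "(\<exists>u\<in>ordn ` (if a = m then Field lam else below w). r ||- (t \<^bold>= pr (ordn a) u)) \<longleftrightarrow>
        (\<exists>u\<in>lev a. r ||- (t \<^bold>= nm u))" for r
      unfolding lev_eq[OF assms] by (auto simp: nm_def)
    then show ?thesis
      unfolding width_chk by (subst ExIn_chk) (auto intro!: fcong small_ordn simp: fr_pair)
  qed
  finally show ?thesis .
qed

lemma guard_level: "a \<in> insert m (below m) \<Longrightarrow> guard (fm_level seq_name (ordn a)) (nm ` lev a)"
  unfolding guard_def by (simp add: level_seq)

lemma level_nmI: "a \<in> insert m (below m) \<Longrightarrow> u \<in> lev a \<Longrightarrow> p ||- fm_level seq_name (ordn a) (nm u)"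
  by (subst level_seq) (auto intro!: densI eq_refl)

lemma resp_level: "resp (fm_level seq_name (ordn a))"
  by (auto intro!: fcong)

lemma lev_T: "u \<in> lev a \<Longrightarrow> u \<in> T \<and> fst u = a"
  by (simp add: lev_def)

lemma T_lev: "u \<in> T \<Longrightarrow> fst u \<in> insert m (below m)"
  by (auto simp: T_iff)

section \<open>The cardinals of the sequence\<close>

lemma infinite_cardinal_top: "p ||- fm_infinite_cardinal top_name"
  unfolding top_name_def
proof (rule infinite_cardinal_chk[OF ccc])
  show "uncountable (Field lam)" using uncountable_m countable_subset[OF below_sub] by blast
qed (use below_Field card_below in blast)+

lemma infinite_cardinal_m: "p ||- fm_infinite_cardinal (ordn m)"
proof (subst ordn_chk, rule infinite_cardinal_chk[OF ccc uncountable_m below_sub])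
  fix a assume a: "a \<in> below m"
  show "|below a| <o |below m|"
  proof (rule ccontr)
    assume "\<not> ?thesis"
    then have "|below m| \<le>o |below a|" by (simp add: not_ordLess_iff_ordLeq card_of_Well_order)
    then obtain f where "inj_on f (below m)" "f ` below m \<subseteq> below a"
      using card_of_ordLeq by metis
    then show False
      using uncountable_m countable_below_m[OF a] countable_image_inj_on countable_subset by metis
  qed
qed (use below_trans in blast)

text \<open>An element below \<open>m\<close> is finite, or \<open>w\<close>, or countable and above
  \<open>w\<close>. In the last case an enumeration from the ground model injects it into omega, so
  it is not a cardinal.\<close>

lemma omega1_m: "p ||- fm_omega1 (ordn m)"
proof -
  have *: "r ||- (ordn a \<^bold>= ordn w)"
    if a: "a \<in> below m" and r: "r \<sqsubseteq> p" "r ||- fm_infinite_cardinal (ordn a)" for a r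
  proof -
    have rF: "r \<in> Field P" using r(1) FieldI1 by fast
    have "a \<notin> below w"
    proof
      assume "a \<in> below w"
      then obtain n where n: "a = e n" by (auto simp: underS_w)
      have "r ||- fm_finite (chk (ordn ` below a))"
        by (rule finite_chk) (simp_all add: n underS_e discrete_ordn' below_sub[of "e n", unfolded underS_e])
      then show False
        using r(2) le_refl[OF rF] ordn_chk[of a] by (simp add: fm_infinite_cardinal_def)
    qed
    moreover have "w \<notin> below a"
    proof
      assume wa: "w \<in> below a"
      have c: "countable (below a)" by (rule countable_below_m[OF a])
      define g where "g = (\<lambda>x. e (to_nat_on (below a) x))"
      have "inj_on g (below a)" "g ` below a \<subseteq> below w"
        using inj_on_to_nat_on[OF c] e_inj e_below unfolding g_def inj_on_def by blast+
      then have "r ||- fm_injection (graph ordn (\<lambda>a. ordn (g a)) (below a)) (chk (ordn ` below a)) (chk (ordn ` below w))"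
        by (intro injection_graph small_a discrete_ordn' below_sub)
      then have i: "r ||- (\<^bold>\<exists>f. fm_injection f (ordn a) (ordn w))"
        unfolding ordn_chk[symmetric] by (rule fr_ExistsI)
      have "r ||- AllIn (ordn a) (\<lambda>b. \<^bold>\<not> (\<^bold>\<exists>f. fm_injection f (ordn a) b))"
        using r(2) unfolding fm_infinite_cardinal_def fm_cardinal_def forces.simps(4) by blast
      then have "r ||- (\<^bold>\<not> (\<^bold>\<exists>f. fm_injection f (ordn a) (ordn w)))"
        by (subst (asm) AllIn_ordn) (use wa in \<open>auto intro!: fcong\<close>)
      then show False using i le_refl[OF rF] unfolding fr_Neg by blast
    qed
    ultimately have "a = w" using below_total[OF _ w_field] a below_Field by blast
    then show ?thesis using eq_refl by simp
  qed
  have "p ||- AllIn (ordn m) (\<lambda>a. fm_infinite_cardinal a \<^bold>\<longrightarrow> a \<^bold>= ordn w)"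
    by (subst AllIn_ordn) (use * in \<open>auto intro!: fcong simp: fr_Imp\<close>)
  then show ?thesis
    unfolding fm_omega1_def
    using infinite_cardinal_m omega_ordn ordn_memI[OF w_below_m]
    by (intro fr_ExistsI[where x = "ordn w"]) (simp add: fm_infinite_cardinal_def)
qed

lemma const_snoc: "p ||- fm_const_snoc seq_name (ordn m1) (ordn w) (ordn m) top_name"
proof -
  have "p ||- fm_function_on seq_name (ordn m1)"
    unfolding seq_name_def ordn_chk[of m1] below_m1
    by (rule function_on_graph[OF small_a discrete_ordn'[OF below_m_sub]])
  moreover have "p ||- AllIn (ordn m) (\<lambda>a. fm_rel seq_name a (ordn w))"
    by (subst AllIn_ordn) (auto intro!: fcong simp: seq_at width_def below_irrefl)
  moreover have "p ||- fm_rel seq_name (ordn m) top_name"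
    by (simp add: seq_at width_def eq_refl)
  ultimately show ?thesis
    unfolding fm_const_snoc_def using ordinal_ordn succ_ordn[OF below_m1] by simp
qed

lemma card_sequence: "p ||- fm_card_sequence seq_name (ordn m1)"
proof -
  have "p ||- AllIn (ordn m1) (\<lambda>a. \<^bold>\<forall>k. fm_rel seq_name a k \<^bold>\<longrightarrow> fm_infinite_cardinal k)"
  proof (subst AllIn_ordn)
    show "\<forall>a\<in>below m1. p ||- (\<^bold>\<forall>k. fm_rel seq_name (ordn a) k \<^bold>\<longrightarrow> fm_infinite_cardinal k)"
    proof
      fix a assume "a \<in> below m1"
      then have a: "a \<in> insert m (below m)" by (simp add: below_m1)
      have "r ||- fm_infinite_cardinal k" if "r ||- (k \<^bold>= width a)" for r k
      proof -
        have "feq r (fm_infinite_cardinal (width a)) (fm_infinite_cardinal k)"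
          using eq_sym[OF that] by (intro fcong)
        moreover have "r ||- fm_infinite_cardinal (width a)"
          using infinite_cardinal_top infinite_cardinal_omega by (simp add: width_def)
        ultimately show ?thesis using feq_fr by blast
      qed
      then show "p ||- (\<^bold>\<forall>k. fm_rel seq_name (ordn a) k \<^bold>\<longrightarrow> fm_infinite_cardinal k)"
        by (simp add: fr_Imp seq_at[OF a])
    qed
  qed (auto intro!: fcong)
  then show ?thesis
    unfolding fm_card_sequence_def using ordinal_ordn const_snoc[of p] by (simp add: fm_const_snoc_def)
qed

section \<open>The clauses of the definition of the poset\<close>

lemma AllIn_T: "resp A \<Longrightarrow> p ||- AllIn T_name A \<longleftrightarrow> (\<forall>t\<in>T. p ||- A (nm t))"
  unfolding T_name_def by (subst AllIn_chk) (auto intro: small_image small_T)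

lemma ExIn_T: "resp A \<Longrightarrow> p ||- ExIn T_name A \<longleftrightarrow> dens p (\<lambda>r. \<exists>t\<in>T. r ||- A (nm t))"
  unfolding T_name_def by (subst ExIn_chk) (auto intro: small_image small_T)

lemma AllIn_ordnI: "resp A \<Longrightarrow> (\<And>a. a \<in> below b \<Longrightarrow> p ||- A (ordn a)) \<Longrightarrow> p ||- AllIn (ordn b) A"
  by (simp add: AllIn_ordn)

lemma AllIn_TI: "resp A \<Longrightarrow> (\<And>t. t \<in> T \<Longrightarrow> p ||- A (nm t)) \<Longrightarrow> p ||- AllIn T_name A"
  by (simp add: AllIn_T)

text \<open>Both sets of conditions are open, since \<open>le\<close> grows along the forcing order,
  so density passes to their intersection.\<close>

lemma dens_le_conj:
  assumes "dens p (\<lambda>r. (a, b) \<in> le r)" "dens p (\<lambda>r. (c, d) \<in> le r)"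
  shows "dens p (\<lambda>r. (a, b) \<in> le r \<and> (c, d) \<in> le r)"
  by (rule dens_bind[OF assms(1)], rule dens_imp[OF dens_mono[OF assms(2)]])
     (use le_monoD in blast)+

lemma partial_order_L: "p ||- fm_partial_order T_name L_name"
proof -
  have 1: "p ||- AllIn L_name (\<lambda>z. ExIn T_name (\<lambda>x. ExIn T_name (\<lambda>y. fm_pair z x y)))"
    unfolding fr_AllIn
  proof (intro allI impI)
    fix z q assume "q ||- (z \<^bold>\<in> L_name)"
    then show "q ||- ExIn T_name (\<lambda>x. ExIn T_name (\<lambda>y. fm_pair z x y))"
      unfolding fr_Mem
    proof (rule forces_bind)
      fix r assume r: "r \<sqsubseteq> q" "\<exists>v\<in>elts L_name. r \<sqsubseteq> snd v \<and> r ||- (z \<^bold>= fst v)"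
      then obtain x y s where s: "s \<in> Field P" "(x, y) \<in> le s" "r ||- (z \<^bold>= pr (nm x) (nm y))"
        unfolding Bex_def elts_L by auto
      then have "x \<in> T" "y \<in> T" using le_inT by blast+
      then have "r ||- (nm x \<^bold>\<in> T_name)" "r ||- (nm y \<^bold>\<in> T_name)"
        unfolding T_name_def by (auto intro!: mem_chkI small_image small_T)
      then show "r ||- ExIn T_name (\<lambda>x. ExIn T_name (\<lambda>y. fm_pair z x y))"
        using s(3) by (intro fr_ExInI[where x = "nm x"] fr_ExInI[where x = "nm y"]) (simp_all add: fr_pair)
    qed
  qed
  have 2: "p ||- AllIn T_name (\<lambda>x. fm_rel L_name x x)"
  proof (subst AllIn_T)
    \<comment> \<open>A condition need not mention \<open>t\<close>; the reflexive pair appears once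
      \<open>le_add\<close> has put \<open>t\<close> into the field.\<close>
    have "dens p (\<lambda>r. (t, t) \<in> le r)" if "t \<in> T" for t
    proof (rule densI_ex)
      fix q assume "q \<sqsubseteq> p"
      then obtain r where r: "r \<sqsubseteq> q" "t \<in> Field (le r)" using le_add[OF FieldI1 \<open>t \<in> T\<close>] by blast
      then show "\<exists>r. r \<sqsubseteq> q \<and> (t, t) \<in> le r" using le_reflD[OF FieldI1] by blast
    qed
    then show "\<forall>t\<in>T. p ||- fm_rel L_name (nm t) (nm t)" by (simp add: rel_L_nm)
  qed (auto intro!: fcong)
  have 3: "p ||- AllIn T_name (\<lambda>x. AllIn T_name (\<lambda>y. fm_rel L_name x y \<^bold>\<and> fm_rel L_name y x \<^bold>\<longrightarrow> x \<^bold>= y))"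
  proof (subst AllIn_T)
    have "q ||- (nm x \<^bold>= nm y)"
      if "dens q (\<lambda>r. (x, y) \<in> le r)" "dens q (\<lambda>r. (y, x) \<in> le r)" for x y q
    proof (rule forces_bind[OF dens_le_conj[OF that]])
      fix r assume "r \<sqsubseteq> q" "(x, y) \<in> le r \<and> (y, x) \<in> le r"
      then have "x = y" using le_antisymD FieldI1 by metis
      then show "r ||- (nm x \<^bold>= nm y)" using eq_refl by simp
    qed
    then show "\<forall>t\<in>T. p ||- AllIn T_name (\<lambda>y. fm_rel L_name (nm t) y \<^bold>\<and> fm_rel L_name y (nm t) \<^bold>\<longrightarrow> nm t \<^bold>= y)"
      by (simp add: AllIn_T fcong fr_Imp rel_L_nm)
  qed (auto intro!: fcong)
  have 4: "p ||- AllIn T_name (\<lambda>x. AllIn T_name (\<lambda>y. AllIn T_name (\<lambda>z.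
      fm_rel L_name x y \<^bold>\<and> fm_rel L_name y z \<^bold>\<longrightarrow> fm_rel L_name x z)))"
  proof (subst AllIn_T)
    have "dens q (\<lambda>r. (x, z) \<in> le r)"
      if "dens q (\<lambda>r. (x, y) \<in> le r)" "dens q (\<lambda>r. (y, z) \<in> le r)" for x y z q
      by (rule dens_imp[OF dens_le_conj[OF that]]) (use le_transD FieldI1 in metis)
    then show "\<forall>t\<in>T. p ||- AllIn T_name (\<lambda>y. AllIn T_name (\<lambda>z.
        fm_rel L_name (nm t) y \<^bold>\<and> fm_rel L_name y z \<^bold>\<longrightarrow> fm_rel L_name (nm t) z))"
      by (simp add: AllIn_T fcong fr_Imp rel_L_nm) blast
  qed (auto intro!: fcong)
  show ?thesis unfolding fm_partial_order_def forces.simps(4) using 1 2 3 4 by (intro conjI)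
qed

text \<open>The companion of \<open>Forall_guardI\<close> for two variables, which are replaced by
  ground model values one after the other, below stronger and stronger conditions.\<close>

lemma guard2I:
  assumes "guard G S" "guard H S'"
    and "\<And>y. resp (\<lambda>x. C x y)" "\<And>x. resp (C x)" "\<And>y. resp (\<lambda>x. D x y)" "\<And>x. resp (D x)"
    and step: "\<And>u v q. u \<in> S \<Longrightarrow> v \<in> S' \<Longrightarrow> q \<sqsubseteq> p \<Longrightarrow> q ||- C u v \<Longrightarrow> q ||- D u v"
  shows "p ||- (\<^bold>\<forall>x y. G x \<^bold>\<and> H y \<^bold>\<and> C x y \<^bold>\<longrightarrow> D x y)"
  unfolding forces.simps(5) fr_Imp forces.simps(4)
proof (intro allI impI, elim conjE)
  fix x y q assume q: "q \<sqsubseteq> p" and G: "q ||- G x" and H: "q ||- H y" and C: "q ||- C x y"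
  have "dens q (\<lambda>r. \<exists>u\<in>S. r ||- (x \<^bold>= u))" using assms(1) G by (simp add: guard_def)
  then show "q ||- D x y"
  proof (rule forces_bind, elim bexE)
    fix r u assume r: "r \<sqsubseteq> q" and u: "u \<in> S" "r ||- (x \<^bold>= u)"
    have "dens q (\<lambda>r. \<exists>v\<in>S'. r ||- (y \<^bold>= v))" using assms(2) H by (simp add: guard_def)
    from dens_mono[OF this r] show "r ||- D x y"
    proof (rule forces_bind, elim bexE)
      fix r' v assume r': "r' \<sqsubseteq> r" and v: "v \<in> S'" "r' ||- (y \<^bold>= v)"
      note u' = forces_mono[OF u(2) r'] and r'q = le_trans[OF r' r]
      have "r' ||- C u v"
        using resp_fr[OF assms(4) eq_sym[OF v(2)] resp_fr[OF assms(3) eq_sym[OF u'] forces_mono[OF C r'q]]] .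
      then have "r' ||- D u v" by (rule step[OF u(1) v(1) le_trans[OF r'q q]])
      then show "r' ||- D x y" using resp_fr[OF assms(6) v(2) resp_fr[OF assms(5) u']] by blast
    qed
  qed
qed

lemma T_levels: "p ||- (\<^bold>\<forall>t. t \<^bold>\<in> T_name \<^bold>\<longleftrightarrow> ExIn (ordn m1) (\<lambda>a. fm_level seq_name a t))"
  unfolding forces.simps(5) fr_Equ feq_def
proof (intro allI impI)
  fix t q
  have "q ||- ExIn (ordn m1) (\<lambda>a. fm_level seq_name a t) \<longleftrightarrow>
      dens q (\<lambda>r. \<exists>a\<in>below m1. r ||- fm_level seq_name (ordn a) t)"
    by (subst ExIn_ordn) (auto intro!: fcong)
  also have "\<dots> \<longleftrightarrow> dens q (\<lambda>r. \<exists>u\<in>T. r ||- (t \<^bold>= nm u))"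
  proof
    assume "dens q (\<lambda>r. \<exists>a\<in>below m1. r ||- fm_level seq_name (ordn a) t)"
    then show "dens q (\<lambda>r. \<exists>u\<in>T. r ||- (t \<^bold>= nm u))"
    proof (rule dens_bind, elim bexE)
      fix r a assume "a \<in> below m1" "r ||- fm_level seq_name (ordn a) t"
      then have "dens r (\<lambda>r. \<exists>u\<in>lev a. r ||- (t \<^bold>= nm u))" by (simp add: level_seq below_m1)
      then show "dens r (\<lambda>r. \<exists>u\<in>T. r ||- (t \<^bold>= nm u))" by (rule dens_imp) (use lev_T in blast)
    qed
  next
    assume "dens q (\<lambda>r. \<exists>u\<in>T. r ||- (t \<^bold>= nm u))"
    then show "dens q (\<lambda>r. \<exists>a\<in>below m1. r ||- fm_level seq_name (ordn a) t)"
    proof (rule dens_imp, elim bexE)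
      fix r u assume u: "u \<in> T" "r ||- (t \<^bold>= nm u)"
      have "r ||- fm_level seq_name (ordn (fst u)) t"
        using resp_fr[OF resp_level u(2) level_nmI[OF T_lev[OF u(1)]]] u(1) by (simp add: lev_def)
      then show "\<exists>a\<in>below m1. r ||- fm_level seq_name (ordn a) t"
        using T_lev[OF u(1)] unfolding below_m1 by blast
    qed
  qed
  finally show "q ||- (t \<^bold>\<in> T_name) \<longleftrightarrow> q ||- ExIn (ordn m1) (\<lambda>a. fm_level seq_name a t)"
    unfolding T_name_def by (simp add: mem_chk small_image small_T)
qed

lemma levels_increase: "p ||- AllIn (ordn m1) (\<lambda>a. AllIn (ordn m1) (\<lambda>b. \<^bold>\<forall>x y.
    fm_level seq_name a x \<^bold>\<and> fm_level seq_name b y \<^bold>\<and> fm_less L_name x y \<^bold>\<longrightarrow> a \<^bold>\<in> b))"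
proof -
  have *: "p ||- (\<^bold>\<forall>x y. fm_level seq_name (ordn a) x \<^bold>\<and>
        fm_level seq_name (ordn b) y \<^bold>\<and> fm_less L_name x y \<^bold>\<longrightarrow> ordn a \<^bold>\<in> ordn b)"
    if ab: "a \<in> below m1" "b \<in> below m1" for a b
      proof (rule guard2I[OF guard_level guard_level])
        fix x y q assume "x \<in> nm ` lev a" "y \<in> nm ` lev b" and q: "q \<sqsubseteq> p" "q ||- fm_less L_name x y"
        then obtain u v where uv: "u \<in> lev a" "v \<in> lev b" "q ||- fm_less L_name (nm u) (nm v)" by blast
        have qF: "q \<in> Field P" using q(1) FieldI1 by fast
        note less_L_nmD[OF uv(3) _ _ qF]
        then have "dens q (\<lambda>r. (u, v) \<in> le r)" "u \<noteq> v" using lev_T uv(1,2) by blast+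
        then obtain r where "r \<sqsubseteq> q" "(u, v) \<in> le r" using densD le_refl[OF qF] by blast
        then have "a \<in> below b" using le_level[of r u v] \<open>u \<noteq> v\<close> FieldI1 lev_T uv(1,2) by metis
        then show "q ||- (ordn a \<^bold>\<in> ordn b)" by (rule ordn_memI)
      qed (use ab below_m1 in \<open>auto intro!: fcong\<close>)
  show ?thesis
    by ((rule AllIn_ordnI, (auto intro!: fcong)[1])+, rule *)
qed

lemma meets: "p ||- AllIn T_name (\<lambda>x. AllIn T_name (\<lambda>y. \<^bold>\<not> x \<^bold>= y \<^bold>\<longrightarrow>
    (\<^bold>\<exists>I. fm_finite I \<^bold>\<and> fm_subset I T_name \<^bold>\<and>
      AllIn T_name (\<lambda>u. (fm_rel L_name u x \<^bold>\<and> fm_rel L_name u y) \<^bold>\<longleftrightarrow> ExIn I (\<lambda>v. fm_rel L_name u v)))))"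
    (is "p ||- AllIn T_name (\<lambda>x. AllIn T_name (\<lambda>y. _ \<^bold>\<longrightarrow> (\<^bold>\<exists>I. ?I x y I)))")
proof -
  have *: "p ||- (\<^bold>\<not> nm x \<^bold>= nm y \<^bold>\<longrightarrow> (\<^bold>\<exists>I. ?I (nm x) (nm y) I))" if xy: "x \<in> T" "y \<in> T" for x y
    unfolding fr_Imp
  proof (intro allI impI)
    fix q assume q: "q \<sqsubseteq> p" "q ||- (\<^bold>\<not> nm x \<^bold>= nm y)"
    have neq: "x \<noteq> y" using q(2) le_refl1[OF q(1)] eq_refl by auto
    show "q ||- (\<^bold>\<exists>I. ?I (nm x) (nm y) I)"
    proof (rule forces_dens, rule densI_ex)
      fix q' assume q': "q' \<sqsubseteq> q"
      obtain r0 where r0: "r0 \<sqsubseteq> q'" "x \<in> Field (le r0)" using le_add[OF FieldI1[OF q'] xy(1)] by blast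
      obtain r where r: "r \<sqsubseteq> r0" "y \<in> Field (le r)" using le_add[OF FieldI1[OF r0(1)] xy(2)] by blast
      have x: "x \<in> Field (le r)" using r0(2) le_mono[OF r(1)] by (auto simp: Field_def)
      have rF: "r \<in> Field P" using FieldI1[OF r(1)] .
      \<comment> \<open>All common lower bounds that \<open>r\<close> knows, not just maximal ones.
        Each later common lower bound lies below a member of \<open>U\<close> by
        \<open>le_meet\<close>, so a canonical name for \<open>U\<close> suffices.\<close>
      define U where "U = {v. (v, x) \<in> le r \<and> (v, y) \<in> le r}"
      have "finite (Field (le r))" using le_finite[OF rF] finite_Field by blast
      then have finU: "finite U" by (rule finite_subset[rotated]) (auto simp: U_def Field_def)
      have UT: "U \<subseteq> T" using le_inT[OF rF] unfolding U_def by blast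
      have 1: "r ||- fm_finite (chk (nm ` U))"
        by (rule finite_chk[OF finU]) (use discrete_nm UT in \<open>unfold discrete_def, blast\<close>)
      have 2: "r ||- fm_subset (chk (nm ` U)) T_name"
        unfolding fm_subset_def T_name_def
        by (subst AllIn_chk) (use UT in \<open>auto intro!: fcong small_image small_T mem_chkI\<close>)
      have "r ||- ((fm_rel L_name (nm u) (nm x) \<^bold>\<and> fm_rel L_name (nm u) (nm y)) \<^bold>\<longleftrightarrow>
          ExIn (chk (nm ` U)) (\<lambda>v. fm_rel L_name (nm u) v))" if u: "u \<in> T" for u
        unfolding fr_Equ feq_def
      proof (intro allI impI)
        fix s assume s: "s \<sqsubseteq> r"
        have "s ||- ExIn (chk (nm ` U)) (\<lambda>v. fm_rel L_name (nm u) v) \<longleftrightarrow>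
            dens s (\<lambda>r. \<exists>v\<in>nm ` U. r ||- fm_rel L_name (nm u) v)"
          by (rule ExIn_chk) (auto intro!: fcong small_image small_T)
        also have "\<dots> \<longleftrightarrow> dens s (\<lambda>r. \<exists>v\<in>U. dens r (\<lambda>r. (u, v) \<in> le r))"
        proof -
          have "(\<exists>v\<in>nm ` U. r ||- fm_rel L_name (nm u) v) \<longleftrightarrow> (\<exists>v\<in>U. dens r (\<lambda>r. (u, v) \<in> le r))" for r
            using rel_L_nm[OF u] UT by blast
          then show ?thesis by simp
        qed
        also have "\<dots> \<longleftrightarrow> dens s (\<lambda>r. (u, x) \<in> le r) \<and> dens s (\<lambda>r. (u, y) \<in> le r)"
        proof
          assume *: "dens s (\<lambda>r. \<exists>v\<in>U. dens r (\<lambda>r. (u, v) \<in> le r))"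
          have "dens s (\<lambda>r. (u, x) \<in> le r \<and> (u, y) \<in> le r)"
          proof (rule dens_bind[OF *], elim bexE)
            fix s' v assume s': "s' \<sqsubseteq> s" and v: "v \<in> U" "dens s' (\<lambda>r. (u, v) \<in> le r)"
            show "dens s' (\<lambda>r. (u, x) \<in> le r \<and> (u, y) \<in> le r)"
            proof (rule dens_imp[OF v(2)])
              fix t assume t: "t \<sqsubseteq> s'" "(u, v) \<in> le t"
              have "t \<sqsubseteq> r" using le_trans t(1) s' s by blast
              then have "(v, x) \<in> le t" "(v, y) \<in> le t" using v(1) le_monoD unfolding U_def by blast+
              then show "(u, x) \<in> le t \<and> (u, y) \<in> le t" using le_transD[OF FieldI1[OF t(1)] t(2)] by blast
            qed
          qed
          then show "dens s (\<lambda>r. (u, x) \<in> le r) \<and> dens s (\<lambda>r. (u, y) \<in> le r)"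
            using dens_imp by (metis (mono_tags, lifting))
        next
          assume "dens s (\<lambda>r. (u, x) \<in> le r) \<and> dens s (\<lambda>r. (u, y) \<in> le r)"
          then have "dens s (\<lambda>r. (u, x) \<in> le r \<and> (u, y) \<in> le r)" using dens_le_conj by blast
          then show "dens s (\<lambda>r. \<exists>v\<in>U. dens r (\<lambda>r. (u, v) \<in> le r))"
          proof (rule dens_imp)
            fix t assume t: "t \<sqsubseteq> s" "(u, x) \<in> le t \<and> (u, y) \<in> le t"
            then obtain v where v: "(u, v) \<in> le t" "(v, x) \<in> le r" "(v, y) \<in> le r"
              using le_meet[OF le_trans[OF t(1) s] x r(2) neq] by blast
            then have "dens t (\<lambda>r. (u, v) \<in> le r)" using le_monoD by (intro densI) blast
            then show "\<exists>v\<in>U. dens t (\<lambda>r. (u, v) \<in> le r)" using v unfolding U_def by blast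
          qed
        qed
        finally show "s ||- (fm_rel L_name (nm u) (nm x) \<^bold>\<and> fm_rel L_name (nm u) (nm y)) \<longleftrightarrow>
          s ||- ExIn (chk (nm ` U)) (\<lambda>v. fm_rel L_name (nm u) v)"
          using rel_L_nm[OF u] xy by simp
      qed
      then have 3: "r ||- AllIn T_name (\<lambda>u. (fm_rel L_name u (nm x) \<^bold>\<and> fm_rel L_name u (nm y)) \<^bold>\<longleftrightarrow>
          ExIn (chk (nm ` U)) (\<lambda>v. fm_rel L_name u v))"
        by (subst AllIn_T) (auto intro!: fcong)
      show "\<exists>r. r \<sqsubseteq> q' \<and> r ||- (\<^bold>\<exists>I. ?I (nm x) (nm y) I)"
        using le_trans[OF r(1) r0(1)]
        by (intro exI[of _ r] conjI fr_ExistsI[where x = "chk (nm ` U)"])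
           (use 1 2 3 in \<open>unfold forces.simps(4), blast+\<close>)
    qed
  qed
  show ?thesis
    by ((rule AllIn_TI, (auto intro!: fcong)[1])+, rule *)
qed

lemma lower_infinite: "p ||- AllIn (ordn m1) (\<lambda>b. AllIn b (\<lambda>a. \<^bold>\<forall>t. fm_level seq_name b t \<^bold>\<longrightarrow>
    (\<^bold>\<exists>X. \<^bold>\<not> fm_finite X \<^bold>\<and> (\<^bold>\<forall>x. x \<^bold>\<in> X \<^bold>\<longleftrightarrow> fm_level seq_name a x \<^bold>\<and> fm_less L_name x t))))"
    (is "p ||- AllIn _ (\<lambda>b. AllIn b (\<lambda>a. \<^bold>\<forall>t. _ b t \<^bold>\<longrightarrow> (\<^bold>\<exists>X. ?B a t X)))")
proof -
  have *: "p ||- (\<^bold>\<forall>t. fm_level seq_name (ordn b) t \<^bold>\<longrightarrow>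
    (\<^bold>\<exists>X. ?B (ordn a) t X))"
    if b: "b \<in> below m1" and ab: "a \<in> below b" for a b
  proof (rule Forall_guardI[OF guard_level])
    have a: "a \<in> insert m (below m)" using below_trans[OF ab b] by (simp add: below_m1)
    fix t q assume "t \<in> nm ` lev b" and "q \<sqsubseteq> p"
    then obtain v where v: "v \<in> T" "fst v = b" "t = nm v" by (auto simp: lev_def)
    let ?Z = "{z. snd z \<in> Field P \<and> (fst z, v) \<in> le (snd z) \<and> fst (fst z) = a}"
    \<comment> \<open>The predecessors of \<open>v\<close> on level \<open>a\<close> are determined
      only by the generic filter, so \<open>X\<close> is a name of the same kind as
      \<open>L_name\<close>.\<close>
    define X where "X = mk_name ((\<lambda>z. (nm (fst z), snd z)) ` ?Z)"
    have "small (UNIV \<times> Field P :: (('a \<times> 'a) \<times> 'p) set)"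
      using small_Times[OF small_T, of "Field P" UNIV] card_forcing by (simp add: small_for_def)
    then have "small ?Z" by (rule small_subset) auto
    from small_image[OF this, of "\<lambda>z. (nm (fst z), snd z)"]
    have elts: "elts X = (\<lambda>z. (nm (fst z), snd z)) ` ?Z"
      unfolding X_def by (intro elts_mk_name) (simp add: small_for_def)
    have memX: "r ||- (nm s \<^bold>\<in> X)" if "(s, v) \<in> le r" "fst s = a" "r \<in> Field P" for r s
    proof -
      have "(nm s, r) \<in> elts X"
        unfolding elts by (rule image_eqI[of _ _ "(s, r)"]) (use that in simp_all)
      from elts_mem[OF this] show ?thesis using le_refl[OF that(3)] by simp
    qed
    have X: "r ||- (\<^bold>\<forall>x. x \<^bold>\<in> X \<^bold>\<longleftrightarrow> fm_level seq_name (ordn a) x \<^bold>\<and> fm_less L_name x (nm v))" for r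
      unfolding forces.simps(5) fr_Equ feq_def
    proof (intro allI impI iffI)
      fix x s assume "s ||- (x \<^bold>\<in> X)"
      then have "dens s (\<lambda>r. \<exists>u\<in>elts X. r \<sqsubseteq> snd u \<and> r ||- (x \<^bold>= fst u))" by (simp add: fr_Mem)
      then show "s ||- (fm_level seq_name (ordn a) x \<^bold>\<and> fm_less L_name x (nm v))"
      proof (rule forces_bind, elim bexE conjE)
        fix r u assume r: "r \<sqsubseteq> s" and u: "u \<in> elts X" "r \<sqsubseteq> snd u" "r ||- (x \<^bold>= fst u)"
        then obtain z where z: "z \<in> ?Z" "u = (nm (fst z), snd z)" unfolding elts by blast
        have zv: "(fst z, v) \<in> le r" using z u(2) le_monoD[of "fst z" v "snd z" r] by simp
        have rF: "r \<in> Field P" using FieldI1[OF r] .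
        have zT: "fst z \<in> lev a" using le_inT[OF rF zv] z(1) by (simp add: lev_def)
        have xz: "r ||- (x \<^bold>= nm (fst z))" using u(3) z(2) by simp
        have "fst z \<noteq> v" using z(1) v(2) ab below_irrefl by auto
        then have "r ||- fm_less L_name (nm (fst z)) (nm v)" by (rule less_L_nmI[OF rF zv])
        then have "r ||- fm_less L_name x (nm v)"
          by (rule resp_fr[of "\<lambda>x. fm_less L_name x (nm v)", OF _ xz, rotated])
             (auto intro!: fcong)
        moreover have "r ||- fm_level seq_name (ordn a) x"
          by (rule resp_fr[OF resp_level xz level_nmI[OF a zT]])
        ultimately show "r ||- (fm_level seq_name (ordn a) x \<^bold>\<and> fm_less L_name x (nm v))" by simp
      qed
    next
      fix x s assume "s ||- (fm_level seq_name (ordn a) x \<^bold>\<and> fm_less L_name x (nm v))"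
      then have lev: "dens s (\<lambda>r. \<exists>u\<in>lev a. r ||- (x \<^bold>= nm u))" and less: "s ||- fm_less L_name x (nm v)"
        using level_seq[OF a] by simp_all
      show "s ||- (x \<^bold>\<in> X)"
      proof (rule forces_bind[OF lev], elim bexE)
        fix r u assume r: "r \<sqsubseteq> s" and u: "u \<in> lev a" "r ||- (x \<^bold>= nm u)"
        have "r ||- fm_less L_name (nm u) (nm v)"
          by (rule resp_fr[of "\<lambda>x. fm_less L_name x (nm v)", OF _ eq_sym[OF u(2)] forces_mono[OF less r]])
             (auto intro!: fcong)
        then have "dens r (\<lambda>r. (u, v) \<in> le r)"
          using less_L_nmD(1) lev_T[OF u(1)] v(1) FieldI1[OF r] by blast
        then show "r ||- (x \<^bold>\<in> X)"
        proof (rule forces_bind)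
          fix r' assume r': "r' \<sqsubseteq> r" "(u, v) \<in> le r'"
          have "r' ||- (nm u \<^bold>\<in> X)" using memX[OF r'(2)] lev_T[OF u(1)] FieldI1[OF r'(1)] by blast
          then show "r' ||- (x \<^bold>\<in> X)" using mem_cong1[OF eq_sym[OF forces_mono[OF u(2) r'(1)]]] by blast
        qed
      qed
    qed
    have "q ||- (\<^bold>\<not> fm_finite X)"
    proof (rule not_finiteI)
      fix q' N assume q': "q' \<sqsubseteq> q"
      \<comment> \<open>Each extension supplies an element outside the field of the previous
        condition, hence a new one. That \<open>v\<close> is in the field is kept in the statement
        for the next use of \<open>le_inf\<close>.\<close>
      have "\<exists>r A. r \<sqsubseteq> q' \<and> v \<in> Field (le r) \<and> finite A \<and> card A = N \<and> (\<forall>s\<in>A. fst s = a \<and> (s, v) \<in> le r)"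
      proof (induction N)
        case 0
        obtain r where "r \<sqsubseteq> q'" "v \<in> Field (le r)" using le_add[OF FieldI1[OF q'] v(1)] by blast
        then show ?case by (intro exI[of _ r] exI[of _ "{}"]) simp
      next
        case (Suc N)
        then obtain r A where r: "r \<sqsubseteq> q'" "v \<in> Field (le r)"
          and A: "finite A" "card A = N" "\<forall>s\<in>A. fst s = a \<and> (s, v) \<in> le r" by blast
        obtain r' s where r': "r' \<sqsubseteq> r" "fst s = a" "s \<notin> Field (le r)" "(s, v) \<in> le r'"
          using le_inf[OF FieldI1[OF r(1)] r(2)] ab v(2) by blast
        have "s \<notin> A" using A(3) r'(3) FieldI1 by fast
        then have "card (insert s A) = Suc N" "finite (insert s A)" using A by simp_all
        moreover have "\<forall>t\<in>insert s A. fst t = a \<and> (t, v) \<in> le r'"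
          using A(3) r' le_monoD by blast
        moreover have "v \<in> Field (le r')" using r'(4) FieldI2 by fast
        ultimately show ?case using le_trans[OF r'(1) r(1)] by blast
      qed
      then obtain r A where r: "r \<sqsubseteq> q'" and A: "finite A" "card A = N"
        "\<forall>s\<in>A. fst s = a \<and> (s, v) \<in> le r" by blast
      have rF: "r \<in> Field P" using FieldI1[OF r] .
      have "A \<subseteq> T" using A(3) le_inT[OF rF] by blast
      then have "discrete nm A" using discrete_nm unfolding discrete_def by blast
      moreover have "\<forall>s\<in>A. r ||- (nm s \<^bold>\<in> X)" using A(3) memX rF by blast
      ultimately show "\<exists>r f. \<exists>A :: ('a \<times> 'a) set. r \<sqsubseteq> q' \<and> finite A \<and> card A = N \<and> discrete f A \<and>
          (\<forall>a\<in>A. r ||- (f a \<^bold>\<in> X))"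
        using r A(1,2) by blast
    qed
    then show "q ||- (\<^bold>\<exists>X. ?B (ordn a) t X)"
      unfolding v(3) using X by (intro fr_ExistsI[where x = X]) (simp only: forces.simps(4))
  qed (use b below_m1 in \<open>auto intro!: fcong\<close>)
  show ?thesis
    by (rule AllIn_ordnI, (auto intro!: fcong)[1],
        rule AllIn_ordnI, (auto intro!: fcong)[1], rule *)
qed

lemma s_poset: "p ||- fm_s_poset seq_name (ordn m1) T_name L_name"
  unfolding fm_s_poset_def forces.simps(4)
  using card_sequence partial_order_L T_levels levels_increase meets lower_infinite by (intro conjI)

section \<open>The bone levels\<close>

lemma bone_level:
  assumes g: "g \<in> below m"
  shows "p ||- fm_bone_level seq_name T_name L_name (ordn g)"
proof -
  have g': "g \<in> insert m (below m)" using g by simp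
  have 1: "p ||- (\<^bold>\<forall>x y. fm_level seq_name (ordn g) x \<^bold>\<and> fm_level seq_name (ordn g) y \<^bold>\<and> \<^bold>\<not> x \<^bold>= y \<^bold>\<longrightarrow>
        \<^bold>\<not> ExIn T_name (\<lambda>u. fm_rel L_name u x \<^bold>\<and> fm_rel L_name u y))"
  proof (rule guard2I[OF guard_level guard_level])
    fix x y q assume "x \<in> nm ` lev g" "y \<in> nm ` lev g" and q: "q \<sqsubseteq> p" "q ||- (\<^bold>\<not> x \<^bold>= y)"
    then obtain a b where ab: "a \<in> lev g" "b \<in> lev g" "x = nm a" "y = nm b" by blast
    have "a \<noteq> b" using q(2) le_refl1[OF q(1)] eq_refl ab by auto
    have False if r: "r \<sqsubseteq> q" "r ||- ExIn T_name (\<lambda>u. fm_rel L_name u (nm a) \<^bold>\<and> fm_rel L_name u (nm b))" for r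
    proof -
      have "dens r (\<lambda>r. \<exists>u\<in>T. r ||- fm_rel L_name (nm u) (nm a) \<and> r ||- fm_rel L_name (nm u) (nm b))"
        using r(2) by (subst (asm) ExIn_T) (auto intro!: fcong)
      then obtain r1 u where r1: "r1 \<sqsubseteq> r" and u: "u \<in> T" "r1 ||- fm_rel L_name (nm u) (nm a)"
        "r1 ||- fm_rel L_name (nm u) (nm b)"
        using densD[OF _ le_refl1[OF r(1)]] by blast
      have "dens r1 (\<lambda>r. (u, a) \<in> le r)" "dens r1 (\<lambda>r. (u, b) \<in> le r)"
        using u rel_L_nm lev_T ab(1,2) by blast+
      then obtain r2 where r2: "r2 \<sqsubseteq> r1" "(u, a) \<in> le r2" "(u, b) \<in> le r2"
        using densD[OF dens_le_conj le_refl1[OF r1]] by blast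
      have "a = b" using le_bone1[OF FieldI1[OF r2(1)] r2(2,3)] lev_T ab(1,2) g by simp
      then show False using \<open>a \<noteq> b\<close> by simp
    qed
    then show "q ||- (\<^bold>\<not> ExIn T_name (\<lambda>u. fm_rel L_name u x \<^bold>\<and> fm_rel L_name u y))"
      unfolding ab fr_Neg by blast
  qed (use g in \<open>auto intro!: fcong\<close>)
  have 2: "p ||- (\<^bold>\<forall>g' x. fm_succ g' (ordn g) \<^bold>\<and> fm_level seq_name g' x \<^bold>\<longrightarrow>
        AllIn T_name (\<lambda>y. fm_less L_name y x \<^bold>\<longrightarrow>
          (\<^bold>\<exists>z. fm_level seq_name (ordn g) z \<^bold>\<and> fm_rel L_name y z \<^bold>\<and> fm_less L_name z x)))"
      (is "p ||- (\<^bold>\<forall>g' x. _ g' x \<^bold>\<longrightarrow> AllIn T_name (\<lambda>y. _ y x \<^bold>\<longrightarrow> (\<^bold>\<exists>z. ?E x y z)))")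
    unfolding forces.simps(5)
  proof (intro allI)
    fix g1 x
    let ?C = "\<lambda>x. AllIn T_name (\<lambda>y. fm_less L_name y x \<^bold>\<longrightarrow> (\<^bold>\<exists>z. ?E x y z))"
    show "p ||- (fm_succ g1 (ordn g) \<^bold>\<and> fm_level seq_name g1 x \<^bold>\<longrightarrow> ?C x)"
      unfolding fr_Imp forces.simps(4)
    proof (intro allI impI, elim conjE)
      fix q assume q: "q \<sqsubseteq> p" and succ: "q ||- fm_succ g1 (ordn g)" and lev: "q ||- fm_level seq_name g1 x"
      \<comment> \<open>\<open>g1\<close> is an arbitrary name. Having an element on its level puts
        it into the domain of the sequence, so it is densely some \<open>ordn a\<close>.\<close>
      have "dens q (\<lambda>r. \<exists>k. r ||- fm_rel seq_name g1 k)"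
        using lev unfolding fm_level_def fr_Exists forces.simps(4) by (rule dens_imp) blast
      then have "dens q (\<lambda>r. \<exists>a\<in>insert m (below m). r ||- (g1 \<^bold>= ordn a))"
      proof (rule dens_bind, elim exE)
        fix r k assume "r ||- fm_rel seq_name g1 k"
        then show "dens r (\<lambda>r. \<exists>a\<in>insert m (below m). r ||- (g1 \<^bold>= ordn a))"
          unfolding seq_name_def rel_graph[OF small_a] by (rule dens_imp) blast
      qed
      then show "q ||- ?C x"
      proof (rule forces_bind, elim bexE)
        fix r a assume r: "r \<sqsubseteq> q" and a: "a \<in> insert m (below m)" and ga: "r ||- (g1 \<^bold>= ordn a)"
        have "r ||- fm_succ (ordn a) (ordn g)"
          by (rule resp_fr[of "\<lambda>x. fm_succ x (ordn g)", OF _ eq_sym[OF ga] forces_mono[OF succ r]])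
             (auto intro!: fcong)
        then have suc: "below a = insert g (below g)"
          by (rule succ_ordnD) (use g a below_m_sub below_Field FieldI1[OF r] in auto)
        then have am: "a \<in> below m" using a m_limit[OF g] by blast
        have "r ||- fm_level seq_name (ordn a) x"
          by (rule resp_fr[of "\<lambda>g. fm_level seq_name g x", OF _ eq_sym[OF ga] forces_mono[OF lev r]])
             (auto intro!: fcong)
        then have "dens r (\<lambda>r. \<exists>u\<in>lev a. r ||- (x \<^bold>= nm u))" using level_seq[OF a] by blast
        then show "r ||- ?C x"
        proof (rule forces_bind, elim bexE)
          fix r1 u assume r1: "r1 \<sqsubseteq> r" and u: "u \<in> lev a" and xu: "r1 ||- (x \<^bold>= nm u)"
          have "r1 ||- ?C (nm u)"
          proof (rule AllIn_TI)
            fix y assume y: "y \<in> T"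
            show "r1 ||- (fm_less L_name (nm y) (nm u) \<^bold>\<longrightarrow>
              (\<^bold>\<exists>z. ?E (nm u) (nm y) z))"
              unfolding fr_Imp
            proof (intro allI impI)
              fix r2 assume r2: "r2 \<sqsubseteq> r1" "r2 ||- fm_less L_name (nm y) (nm u)"
              note yu = less_L_nmD[OF r2(2) y conjunct1[OF lev_T[OF u]] FieldI1[OF r2(1)]]
              show "r2 ||- (\<^bold>\<exists>z. ?E (nm u) (nm y) z)"
              proof (rule forces_bind[OF yu(1)])
                fix r3 assume r3: "r3 \<sqsubseteq> r2" "(y, u) \<in> le r3"
                have F: "r3 \<in> Field P" using FieldI1[OF r3(1)] .
                obtain z where z: "fst z = g" "(y, z) \<in> le r3" "(z, u) \<in> le r3"
                  using le_bone2[OF F r3(2) yu(2)] lev_T[OF u] am suc by blast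
                have "z \<noteq> u" using z(1) lev_T[OF u] suc below_irrefl by blast
                moreover have "z \<in> lev g" using z(1) le_inT[OF F z(2)] by (simp add: lev_def)
                ultimately show "r3 ||- (\<^bold>\<exists>z. ?E (nm u) (nm y) z)"
                  using rel_L_nmI[OF F z(2)] less_L_nmI[OF F z(3)] level_nmI[OF g']
                  by (intro fr_ExistsI[where x = "nm z"]) simp
              qed
            qed
          qed (auto intro!: fcong)
          then show "r1 ||- ?C x"
            by (rule resp_fr[of ?C, OF _ xu, rotated]) (auto intro!: fcong)
        qed
      qed
    qed
  qed
  show ?thesis unfolding fm_bone_level_def forces.simps(4) using 1 2 by (intro conjI)
qed

lemma feq_bone_level [fcong]:
  "p ||- (g \<^bold>= g') \<Longrightarrow> feq p (fm_bone_level S T' L g) (fm_bone_level S T' L g')"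
  unfolding fm_bone_level_def by (intro fcong)

theorem omega1_skeleton_exists: "p ||- fm_omega1_skeleton_exists top_name"
proof -
  have "p ||- (ordn w \<^bold>\<in> top_name)"
    unfolding top_name_def using w_field by (auto intro!: mem_chkI small_ordn)
  moreover have "p ||- (\<^bold>\<not> fm_empty (ordn m))"
    by (rule not_empty[OF ordn_memI[OF w_below_m]])
  moreover have "p ||- AllIn (ordn m) (fm_bone_level seq_name T_name L_name)"
    by (rule AllIn_ordnI) (auto intro!: fcong bone_level)
  moreover note const_snoc s_poset
  ultimately have "p ||- fm_skeleton (ordn w) (ordn m) top_name T_name L_name"
    unfolding fm_skeleton_def forces.simps(4)
    by (intro conjI fr_ExistsI[where x = seq_name] fr_ExistsI[where x = "ordn m1"])
       (simp_all only: forces.simps(4))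
  then show ?thesis
    unfolding fm_omega1_skeleton_exists_def
    by (intro fr_ExistsI[where x = "ordn w"] fr_ExistsI[where x = "ordn m"]
        fr_ExistsI[where x = T_name] fr_ExistsI[where x = L_name])
       (simp only: forces.simps(4) omega_ordn omega1_m)
qed

end

section \<open>Finite conditions\<close>

lemma uncountable_pigeonhole:
  assumes "uncountable I" "countable (f ` I)"
  obtains b where "uncountable {i \<in> I. f i = b}"
proof (rule ccontr)
  assume "\<not> thesis"
  then have "countable {i \<in> I. f i = b}" for b using that by blast
  then have "countable (\<Union>b\<in>f ` I. {i \<in> I. f i = b})" using assms(2) by blast
  moreover have "(\<Union>b\<in>f ` I. {i \<in> I. f i = b}) = I" by blast
  ultimately show False using assms(1) by simp
qed

lemma uncountable_two:
  assumes "uncountable I"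
  obtains i j where "i \<in> I" "j \<in> I" "i \<noteq> j"
proof -
  obtain i where i: "i \<in> I" using assms by fastforce
  have "I - {i} \<noteq> {}" using assms by (metis countable_Diff_eq countable_empty)
  then show thesis using i that by blast
qed

text \<open>The family is indexed, so that different indices may carry equal sets, as level sets of
  conditions can. If some \<open>x\<close> lies in uncountably many sets, it goes into the root and
  the induction hypothesis treats the rest; otherwise a maximal disjoint subfamily is uncountable,
  with empty root.\<close>

lemma delta_system_card:
  assumes "uncountable I" "\<And>i. i \<in> I \<Longrightarrow> finite (f i) \<and> card (f i) = n"
  shows "\<exists>J R. J \<subseteq> I \<and> uncountable J \<and> (\<forall>i\<in>J. \<forall>j\<in>J. i \<noteq> j \<longrightarrow> f i \<inter> f j = R)"
  using assms
proof (induction n arbitrary: I f)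
  case 0
  then have "\<forall>i\<in>I. f i = {}" by (metis card_0_eq)
  then show ?case using 0(1) by (intro exI[of _ I] exI[of _ "{}"]) auto
next
  case (Suc n)
  show ?case
  proof (cases "\<exists>x. uncountable {i \<in> I. x \<in> f i}")
    case True
    then obtain x where x: "uncountable {i \<in> I. x \<in> f i}" by blast
    obtain J R where J: "J \<subseteq> {i \<in> I. x \<in> f i}" "uncountable J"
      "\<forall>i\<in>J. \<forall>j\<in>J. i \<noteq> j \<longrightarrow> (f i - {x}) \<inter> (f j - {x}) = R"
      using Suc.IH[OF x, of "\<lambda>i. f i - {x}"] Suc.prems(2) by auto
    have "\<forall>i\<in>J. \<forall>j\<in>J. i \<noteq> j \<longrightarrow> f i \<inter> f j = insert x R"
      using J by blast
    then show ?thesis using J by blast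
  next
    case False
    let ?D = "\<lambda>J. pairwise (\<lambda>i j. disjnt (f i) (f j)) J"
    obtain J where J: "J \<subseteq> I" "?D J" and max: "\<And>K. K \<subseteq> I \<Longrightarrow> ?D K \<Longrightarrow> J \<subseteq> K \<Longrightarrow> K = J"
    proof -
      have "\<exists>M\<in>{J. J \<subseteq> I \<and> ?D J}. \<forall>X\<in>{J. J \<subseteq> I \<and> ?D J}. M \<subseteq> X \<longrightarrow> X = M"
      proof (rule subset_Zorn_nonempty)
        show "{J. J \<subseteq> I \<and> ?D J} \<noteq> {}" by (auto intro: exI[of _ "{}"])
      next
        fix C assume "C \<noteq> {}" and C: "subset.chain {J. J \<subseteq> I \<and> ?D J} C"
        then have "?D (\<Union>C)"
          by (intro pairwise_chain_Union) (unfold subset_chain_def chain_subset_def, blast+)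
        then show "\<Union>C \<in> {J. J \<subseteq> I \<and> ?D J}" using C unfolding subset_chain_def by blast
      qed
      then obtain M where M: "M \<subseteq> I" "?D M" "\<forall>X\<in>{J. J \<subseteq> I \<and> ?D J}. M \<subseteq> X \<longrightarrow> X = M"
        by blast
      show thesis
        by (rule that[OF M(1,2)]) (use M(3) in simp)
    qed
    have "uncountable J"
    proof
      assume c: "countable J"
      \<comment> \<open>By maximality each set outside the subfamily meets one inside it. A
        countable \<open>J\<close> has only countably many points, each in countably many sets, and
        could not account for all of \<open>I\<close>.\<close>
      have "I \<subseteq> J \<union> (\<Union>x\<in>\<Union>(f ` J). {i \<in> I. x \<in> f i})"
      proof
        fix i assume i: "i \<in> I"
        show "i \<in> J \<union> (\<Union>x\<in>\<Union>(f ` J). {i \<in> I. x \<in> f i})"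
        proof (rule ccontr)
          assume n: "\<not> ?thesis"
          then have "?D (insert i J)"
            using J(2) i by (auto simp: pairwise_insert disjnt_iff)
          then have "insert i J = J" using max[of "insert i J"] J(1) i by blast
          then show False using n by blast
        qed
      qed
      moreover have fJ: "countable (\<Union>(f ` J))"
        using c J(1) Suc.prems(2) by (intro countable_UN) (auto intro: countable_finite)
      have "countable (J \<union> (\<Union>x\<in>\<Union>(f ` J). {i \<in> I. x \<in> f i}))"
        by (intro countable_Un c countable_UN[OF fJ]) (use False in blast)
      ultimately show False using Suc.prems(1) countable_subset by blast
    qed
    moreover have "\<forall>i\<in>J. \<forall>j\<in>J. i \<noteq> j \<longrightarrow> f i \<inter> f j = {}"
      using J(2) by (auto simp: pairwise_def disjnt_def)
    ultimately show ?thesis using J(1) by blast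
  qed
qed

lemma delta_system:
  assumes "uncountable I" "\<And>i. i \<in> I \<Longrightarrow> finite (f i)"
  obtains J R where "J \<subseteq> I" "uncountable J" "\<And>i j. i \<in> J \<Longrightarrow> j \<in> J \<Longrightarrow> i \<noteq> j \<Longrightarrow> f i \<inter> f j = R"
proof -
  obtain n where n: "uncountable {i \<in> I. card (f i) = n}"
    by (rule uncountable_pigeonhole[OF assms(1), of "\<lambda>i. card (f i)"]) (simp, rule that)
  have "\<exists>J R. J \<subseteq> {i \<in> I. card (f i) = n} \<and> uncountable J \<and> (\<forall>i\<in>J. \<forall>j\<in>J. i \<noteq> j \<longrightarrow> f i \<inter> f j = R)"
    by (rule delta_system_card[OF n]) (use assms(2) in auto)
  then obtain J R where J: "J \<subseteq> {i \<in> I. card (f i) = n}" "uncountable J"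
    "\<forall>i\<in>J. \<forall>j\<in>J. i \<noteq> j \<longrightarrow> f i \<inter> f j = R" by blast
  show thesis
    by (rule that[of J R]) (use J in blast)+
qed

section \<open>Conditions and their extensions\<close>

text \<open>\<open>F\<close> is the given function moved to values below \<open>m\<close>, as a
  symmetric function of two arguments; its unboundedness is stated for uncountable families of any
  size.\<close>

locale skeleton_conditions = initial_segments lam
  for lam :: "'a rel" +
  fixes w m :: 'a and F :: "'a \<Rightarrow> 'a \<Rightarrow> 'a"
  assumes m_Field: "m \<in> Field lam"
    and uncountable_m: "uncountable (below m)"
    and countable_below_m: "\<And>a. a \<in> below m \<Longrightarrow> countable (below a)"
    and infinite_w: "infinite (below w)" and countable_w: "countable (below w)"
    and F_sym: "\<And>x y. F x y = F y x"
    and F_below: "\<And>x y. x \<in> Field lam \<Longrightarrow> y \<in> Field lam \<Longrightarrow> x \<noteq> y \<Longrightarrow> F x y \<in> below m"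
    and F_unbounded: "\<And>d n A. d \<in> below m \<Longrightarrow> uncountable A \<Longrightarrow> pairwise disjnt A \<Longrightarrow>
      (\<And>a. a \<in> A \<Longrightarrow> a \<subseteq> Field lam \<and> finite a \<and> card a = n) \<Longrightarrow>
      \<exists>a\<in>A. \<exists>b\<in>A. a \<noteq> b \<and> (\<forall>x\<in>a. \<forall>y\<in>b. d \<in> below (F x y))"
begin

definition T :: "('a \<times> 'a) set" where
  "T = {t. fst t \<in> below m \<and> snd t \<in> below w \<or> fst t = m \<and> snd t \<in> Field lam}"

lemma T_fst: "t \<in> T \<Longrightarrow> fst t = m \<or> fst t \<in> below m"
  by (auto simp: T_def)

text \<open>Antisymmetry follows from the strictly increasing levels. Only pairs on the top level
  get a bound on their common lower bounds: in the amalgamation no new element lies below a shared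
  element of a countable level, so the other pairs take care of themselves.\<close>

definition cond :: "('a \<times> 'a) rel \<Rightarrow> bool" where
  "cond p \<longleftrightarrow> finite p \<and> Field p \<subseteq> T \<and> (\<forall>x\<in>Field p. (x, x) \<in> p) \<and> trans p \<and>
    (\<forall>x y. (x, y) \<in> p \<longrightarrow> x \<noteq> y \<longrightarrow> fst x \<in> below (fst y)) \<and>
    (\<forall>u x y. (u, x) \<in> p \<longrightarrow> (u, y) \<in> p \<longrightarrow> fst x = fst y \<longrightarrow> fst x \<in> below m \<longrightarrow> x = y) \<and>
    (\<forall>x y g. (y, x) \<in> p \<longrightarrow> y \<noteq> x \<longrightarrow> fst x \<in> below m \<longrightarrow> below (fst x) = insert g (below g) \<longrightarrow>
      (\<exists>z. fst z = g \<and> (y, z) \<in> p \<and> (z, x) \<in> p)) \<and>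
    (\<forall>u x y. (u, x) \<in> p \<longrightarrow> (u, y) \<in> p \<longrightarrow> x \<noteq> y \<longrightarrow> fst x = m \<longrightarrow> fst y = m \<longrightarrow>
      fst u \<in> below (F (snd x) (snd y)))"

text \<open>The witness \<open>v\<close> is related to \<open>x\<close> and \<open>y\<close> already
  in \<open>p\<close>, so the common lower bounds present in \<open>p\<close> serve as
  \<open>i{x, y}\<close> in all further extensions.\<close>

definition ext :: "('a \<times> 'a) rel \<Rightarrow> ('a \<times> 'a) rel \<Rightarrow> bool" where
  "ext q p \<longleftrightarrow> p \<subseteq> q \<and> (\<forall>x\<in>Field p. \<forall>y\<in>Field p. (x, y) \<in> q \<longrightarrow> (x, y) \<in> p) \<and>
    (\<forall>x\<in>Field p. \<forall>y\<in>Field p. \<forall>u. x \<noteq> y \<longrightarrow> (u, x) \<in> q \<longrightarrow> (u, y) \<in> q \<longrightarrow>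
      (\<exists>v. (u, v) \<in> q \<and> (v, x) \<in> p \<and> (v, y) \<in> p))"

lemma condI:
  assumes "finite p" "Field p \<subseteq> T" "\<And>x. x \<in> Field p \<Longrightarrow> (x, x) \<in> p"
    "\<And>x y z. (x, y) \<in> p \<Longrightarrow> (y, z) \<in> p \<Longrightarrow> (x, z) \<in> p"
    "\<And>x y. (x, y) \<in> p \<Longrightarrow> x \<noteq> y \<Longrightarrow> fst x \<in> below (fst y)"
    "\<And>u x y. (u, x) \<in> p \<Longrightarrow> (u, y) \<in> p \<Longrightarrow> fst x = fst y \<Longrightarrow> fst x \<in> below m \<Longrightarrow> x = y"
    "\<And>x y g. (y, x) \<in> p \<Longrightarrow> y \<noteq> x \<Longrightarrow> fst x \<in> below m \<Longrightarrow> below (fst x) = insert g (below g) \<Longrightarrow>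
      \<exists>z. fst z = g \<and> (y, z) \<in> p \<and> (z, x) \<in> p"
    "\<And>u x y. (u, x) \<in> p \<Longrightarrow> (u, y) \<in> p \<Longrightarrow> x \<noteq> y \<Longrightarrow> fst x = m \<Longrightarrow> fst y = m \<Longrightarrow>
      fst u \<in> below (F (snd x) (snd y))"
  shows "cond p"
  unfolding cond_def trans_def
  by (intro conjI allI impI ballI; (rule assms(1-3) | rule assms(4) | rule assms(5) | rule assms(6)
      | rule assms(7) | rule assms(8)); assumption)

lemmas cond_unfold = cond_def[unfolded trans_def, THEN iffD1]

lemmas cond_finite = cond_unfold[THEN conjunct1, rule_format]
lemmas cond_T = cond_unfold[THEN conjunct2, THEN conjunct1, rule_format]
lemmas cond_refl = cond_unfold[THEN conjunct2, THEN conjunct2, THEN conjunct1, rule_format]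
lemmas cond_trans = cond_unfold[THEN conjunct2, THEN conjunct2, THEN conjunct2, THEN conjunct1, rule_format]
lemmas cond_level = cond_unfold[THEN conjunct2, THEN conjunct2, THEN conjunct2, THEN conjunct2, THEN conjunct1, rule_format]
lemmas cond_bone1 = cond_unfold[THEN conjunct2, THEN conjunct2, THEN conjunct2, THEN conjunct2, THEN conjunct2, THEN conjunct1, rule_format]
lemmas cond_bone2 = cond_unfold[THEN conjunct2, THEN conjunct2, THEN conjunct2, THEN conjunct2, THEN conjunct2, THEN conjunct2, THEN conjunct1, rule_format]
lemmas cond_F = cond_unfold[THEN conjunct2, THEN conjunct2, THEN conjunct2, THEN conjunct2, THEN conjunct2, THEN conjunct2, THEN conjunct2, rule_format]

lemma cond_antisym: "cond p \<Longrightarrow> (x, y) \<in> p \<Longrightarrow> (y, x) \<in> p \<Longrightarrow> x = y"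
  using cond_level[of p x y] cond_level[of p y x] below_trans below_irrefl by blast

lemma cond_partial_order: "cond p \<Longrightarrow> Partial_order p"
  unfolding partial_order_on_def preorder_on_def refl_on_def antisym_def trans_def
  using cond_refl cond_trans cond_antisym by (auto simp: Field_def)

lemma cond_Field: "cond p \<Longrightarrow> x \<in> Field p \<Longrightarrow> x \<in> T"
  using cond_T by blast

lemma cond_finite_Field: "cond p \<Longrightarrow> finite (Field p)"
  using cond_finite finite_Field by blast

text \<open>Levels in \<open>T\<close> go up to \<open>m\<close> and no further, so top elements are
  maximal.\<close>

lemma cond_top: "cond p \<Longrightarrow> (x, y) \<in> p \<Longrightarrow> fst x = m \<Longrightarrow> x = y"
proof (rule ccontr)
  assume p: "cond p" and xy: "(x, y) \<in> p" "fst x = m" "x \<noteq> y"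
  have "m \<in> below (fst y)" using cond_level[OF p xy(1,3)] xy(2) by simp
  moreover have "fst y = m \<or> fst y \<in> below m" using T_fst[OF cond_Field[OF p FieldI2[OF xy(1)]]] .
  ultimately show False using below_irrefl below_trans by metis
qed

lemma cond_empty: "cond {}"
  by (rule condI) (auto simp: Field_def)

lemma extI:
  assumes "p \<subseteq> q" "\<And>x y. x \<in> Field p \<Longrightarrow> y \<in> Field p \<Longrightarrow> (x, y) \<in> q \<Longrightarrow> (x, y) \<in> p"
    "\<And>x y u. x \<in> Field p \<Longrightarrow> y \<in> Field p \<Longrightarrow> x \<noteq> y \<Longrightarrow> (u, x) \<in> q \<Longrightarrow> (u, y) \<in> q \<Longrightarrow>
      \<exists>v. (u, v) \<in> q \<and> (v, x) \<in> p \<and> (v, y) \<in> p"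
  shows "ext q p"
  unfolding ext_def
  by (intro conjI allI impI ballI; (rule assms(1) | rule assms(2) | rule assms(3)); assumption)

lemmas ext_sub = ext_def[THEN iffD1, THEN conjunct1, THEN subsetD]
lemmas ext_restrict = ext_def[THEN iffD1, THEN conjunct2, THEN conjunct1, rule_format]
lemmas ext_meet = ext_def[THEN iffD1, THEN conjunct2, THEN conjunct2, rule_format]

lemma ext_refl: "cond p \<Longrightarrow> ext p p"
  by (rule extI) (use cond_refl[OF _ FieldI1] in blast)+

lemma ext_Field: "ext q p \<Longrightarrow> Field p \<subseteq> Field q"
  by (auto simp: ext_def Field_def)

lemma ext_trans:
  assumes r: "cond r" and rq: "ext r q" and qp: "ext q p"
  shows "ext r p"
proof (rule extI)
  show "p \<subseteq> r" using ext_sub[OF rq] ext_sub[OF qp] by blast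
next
  fix x y assume xy: "x \<in> Field p" "y \<in> Field p" "(x, y) \<in> r"
  then have "x \<in> Field q" "y \<in> Field q" using ext_Field[OF qp] by blast+
  then show "(x, y) \<in> p" using xy by (intro ext_restrict[OF qp] ext_restrict[OF rq])
next
  fix x y u assume *: "x \<in> Field p" "y \<in> Field p" "x \<noteq> y" "(u, x) \<in> r" "(u, y) \<in> r"
  then have "x \<in> Field q" "y \<in> Field q" using ext_Field[OF qp] by blast+
  from ext_meet[OF rq this *(3-5)]
  obtain v where v: "(u, v) \<in> r" "(v, x) \<in> q" "(v, y) \<in> q" by blast
  from ext_meet[OF qp *(1-3) v(2,3)]
  obtain v' where v': "(v, v') \<in> q" "(v', x) \<in> p" "(v', y) \<in> p" by blast
  have "(u, v') \<in> r" using cond_trans[OF r v(1) ext_sub[OF rq v'(1)]] .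
  then show "\<exists>v. (u, v) \<in> r \<and> (v, x) \<in> p \<and> (v, y) \<in> p" using v' by blast
qed

lemma ext_antisym: "ext q p \<Longrightarrow> ext p q \<Longrightarrow> p = q"
  by (auto simp: ext_def)

section \<open>Adding elements to a condition\<close>

lemma add_isolated:
  assumes p: "cond p" and t: "t \<in> T" "t \<notin> Field p"
  shows "cond (insert (t, t) p)" "ext (insert (t, t) p) p" "t \<in> Field (insert (t, t) p)"
proof -
  have F: "Field (insert (t, t) p) = insert t (Field p)" by (auto simp: Field_def)
  have no: "(x, t) \<notin> p" "(t, x) \<notin> p" for x using t(2) by (auto simp: Field_def)
  show "cond (insert (t, t) p)"
  proof (rule condI)
    show "finite (insert (t, t) p)" using cond_finite[OF p] by simp
    show "Field (insert (t, t) p) \<subseteq> T" using t(1) cond_T[OF p] by (simp add: F)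
  next
    fix x y z assume "(x, y) \<in> insert (t, t) p" "(y, z) \<in> insert (t, t) p"
    then show "(x, z) \<in> insert (t, t) p" using no cond_trans[OF p] by blast
  next
    fix x y g assume "(y, x) \<in> insert (t, t) p" "y \<noteq> x" "fst x \<in> below m"
      "below (fst x) = insert g (below g)"
    then show "\<exists>z. fst z = g \<and> (y, z) \<in> insert (t, t) p \<and> (z, x) \<in> insert (t, t) p"
      using cond_bone2[OF p] by blast
  next
    fix u x y assume "(u, x) \<in> insert (t, t) p" "(u, y) \<in> insert (t, t) p" "fst x = fst y" "fst x \<in> below m"
    then show "x = y" using cond_bone1[OF p] no by blast
  next
    fix u x y assume "(u, x) \<in> insert (t, t) p" "(u, y) \<in> insert (t, t) p" "x \<noteq> y" "fst x = m" "fst y = m"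
    then show "fst u \<in> below (F (snd x) (snd y))" using cond_F[OF p] no by blast
  next
    fix x y assume "(x, y) \<in> insert (t, t) p" "x \<noteq> y"
    then show "fst x \<in> below (fst y)" using cond_level[OF p] by blast
  qed (use F cond_refl[OF p] in auto)
  show "ext (insert (t, t) p) p"
    unfolding ext_def using t(2) cond_refl[OF p FieldI1] no by blast
qed (simp add: Field_def)

text \<open>Apart from itself, the new \<open>s\<close> lies below exactly what is above
  \<open>t\<close>, and so inherits the clauses from \<open>t\<close>. The one that can fail is the
  second bone condition for \<open>s\<close> under \<open>t\<close> itself, where no old element
  stands between; by \<open>suc\<close> the element \<open>s\<close> is then its own
  witness.\<close>

lemma add_below:
  assumes p: "cond p" and t: "t \<in> Field p" and s: "s \<in> T" "s \<notin> Field p" "fst s \<in> below (fst t)"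
    and suc: "\<And>g. fst t \<in> below m \<Longrightarrow> below (fst t) = insert g (below g) \<Longrightarrow> g = fst s"
  defines "q \<equiv> p \<union> {s} \<times> insert s (p `` {t})"
  shows "cond q" "ext q p" "(s, t) \<in> q"
proof -
  have tt: "(t, t) \<in> p" by (rule cond_refl[OF p t])
  then show "(s, t) \<in> q" by (simp add: q_def)
  have no: "(x, s) \<notin> p" "(s, x) \<notin> p" for x using s(2) by (auto simp: Field_def)
  have q: "(x, y) \<in> q \<longleftrightarrow> (x, y) \<in> p \<or> x = s \<and> (y = s \<or> (t, y) \<in> p)" for x y
    by (auto simp: q_def)
  have F: "Field q = insert s (Field p)" by (auto simp: Field_def q)
  have up: "fst s \<in> below (fst y)" if "(t, y) \<in> p" for y
    using cond_level[OF p that] s(3) below_trans by blast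
  have sm: "fst s \<noteq> m" using s(3) T_fst[OF cond_Field[OF p t]] below_trans below_irrefl by metis
  show "cond q"
  proof (rule condI)
    have "p `` {t} \<subseteq> Field p" by (auto simp: Field_def)
    then have "finite (p `` {t})" using cond_finite_Field[OF p] finite_subset by blast
    then show "finite q" unfolding q_def using cond_finite[OF p] by simp
    show "Field q \<subseteq> T" using s(1) cond_T[OF p] by (simp add: F)
  next
    fix x assume "x \<in> Field q" then show "(x, x) \<in> q" using F cond_refl[OF p] q by blast
  next
    fix x y z assume "(x, y) \<in> q" "(y, z) \<in> q"
    then show "(x, z) \<in> q" unfolding q using no cond_trans[OF p] by blast
  next
    fix x y assume "(x, y) \<in> q" "x \<noteq> y"
    then show "fst x \<in> below (fst y)" unfolding q using cond_level[OF p] up by blast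
  next
    fix u x y assume a: "(u, x) \<in> q" "(u, y) \<in> q" "fst x = fst y" "fst x \<in> below m"
    show "x = y"
    proof (cases "u = s")
      case True
      then show ?thesis using a no up[of x] up[of y] below_irrefl cond_bone1[OF p, of t x y] unfolding q by metis
    next
      case False
      then show ?thesis using a cond_bone1[OF p] unfolding q by blast
    qed
  next
    fix x y g assume a: "(y, x) \<in> q" "y \<noteq> x" "fst x \<in> below m" "below (fst x) = insert g (below g)"
    show "\<exists>z. fst z = g \<and> (y, z) \<in> q \<and> (z, x) \<in> q"
    proof (cases "y = s")
      case True
      then have tx: "(t, x) \<in> p" using a(1,2) no unfolding q by blast
      show ?thesis
      proof (cases "x = t")
        case True
        then show ?thesis using suc a(3,4) tt \<open>y = s\<close> unfolding q by blast
      next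
        case False
        then show ?thesis using cond_bone2[OF p tx _ a(3,4)] \<open>y = s\<close> unfolding q by blast
      qed
    next
      case False
      then show ?thesis using a cond_bone2[OF p] unfolding q by blast
    qed
  next
    fix u x y assume a: "(u, x) \<in> q" "(u, y) \<in> q" "x \<noteq> y" "fst x = m" "fst y = m"
    show "fst u \<in> below (F (snd x) (snd y))"
    proof (cases "u = s")
      case True
      \<comment> \<open>Since \<open>s\<close> is not on the top level, \<open>t\<close> is below
        both top elements, and its bound passes to the lower level of \<open>s\<close>.\<close>
      then have "(t, x) \<in> p" "(t, y) \<in> p" using a no sm unfolding q by blast+
      then show ?thesis using cond_F[OF p _ _ a(3,4,5)] s(3) below_trans True by blast
    next
      case False
      then show ?thesis using a cond_F[OF p] unfolding q by blast
    qed
  qed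
  show "ext q p"
    unfolding ext_def
  proof (intro conjI ballI allI impI)
    fix x y u assume a: "x \<in> Field p" "y \<in> Field p" "x \<noteq> y" "(u, x) \<in> q" "(u, y) \<in> q"
    show "\<exists>v. (u, v) \<in> q \<and> (v, x) \<in> p \<and> (v, y) \<in> p"
    proof (cases "u = s")
      case True
      then have "(t, x) \<in> p" "(t, y) \<in> p" using a no s(2) unfolding q by blast+
      then show ?thesis using True \<open>(s, t) \<in> q\<close> by blast
    next
      case False
      then have "(u, x) \<in> p" "(u, y) \<in> p" using a unfolding q by blast+
      then show ?thesis using cond_refl[OF p FieldI1] unfolding q by blast
    qed
  qed (use q s(2) in auto)
qed

lemma fresh_element:
  assumes "cond p" "a \<in> below m"
  obtains s where "s \<in> T" "fst s = a" "s \<notin> Field p"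
proof -
  have "infinite ((\<lambda>b. (a, b)) ` below w)"
    using infinite_w by (simp add: finite_image_iff inj_on_def)
  then have "\<not> (\<lambda>b. (a, b)) ` below w \<subseteq> Field p"
    using cond_finite_Field[OF assms(1)] finite_subset by blast
  then obtain b where "b \<in> below w" "(a, b) \<notin> Field p" by blast
  then show thesis using that[of "(a, b)"] assms(2) by (simp add: T_def)
qed

lemma pred_unique: "below a = insert g (below g) \<Longrightarrow> below a = insert g' (below g') \<Longrightarrow> g = g'"
  using below_trans below_irrefl by (metis insertE insertI1)

lemma extend_below:
  assumes "cond p" "t \<in> Field p" "a \<in> below (fst t)"
  shows "\<exists>q s. cond q \<and> ext q p \<and> fst s = a \<and> s \<notin> Field p \<and> (s, t) \<in> q"
proof -
  have "\<forall>p t. cond p \<longrightarrow> t \<in> Field p \<longrightarrow> fst t = b \<longrightarrow> a \<in> below b \<longrightarrow>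
      (\<exists>q s. cond q \<and> ext q p \<and> fst s = a \<and> s \<notin> Field p \<and> (s, t) \<in> q)" for b
  proof (induction b rule: below_induct)
    case (1 b)
    show ?case
    proof (intro allI impI)
      fix p t assume p: "cond p" and t: "t \<in> Field p" and tb: "fst t = b" and ab: "a \<in> below b"
      have lt_m: "c \<in> below m" if "c \<in> below b" for c
        using that T_fst[OF cond_Field[OF p t]] tb below_trans by blast
      show "\<exists>q s. cond q \<and> ext q p \<and> fst s = a \<and> s \<notin> Field p \<and> (s, t) \<in> q"
      \<comment> \<open>In the first case the level of \<open>t\<close> is the successor of
        \<open>g\<close>, and \<open>a\<close> lies below \<open>g\<close>. The second bone
        condition demands an element on level \<open>g\<close> in between, which then takes over the
        role of \<open>t\<close>.\<close>
      proof (cases "\<exists>g. b \<in> below m \<and> below b = insert g (below g) \<and> g \<noteq> a")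
        case True
        then obtain g where g: "below b = insert g (below g)" "g \<noteq> a" by blast
        then have gb: "g \<in> below b" and ag: "a \<in> below g" using ab by auto
        obtain s' where s': "s' \<in> T" "fst s' = g" "s' \<notin> Field p"
          by (rule fresh_element[OF p lt_m[OF gb]])
        define q1 where "q1 = p \<union> {s'} \<times> insert s' (p `` {t})"
        have q1: "cond q1" "ext q1 p" "(s', t) \<in> q1"
          unfolding q1_def
          by (rule add_below[OF p t s'(1,3)]; use s'(2) gb tb pred_unique[OF _ g(1)] in simp)+
        obtain q s where q: "cond q" "ext q q1" "fst s = a" "s \<notin> Field q1" "(s, s') \<in> q"
          using 1[OF gb] q1(1) FieldI1[OF q1(3)] s'(2) ag by blast
        have "(s', t) \<in> q" using q1(3) q(2) by (auto simp: ext_def)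
        then have "(s, t) \<in> q" using cond_trans[OF q(1,5)] by blast
        moreover have "s \<notin> Field p" using q(4) ext_Field[OF q1(2)] by blast
        ultimately show ?thesis using q(1,3) ext_trans[OF q(1,2) q1(2)] by blast
      next
        case False
        obtain s where s: "s \<in> T" "fst s = a" "s \<notin> Field p"
          by (rule fresh_element[OF p lt_m[OF ab]])
        have st: "fst s \<in> below (fst t)" using s(2) ab tb by simp
        have suc: "g = fst s" if "fst t \<in> below m" "below (fst t) = insert g (below g)" for g
          using False that s(2) tb by blast
        show ?thesis using add_below[OF p t s(1,3) st suc] s(2,3) by blast
      qed
    qed
  qed
  then show ?thesis using assms by blast
qed

end

section \<open>Amalgamation of two conditions\<close>

context skeleton_conditions
begin

text \<open>The ordinal \<open>d\<close> separates: shared elements sit on top or on levels up to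
  \<open>d\<close>, unshared ones above \<open>d\<close>. The clause on equal levels is there for
  the first bone condition, which a shared element below unshared ones of both conditions might
  otherwise violate.\<close>

definition amalgamable :: "'a \<Rightarrow> ('a \<times> 'a) rel \<Rightarrow> ('a \<times> 'a) rel \<Rightarrow> bool" where
  "amalgamable d p q \<longleftrightarrow> cond p \<and> cond q \<and>
    (\<forall>x\<in>Field p. \<forall>y\<in>Field p. x \<in> Field q \<longrightarrow> y \<in> Field q \<longrightarrow> (x, y) \<in> p \<longleftrightarrow> (x, y) \<in> q) \<and>
    (\<forall>t\<in>Field p. t \<in> Field q \<longrightarrow> fst t = m \<or> fst t \<in> insert d (below d)) \<and>
    (\<forall>t\<in>Field p. t \<notin> Field q \<longrightarrow> fst t \<notin> insert d (below d)) \<and>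
    (\<forall>t\<in>Field q. t \<notin> Field p \<longrightarrow> fst t \<notin> insert d (below d)) \<and>
    (\<forall>s\<in>Field p. \<forall>t\<in>Field q. s \<notin> Field q \<longrightarrow> t \<notin> Field p \<longrightarrow> fst s = fst t \<longrightarrow> fst s = m) \<and>
    (\<forall>x\<in>Field p. \<forall>y\<in>Field p. x \<in> Field q \<longrightarrow> y \<in> Field q \<longrightarrow> x \<noteq> y \<longrightarrow> fst x = m \<longrightarrow> fst y = m \<longrightarrow>
      F (snd x) (snd y) \<in> insert d (below d)) \<and>
    (\<forall>x\<in>Field p. \<forall>y\<in>Field q. x \<notin> Field q \<longrightarrow> y \<notin> Field p \<longrightarrow> fst x = m \<longrightarrow> fst y = m \<longrightarrow>
      d \<in> below (F (snd x) (snd y)))"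

lemmas am_cond1 = amalgamable_def[THEN iffD1, THEN conjunct1]
lemmas am_cond2 = amalgamable_def[THEN iffD1, THEN conjunct2, THEN conjunct1]
lemmas am_agree = amalgamable_def[THEN iffD1, THEN conjunct2, THEN conjunct2, THEN conjunct1, rule_format]
lemmas am_low = amalgamable_def[THEN iffD1, THEN conjunct2, THEN conjunct2, THEN conjunct2, THEN conjunct1, rule_format]
lemmas am_high = amalgamable_def[THEN iffD1, THEN conjunct2, THEN conjunct2, THEN conjunct2, THEN conjunct2, THEN conjunct1, rule_format]
lemmas am_high2 = amalgamable_def[THEN iffD1, THEN conjunct2, THEN conjunct2, THEN conjunct2, THEN conjunct2, THEN conjunct2, THEN conjunct1, rule_format]
lemmas am_disjoint = amalgamable_def[THEN iffD1, THEN conjunct2, THEN conjunct2, THEN conjunct2, THEN conjunct2, THEN conjunct2, THEN conjunct2, THEN conjunct1, rule_format]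
lemmas am_F_low = amalgamable_def[THEN iffD1, THEN conjunct2, THEN conjunct2, THEN conjunct2, THEN conjunct2, THEN conjunct2, THEN conjunct2, THEN conjunct2, THEN conjunct1, rule_format]
lemmas am_F_high = amalgamable_def[THEN iffD1, THEN conjunct2, THEN conjunct2, THEN conjunct2, THEN conjunct2, THEN conjunct2, THEN conjunct2, THEN conjunct2, THEN conjunct2, rule_format]

lemma amalgamable_sym:
  assumes a: "amalgamable d p q" shows "amalgamable d q p"
  unfolding amalgamable_def
proof (intro conjI ballI impI)
  fix s t assume st: "s \<in> Field q" "t \<in> Field p" "s \<notin> Field p" "t \<notin> Field q" "fst s = fst t"
  show "fst s = m" using am_disjoint[OF a st(2,1,4,3)] st(5) by simp
next
  fix x y assume xy: "x \<in> Field q" "y \<in> Field p" "x \<notin> Field p" "y \<notin> Field q" "fst x = m" "fst y = m"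
  show "d \<in> below (F (snd x) (snd y))" using am_F_high[OF a xy(2,1,4,3,6,5)] by (simp add: F_sym)
qed (use am_cond1[OF a] am_cond2[OF a] am_agree[OF a] am_low[OF a] am_high[OF a] am_high2[OF a] am_F_low[OF a] in blast)+

text \<open>The union is already transitive. In a chain \<open>x\<close>, \<open>y\<close>,
  \<open>z\<close> passing from one condition to the other, either \<open>z\<close> is shared, or
  \<open>y\<close> is shared and not on top; then \<open>x\<close> is shared too, as no unshared
  element lies below such a \<open>y\<close>.\<close>

lemma amalgam:
  assumes am: "amalgamable d p q"
  shows "cond (p \<union> q)" "ext (p \<union> q) p"
proof -
  note qp = amalgamable_sym[OF am]
  have below_d: "a \<in> below d" if "a \<in> below b" "b \<in> insert d (below d)" for a b
    using that below_trans by blast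
  \<comment> \<open>An unshared element has its level above \<open>d\<close>, so shared elements
    over it can only be on top. The facts \<open>up\<close>, \<open>tr\<close>, \<open>bone\<close>
    and \<open>Fb\<close> are stated for arbitrary \<open>p'\<close> and \<open>q'\<close> in order
    to be used with the roles exchanged.\<close>
  have up: "fst v = m" if "amalgamable d p' q'" "(u, v) \<in> p'" "u \<notin> Field q'" "v \<in> Field q'" for u v p' q'
  proof (rule ccontr)
    assume "fst v \<noteq> m"
    then have "fst v \<in> insert d (below d)" using am_low[OF that(1) FieldI2[OF that(2)] that(4)] by simp
    moreover have "fst u \<in> below (fst v)"
      using cond_level[OF am_cond1[OF that(1)] that(2)] that(3,4) by blast
    ultimately have "fst u \<in> below d" using below_d by blast
    then show False using am_high[OF that(1) FieldI1[OF that(2)] that(3)] by blast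
  qed
  have Fpq: "Field (p \<union> q) = Field p \<union> Field q" by (auto simp: Field_def)
  have old: "(x, y) \<in> p" if "(x, y) \<in> p \<union> q" "x \<in> Field p" "y \<in> Field p" for x y
    using that am_agree[OF am, of x y] FieldI1 FieldI2 by fast
  have tr: "(x, z) \<in> p' \<union> q'" if a: "amalgamable d p' q'" and xy: "(x, y) \<in> p'" and yz: "(y, z) \<in> q'" for x y z p' q'
  proof (cases "z \<in> Field p'")
    case True
    have "(y, z) \<in> p'" using am_agree[OF a FieldI2[OF xy] True FieldI1[OF yz] FieldI2[OF yz]] yz by blast
    then show ?thesis using cond_trans[OF am_cond1[OF a] xy] by blast
  next
    case False
    have q': "cond q'" by (rule am_cond1[OF amalgamable_sym[OF a]])
    have "fst y \<noteq> m" using cond_top[OF q' yz] False FieldI2[OF xy] by blast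
    then have "x \<in> Field q'" using up[OF a xy _ FieldI1[OF yz]] by blast
    then have "(x, y) \<in> q'" using am_agree[OF a FieldI1[OF xy] FieldI2[OF xy] _ FieldI1[OF yz]] xy by blast
    then show ?thesis using cond_trans[OF q' _ yz] by blast
  qed
  have bone: "x = y" if a: "amalgamable d p' q'" and ux: "(u, x) \<in> p'" and uy: "(u, y) \<in> q'"
    and eq: "fst x = fst y" "fst x \<in> below m" for u x y p' q'
  proof -
    have q': "cond q'" and p': "cond p'" by (rule am_cond1[OF amalgamable_sym[OF a]], rule am_cond1[OF a])
    note u = FieldI1[OF ux] FieldI1[OF uy]
    consider "x \<in> Field q'" | "y \<in> Field p'" | "x \<notin> Field q'" "y \<notin> Field p'" by blast
    then show ?thesis
    proof cases
      case 1
      then have "(u, x) \<in> q'" using am_agree[OF a u(1) FieldI2[OF ux] u(2)] ux by blast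
      then show ?thesis using cond_bone1[OF q' _ uy eq] by blast
    next
      case 2
      then have "(u, y) \<in> p'" using am_agree[OF a u(1) _ u(2) FieldI2[OF uy]] uy by blast
      then show ?thesis using cond_bone1[OF p' ux _ eq] by blast
    next
      case 3
      then have "fst x = m" using am_disjoint[OF a FieldI2[OF ux] FieldI2[OF uy] _ _ eq(1)] by blast
      then show ?thesis using eq(2) below_irrefl by simp
    qed
  qed
  have Fb: "fst u \<in> below (F (snd x) (snd y))" if a: "amalgamable d p' q'" and ux: "(u, x) \<in> p'" and uy: "(u, y) \<in> q'"
    and ne: "x \<noteq> y" "fst x = m" "fst y = m" for u x y p' q'
  proof -
    have q': "cond q'" and p': "cond p'" by (rule am_cond1[OF amalgamable_sym[OF a]], rule am_cond1[OF a])
    note u = FieldI1[OF ux] FieldI1[OF uy]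
    consider "x \<in> Field q'" | "y \<in> Field p'" | "x \<notin> Field q'" "y \<notin> Field p'" by blast
    then show ?thesis
    proof cases
      case 1
      then have "(u, x) \<in> q'" using am_agree[OF a u(1) FieldI2[OF ux] u(2)] ux by blast
      then show ?thesis using cond_F[OF q' _ uy ne] by blast
    next
      case 2
      then have "(u, y) \<in> p'" using am_agree[OF a u(1) _ u(2) FieldI2[OF uy]] uy by blast
      then show ?thesis using cond_F[OF p' ux _ ne] by blast
    next
      case 3
      \<comment> \<open>\<open>u\<close> is shared and, with the unshared \<open>x\<close> above it,
        not on top; so its level is at most \<open>d\<close>, which the value of \<open>F\<close> on
        a mixed pair exceeds.\<close>
      have "fst u \<noteq> m" using cond_top[OF p' ux] u(2) 3(1) by blast
      then have "fst u \<in> insert d (below d)" using am_low[OF a u] by blast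
      moreover have "d \<in> below (F (snd x) (snd y))"
        using am_F_high[OF a FieldI2[OF ux] FieldI2[OF uy] 3 ne(2,3)] .
      ultimately show ?thesis using below_trans by blast
    qed
  qed
  have cp: "cond p" and cq: "cond q" using am_cond1[OF am] am_cond1[OF qp] .
  show "cond (p \<union> q)"
  proof (rule condI)
    show "finite (p \<union> q)" using cond_finite[OF cp] cond_finite[OF cq] by simp
    show "Field (p \<union> q) \<subseteq> T" using cond_T[OF cp] cond_T[OF cq] by (simp add: Fpq)
  next
    fix x assume "x \<in> Field (p \<union> q)"
    then show "(x, x) \<in> p \<union> q" using cond_refl[OF cp] cond_refl[OF cq] Fpq by blast
  next
    fix x y z assume "(x, y) \<in> p \<union> q" "(y, z) \<in> p \<union> q"
    then show "(x, z) \<in> p \<union> q"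
      using cond_trans[OF cp] cond_trans[OF cq] tr[OF am] tr[OF qp] by blast
  next
    fix x y assume "(x, y) \<in> p \<union> q" "x \<noteq> y"
    then show "fst x \<in> below (fst y)" using cond_level[OF cp] cond_level[OF cq] by blast
  next
    fix u x y assume a: "(u, x) \<in> p \<union> q" "(u, y) \<in> p \<union> q" "fst x = fst y" "fst x \<in> below m"
    have "fst y \<in> below m" "fst y = fst x" using a(3,4) by simp_all
    then show "x = y"
      using a cond_bone1[OF cp] cond_bone1[OF cq] bone[OF am] bone[OF qp] by blast
  next
    fix x y g assume "(y, x) \<in> p \<union> q" "y \<noteq> x" "fst x \<in> below m" "below (fst x) = insert g (below g)"
    then show "\<exists>z. fst z = g \<and> (y, z) \<in> p \<union> q \<and> (z, x) \<in> p \<union> q"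
      using cond_bone2[OF cp] cond_bone2[OF cq] by blast
  next
    fix u x y assume a: "(u, x) \<in> p \<union> q" "(u, y) \<in> p \<union> q" "x \<noteq> y" "fst x = m" "fst y = m"
    show "fst u \<in> below (F (snd x) (snd y))"
      using a(1,2) cond_F[OF cp _ _ a(3-5)] cond_F[OF cq _ _ a(3-5)] Fb[OF am _ _ a(3-5)] Fb[OF qp _ _ a(3-5)]
      by blast
  qed
  show "ext (p \<union> q) p"
  proof (rule extI)
    fix x y u assume xy: "x \<in> Field p" "y \<in> Field p" "x \<noteq> y" and u: "(u, x) \<in> p \<union> q" "(u, y) \<in> p \<union> q"
    \<comment> \<open>An unshared \<open>u\<close> forces both \<open>x\<close> and \<open>y\<close>
      onto the top level; being shared, they have \<open>F\<close> at most \<open>d\<close>, which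
      pushes \<open>u\<close> below \<open>d\<close>, where unshared elements do not occur.\<close>
    have "u \<in> Field p"
    proof (rule ccontr)
      assume n: "u \<notin> Field p"
      then have uq: "(u, x) \<in> q" "(u, y) \<in> q" using u FieldI1 by fast+
      have xm: "fst x = m" "fst y = m" using up[OF qp uq(1) n xy(1)] up[OF qp uq(2) n xy(2)] .
      have "fst u \<in> below (F (snd x) (snd y))" by (rule cond_F[OF cq uq xy(3) xm])
      moreover have "F (snd x) (snd y) \<in> insert d (below d)"
        by (rule am_F_low[OF am xy(1,2) FieldI2[OF uq(1)] FieldI2[OF uq(2)] xy(3) xm])
      ultimately have "fst u \<in> below d" using below_d by blast
      then show False using am_high[OF qp FieldI1[OF uq(1)] n] by blast
    qed
    then have "(u, x) \<in> p" "(u, y) \<in> p" using old u xy by blast+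
    then show "\<exists>v. (u, v) \<in> p \<union> q \<and> (v, x) \<in> p \<and> (v, y) \<in> p"
      using cond_refl[OF cp \<open>u \<in> Field p\<close>] by blast
  qed (use old in blast)+
qed

section \<open>The countable chain condition\<close>

lemma finite_bound:
  assumes "finite D" "D \<subseteq> below m"
  shows "\<exists>d\<in>below m. D \<subseteq> insert d (below d)"
  using assms
proof (induction D rule: finite_induct)
  case empty
  have "below m \<noteq> {}" using uncountable_m by force
  then show ?case by blast
next
  case (insert x D)
  then obtain d where d: "d \<in> below m" "D \<subseteq> insert d (below d)" by blast
  show ?case
  proof (cases "x \<in> insert d (below d)")
    case True
    then show ?thesis using d by blast
  next
    case False
    then have "d \<in> below x" using below_total[of x d] d(1) insert.prems below_Field by blast
    then have "D \<subseteq> below x" using d(2) below_trans by blast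
    then show ?thesis using insert.prems by (intro bexI[of _ x]) auto
  qed
qed

text \<open>The families \<open>J1\<close> to \<open>J5\<close> fix in turn the root of the fields,
  the root of the level sets, the order on the root, the place of the new countable levels, and the
  number of new top elements.\<close>

lemma conditions_ccc:
  assumes A: "uncountable A" "\<And>p. p \<in> A \<Longrightarrow> cond p"
  shows "\<exists>p\<in>A. \<exists>q\<in>A. p \<noteq> q \<and> (\<exists>r. cond r \<and> ext r p \<and> ext r q)"
proof -
  obtain J1 R where J1: "J1 \<subseteq> A" "uncountable J1"
    and R: "\<And>p q. p \<in> J1 \<Longrightarrow> q \<in> J1 \<Longrightarrow> p \<noteq> q \<Longrightarrow> Field p \<inter> Field q = R"
    by (rule delta_system[OF A(1), of Field]) (use A(2) cond_finite_Field in blast)+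
  obtain J2 L where J2: "J2 \<subseteq> J1" "uncountable J2"
    and L: "\<And>p q. p \<in> J2 \<Longrightarrow> q \<in> J2 \<Longrightarrow> p \<noteq> q \<Longrightarrow> fst ` Field p \<inter> fst ` Field q = L"
    by (rule delta_system[OF J1(2), of "\<lambda>p. fst ` Field p"]) (use J1(1) A(2) cond_finite_Field in blast)+
  obtain p0 q0 where pq0: "p0 \<in> J2" "q0 \<in> J2" "p0 \<noteq> q0" by (rule uncountable_two[OF J2(2)])
  have p0: "cond p0" using pq0(1) J2(1) J1(1) A(2) by blast
  have Rp0: "R \<subseteq> Field p0" and Lp0: "L \<subseteq> fst ` Field p0" using R[of p0 q0] L[of p0 q0] pq0 J2(1) by blast+
  have finR: "finite R" and finL: "finite L"
    using finite_subset[OF Rp0] finite_subset[OF Lp0] cond_finite_Field[OF p0] by blast+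
  have RL: "fst t \<in> L" if "t \<in> R" for t
    using R[of p0 q0] L[of p0 q0] pq0 J2(1) that by blast
  \<comment> \<open>A finite root carries only finitely many relations, so uncountably many
    conditions agree on it.\<close>
  have "(\<lambda>p. p \<inter> R \<times> R) ` J2 \<subseteq> Pow (R \<times> R)" by blast
  moreover have "finite (Pow (R \<times> R))" using finR by simp
  ultimately have "countable ((\<lambda>p. p \<inter> R \<times> R) ` J2)"
    using finite_subset countable_finite by blast
  then obtain Q where "uncountable {p \<in> J2. p \<inter> R \<times> R = Q}"
    by (rule uncountable_pigeonhole[OF J2(2)])
  then obtain J3 where J3: "J3 \<subseteq> J2" "uncountable J3" and Q: "\<And>p. p \<in> J3 \<Longrightarrow> p \<inter> R \<times> R = Q"
    by (metis (mono_tags, lifting) mem_Collect_eq subsetI)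
  \<comment> \<open>Everything that has to stay at or below \<open>d\<close>: the countable levels
    occurring in more than one condition, and the values of \<open>F\<close> on pairs of top
    elements of the root.\<close>
  define D where "D = (L - {m}) \<union>
    {F (snd x) (snd y) |x y. x \<in> R \<and> y \<in> R \<and> fst x = m \<and> fst y = m \<and> x \<noteq> y}"
  have "finite {F (snd x) (snd y) |x y. x \<in> R \<and> y \<in> R \<and> fst x = m \<and> fst y = m \<and> x \<noteq> y}"
    by (rule finite_subset[of _ "(\<lambda>z. F (snd (fst z)) (snd (snd z))) ` (R \<times> R)"])
       (use finR in force)+
  then have "finite D" using finL by (simp add: D_def)
  moreover have "D \<subseteq> below m"
  proof -
    have "a \<in> below m" if "a \<in> L" "a \<noteq> m" for a
      using that Lp0 cond_T[OF p0] T_fst by blast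
    moreover have "F (snd x) (snd y) \<in> below m"
      if "x \<in> R" "y \<in> R" "fst x = m" "fst y = m" "x \<noteq> y" for x y
    proof (rule F_below)
      have "x \<in> T" "y \<in> T" using that(1,2) Rp0 cond_T[OF p0] by blast+
      then show "snd x \<in> Field lam" "snd y \<in> Field lam"
        using that(3,4) by (auto simp: T_def below_irrefl)
      show "snd x \<noteq> snd y" using that(3-5) by (simp add: prod_eq_iff)
    qed
    ultimately show ?thesis unfolding D_def by blast
  qed
  ultimately obtain d where d: "d \<in> below m" "D \<subseteq> insert d (below d)"
    using finite_bound by blast
  \<comment> \<open>All elements on levels up to \<open>d\<close>, countably many since both these
    levels and their width are countable. An element outside the root belongs to at most one
    condition, so discarding the conditions with a new element in \<open>N\<close> costs only
    countably many.\<close>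
  define N where "N = insert d (below d) \<times> below w"
  have "countable N"
    unfolding N_def using countable_below_m[OF d(1)] countable_w by simp
  have dm: "m \<notin> insert d (below d)" using d(1) below_trans below_irrefl by blast
  define J4 where "J4 = {p \<in> J3. (Field p - R) \<inter> N = {}}"
  have "countable (J3 - J4)"
  proof -
    have "countable {p \<in> J3. t \<in> Field p}" if "t \<notin> R" for t
    proof (cases "\<exists>p\<in>J3. t \<in> Field p")
      case True
      then obtain p where p: "p \<in> J3" "t \<in> Field p" by blast
      have "q = p" if q: "q \<in> J3" "t \<in> Field q" for q
      proof (rule ccontr)
        assume "q \<noteq> p"
        then have "Field q \<inter> Field p = R" using q(1) p(1) J3(1) J2(1) by (intro R) auto
        then show False using q(2) p(2) \<open>t \<notin> R\<close> by blast
      qed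
      then have "{p \<in> J3. t \<in> Field p} \<subseteq> {p}" by (intro subsetI) simp
      then show ?thesis by (rule countable_subset) simp
    next
      case False
      then have "{p \<in> J3. t \<in> Field p} = {}" by blast
      then show ?thesis by (metis countable_empty)
    qed
    then have "countable (\<Union>t\<in>N - R. {p \<in> J3. t \<in> Field p})"
      using \<open>countable N\<close> by (intro countable_UN) auto
    moreover have "J3 - J4 \<subseteq> (\<Union>t\<in>N - R. {p \<in> J3. t \<in> Field p})"
      unfolding J4_def by blast
    ultimately show ?thesis using countable_subset by blast
  qed
  then have J4: "uncountable J4"
    using J3(2) countable_Un[of "J3 - J4" J4] countable_subset[of J3 "J3 - J4 \<union> J4"] by blast
  \<comment> \<open>Strong unboundedness speaks of sets of one fixed finite size, hence the last
    thinning by \<open>card\<close>.\<close>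
  define top where "top p = {x. (m, x) \<in> Field p - R}" for p
  obtain n where "uncountable {p \<in> J4. card (top p) = n}"
    by (rule uncountable_pigeonhole[OF J4, of "\<lambda>p. card (top p)"]) (simp, rule that)
  then obtain J5 where J5: "J5 \<subseteq> J4" "uncountable J5" and n: "\<And>p. p \<in> J5 \<Longrightarrow> card (top p) = n"
    by (metis (mono_tags, lifting) mem_Collect_eq subsetI)
  have J5A: "p \<in> A \<and> p \<in> J1 \<and> p \<in> J2 \<and> p \<in> J3 \<and> p \<in> J4 \<and> cond p" if "p \<in> J5" for p
    using that J5(1) J3(1) J2(1) J1(1) A(2) unfolding J4_def by blast
  have top_fin: "finite (top p)" and top_sub: "top p \<subseteq> Field lam" if "p \<in> J5" for p
  proof -
    have p: "cond p" using J5A[OF that] by blast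
    have "top p \<subseteq> snd ` Field p" unfolding top_def by force
    then show "finite (top p)" using cond_finite_Field[OF p] finite_subset by blast
    show "top p \<subseteq> Field lam"
      using cond_T[OF p] below_irrefl unfolding top_def T_def by force
  qed
  have top_disj: "disjnt (top p) (top q)" if "p \<in> J5" "q \<in> J5" "p \<noteq> q" for p q
    using R[of p q] J5A[OF that(1)] J5A[OF that(2)] that(3) unfolding top_def disjnt_def by blast
  \<comment> \<open>Without new top elements the sets \<open>top p\<close> are all empty and form no
    uncountable family, but then any two conditions will do. Otherwise disjointness makes
    \<open>top\<close> injective.\<close>
  obtain p q where pq: "p \<in> J5" "q \<in> J5" "p \<noteq> q" and un: "\<forall>x\<in>top p. \<forall>y\<in>top q. d \<in> below (F x y)"
  proof (cases "n = 0")
    case True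
    obtain p q where pq: "p \<in> J5" "q \<in> J5" "p \<noteq> q" by (rule uncountable_two[OF J5(2)])
    have "top p = {}" using n[OF pq(1)] True top_fin[OF pq(1)] by simp
    then show thesis using that[OF pq] by simp
  next
    case False
    have ne: "top p \<noteq> {}" if "p \<in> J5" for p using n[OF that] False by force
    have "inj_on top J5"
    proof (rule inj_onI, rule ccontr)
      fix p q assume "p \<in> J5" "q \<in> J5" "top p = top q" "p \<noteq> q"
      then show False using top_disj[of p q] ne[of p] by (simp add: disjnt_def)
    qed
    then have "uncountable (top ` J5)" using J5(2) countable_image_inj_on by blast
    moreover have "pairwise disjnt (top ` J5)" using top_disj unfolding pairwise_def by blast
    ultimately have "\<exists>a\<in>top ` J5. \<exists>b\<in>top ` J5. a \<noteq> b \<and> (\<forall>x\<in>a. \<forall>y\<in>b. d \<in> below (F x y))"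
      by (rule F_unbounded[OF d(1), where n = n]) (use top_fin top_sub n in blast)
    then obtain p q where "p \<in> J5" "q \<in> J5" "top p \<noteq> top q" "\<forall>x\<in>top p. \<forall>y\<in>top q. d \<in> below (F x y)"
      by blast
    then show thesis using that[of p q] by blast
  qed
  note p = J5A[OF pq(1)] and q = J5A[OF pq(2)]
  have Rpq: "Field p \<inter> Field q = R" using R p q pq(3) by blast
  have Lpq: "fst ` Field p \<inter> fst ` Field q = L" using L p q pq(3) by blast
  have low: "a = m \<or> a \<in> insert d (below d)" if "a \<in> L" for a using that d(2) by (auto simp: D_def)
  have high: "fst t \<notin> insert d (below d)" if "r \<in> J5" "t \<in> Field r" "t \<notin> R" for r t
  proof
    assume td: "fst t \<in> insert d (below d)"
    have "t \<in> T" using that(2) J5A[OF that(1)] cond_T by blast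
    then have "snd t \<in> below w" using td dm by (auto simp: T_def)
    then have "t \<in> N" using td by (simp add: N_def mem_Times_iff)
    then show False using that(2,3) J5A[OF that(1)] unfolding J4_def by blast
  qed
  have "amalgamable d p q"
    unfolding amalgamable_def
  proof (intro conjI ballI impI)
    show "cond p" "cond q" using p q by blast+
  next
    fix x y assume "x \<in> Field p" "y \<in> Field p" "x \<in> Field q" "y \<in> Field q"
    then have "x \<in> R" "y \<in> R" using Rpq by blast+
    then show "(x, y) \<in> p \<longleftrightarrow> (x, y) \<in> q" using Q[of p] Q[of q] p q by blast
  next
    fix t assume "t \<in> Field p" "t \<in> Field q"
    then show "fst t = m \<or> fst t \<in> insert d (below d)" using RL low Rpq by blast
  next
    fix t assume "t \<in> Field p" "t \<notin> Field q"
    then show "fst t \<notin> insert d (below d)" using high[OF pq(1)] Rpq by blast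
  next
    fix t assume "t \<in> Field q" "t \<notin> Field p"
    then show "fst t \<notin> insert d (below d)" using high[OF pq(2)] Rpq by blast
  next
    fix s t assume st: "s \<in> Field p" "t \<in> Field q" "s \<notin> Field q" "t \<notin> Field p" "fst s = fst t"
    \<comment> \<open>A level carrying new elements of both conditions belongs to \<open>L\<close>,
      thus is \<open>m\<close> or at most \<open>d\<close>, and new elements avoid the levels up to
      \<open>d\<close>.\<close>
    have "fst s \<in> fst ` Field p" "fst s \<in> fst ` Field q" using st by (auto intro: rev_image_eqI)
    then have "fst s \<in> L" using Lpq by blast
    moreover have "fst s \<notin> insert d (below d)"
      using high[OF pq(1), of s] st Rpq by blast
    ultimately show "fst s = m" using low by blast
  next
    fix x y assume "x \<in> Field p" "y \<in> Field p" "x \<in> Field q" "y \<in> Field q"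
      and "x \<noteq> y" "fst x = m" "fst y = m"
    then have "F (snd x) (snd y) \<in> D" unfolding D_def using Rpq by blast
    then show "F (snd x) (snd y) \<in> insert d (below d)" using d(2) by blast
  next
    fix x y assume xy: "x \<in> Field p" "y \<in> Field q" "x \<notin> Field q" "y \<notin> Field p" "fst x = m" "fst y = m"
    have "(m, snd x) = x" "(m, snd y) = y" using xy by (simp_all add: prod_eq_iff)
    then have "snd x \<in> top p" "snd y \<in> top q" using xy Rpq unfolding top_def by auto
    then show "d \<in> below (F (snd x) (snd y))" using un by blast
  qed
  note am = this
  have "cond (p \<union> q)" "ext (p \<union> q) p" "ext (p \<union> q) q"
    using amalgam[OF am] amalgam(2)[OF amalgamable_sym[OF am]] by (simp_all add: Un_commute)
  then show ?thesis using p q pq(3) by blast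
qed

end

section \<open>Coding the conditions\<close>

lemma countable_iff_natLeq: "countable A \<longleftrightarrow> |A| \<le>o natLeq"
proof -
  have "countable A \<longleftrightarrow> |A| \<le>o |UNIV :: nat set|"
    unfolding countable_def card_of_ordLeq[symmetric] by simp
  then show ?thesis
    using card_of_nat ordLeq_ordIso_trans ordIso_symmetric by blast
qed

text \<open>Bounds the number of conditions, so that they can be coded. A set of size
  \<open>Suc n\<close> arises by inserting an element into one of size \<open>n\<close>, and an
  infinite cardinal absorbs the product.\<close>

lemma card_of_finite_subsets:
  assumes "infinite A"
  shows "|{X. X \<subseteq> A \<and> finite X}| \<le>o |A|"
proof -
  have n: "|{X. X \<subseteq> A \<and> finite X \<and> card X = n}| \<le>o |A|" for n
  proof (induction n)
    case 0
    have "{X. X \<subseteq> A \<and> finite X \<and> card X = 0} = {{}}" by auto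
    then show ?case using assms card_of_singl_ordLeq by (metis finite.emptyI)
  next
    case (Suc n)
    let ?S = "{X. X \<subseteq> A \<and> finite X \<and> card X = n}"
    have "{X. X \<subseteq> A \<and> finite X \<and> card X = Suc n} \<subseteq> (\<lambda>(a, X). insert a X) ` (A \<times> ?S)"
    proof
      fix X assume "X \<in> {X. X \<subseteq> A \<and> finite X \<and> card X = Suc n}"
      then have X: "X \<subseteq> A" "finite X" "card X = Suc n" by auto
      then obtain a Y where "X = insert a Y" "a \<notin> Y" "card Y = n" by (metis card_Suc_eq)
      then show "X \<in> (\<lambda>(a, X). insert a X) ` (A \<times> ?S)"
        using X by (intro image_eqI[of _ _ "(a, Y)"]) auto
    qed
    then have "|{X. X \<subseteq> A \<and> finite X \<and> card X = Suc n}| \<le>o |A \<times> ?S|"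
      by (rule surj_imp_ordLeq)
    also have "|A \<times> ?S| \<le>o |A|"
      using assms Suc by (intro card_of_Times_ordLeq_infinite_Field)
        (auto simp: Field_card_of card_of_card_order_on intro: ordIso_imp_ordLeq card_of_refl)
    finally show ?case .
  qed
  have "|\<Union>n\<in>(UNIV :: nat set). {X. X \<subseteq> A \<and> finite X \<and> card X = n}| \<le>o |A|"
    using assms n infinite_iff_card_of_nat
    by (intro card_of_UNION_ordLeq_infinite) auto
  moreover have "(\<Union>n\<in>(UNIV :: nat set). {X. X \<subseteq> A \<and> finite X \<and> card X = n}) = {X. X \<subseteq> A \<and> finite X}"
    by auto
  ultimately show ?thesis by simp
qed

text \<open>Locates omega and omega1 inside \<open>lam\<close>, as the elements \<open>w\<close> and
  \<open>m\<close>.\<close>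

lemma initial_segment_iso:
  assumes "Well_order lam" "r <o lam"
  obtains a f where "a \<in> Field lam" "bij_betw f (Field r) (underS lam a)"
    "\<And>x y. x \<in> Field r \<Longrightarrow> y \<in> Field r \<Longrightarrow> (x, y) \<in> r \<longleftrightarrow> (f x, f y) \<in> lam"
proof -
  have "Well_order r" using assms(2) by (auto simp: ordLess_def)
  then obtain a where a: "a \<in> Field lam" "r =o Restr lam (underS lam a)"
    using ordLess_iff_ordIso_Restr[OF assms(1)] assms(2) by blast
  then obtain f where f: "iso r (Restr lam (underS lam a)) f" by (auto simp: ordIso_def)
  have "Refl lam" using assms(1) by (simp add: well_order_on_def linear_order_on_def partial_order_on_def preorder_on_def)
  then have "Field (Restr lam (underS lam a)) = underS lam a"
    by (rule Refl_Field_Restr2) (auto simp: underS_def Field_def)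
  then have b: "bij_betw f (Field r) (underS lam a)"
    and i: "\<forall>x\<in>Field r. \<forall>y\<in>Field r. (x, y) \<in> r \<longleftrightarrow> (f x, f y) \<in> Restr lam (underS lam a)"
    using f by (simp_all add: iso_iff2)
  have "(x, y) \<in> r \<longleftrightarrow> (f x, f y) \<in> lam" if "x \<in> Field r" "y \<in> Field r" for x y
    using i that bij_betwE[OF b] by simp
  then show thesis using that[OF a(1) b] by blast
qed

text \<open>The successor of \<open>a\<close> is the least element above it, found by descending
  from \<open>b\<close>.\<close>

lemma (in initial_segments) successor_exists:
  assumes "a \<in> below b"
  shows "\<exists>c\<in>Field lam. below c = insert a (below a)"
  using assms
proof (induction b rule: below_induct)
  case (1 b)
  show ?case
  proof (cases "\<exists>c\<in>below b. a \<in> below c")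
    case True
    then show ?thesis using 1(1) by blast
  next
    case False
    have "c \<in> insert a (below a)" if "c \<in> below b" for c
      using below_total[of a c] below_Field[OF 1(2)] below_Field[OF that] False that by blast
    moreover have "insert a (below a) \<subseteq> below b" using 1(2) below_trans by blast
    ultimately have "below b = insert a (below a)" by blast
    then show ?thesis using below_Field(2)[OF 1(2)] by blast
  qed
qed

text \<open>The forcing notion is to be a relation on the element type of \<open>lam\<close>, while
  conditions are finite relations on pairs; an injection on the conditions moves their order
  over.\<close>

locale coded_conditions = skeleton_conditions lam w m F
  for lam :: "'a rel" and w m :: 'a and F :: "'a \<Rightarrow> 'a \<Rightarrow> 'a" +
  fixes code :: "('a \<times> 'a) rel \<Rightarrow> 'p"
  assumes inj_code: "inj_on code (Collect cond)"
begin

definition P :: "'p rel" where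
  "P = {(code q, code p) |p q. cond p \<and> cond q \<and> ext q p}"

definition decode :: "'p \<Rightarrow> ('a \<times> 'a) rel" where
  "decode = inv_into (Collect cond) code"

lemma decode_code: "cond p \<Longrightarrow> decode (code p) = p"
  unfolding decode_def by (rule inv_into_f_f[OF inj_code]) simp

lemma P_iff: "cond p \<Longrightarrow> cond q \<Longrightarrow> (code q, code p) \<in> P \<longleftrightarrow> ext q p"
  unfolding P_def using decode_code by (auto; metis)

lemma Field_P: "Field P = code ` Collect cond"
  unfolding P_def Field_def using ext_refl by blast

lemma P_D: "(y, x) \<in> P \<Longrightarrow> cond (decode x) \<and> cond (decode y) \<and> ext (decode y) (decode x)"
  unfolding P_def using decode_code by auto

lemma Field_P_D: "x \<in> Field P \<Longrightarrow> cond (decode x) \<and> code (decode x) = x"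
  unfolding Field_P using decode_code by auto

lemma P_extend: "x \<in> Field P \<Longrightarrow> cond q \<Longrightarrow> ext q (decode x) \<Longrightarrow> (code q, x) \<in> P"
  using P_iff[of "decode x" q] Field_P_D[of x] by simp

lemma P_partial_order: "Partial_order P"
  unfolding partial_order_on_def preorder_on_def refl_on_def trans_def antisym_def
proof (intro conjI ballI allI impI)
  show "(x, x) \<in> P" if "x \<in> Field P" for x
    using P_extend[OF that] Field_P_D[OF that] ext_refl by metis
  show "(x, z) \<in> P" if "(x, y) \<in> P" "(y, z) \<in> P" for x y z
    using P_D[OF that(1)] P_D[OF that(2)] ext_trans[of "decode x" "decode y" "decode z"]
      P_extend[OF FieldI2[OF that(2)]] Field_P_D[OF FieldI1[OF that(1)]] by metis
  show "x = y" if "(x, y) \<in> P" "(y, x) \<in> P" for x y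
    using P_D[OF that(1)] P_D[OF that(2)] ext_antisym Field_P_D[OF FieldI1[OF that(1)]]
      Field_P_D[OF FieldI2[OF that(1)]] by metis
qed (auto simp: Field_def)

lemma P_ccc: "ccc P"
  unfolding ccc_def
proof (intro allI impI, rule ccontr)
  fix A assume A: "A \<subseteq> Field P" and inc: "pairwise (\<lambda>p q. \<not> compatible P p q) A" and unc: "uncountable A"
  have "inj_on decode A"
    by (rule inj_onI) (use A Field_P_D in \<open>metis subsetD\<close>)
  then have "uncountable (decode ` A)" using unc countable_image_inj_on by blast
  moreover have "cond p" if "p \<in> decode ` A" for p using that A Field_P_D by blast
  ultimately have "\<exists>p\<in>decode ` A. \<exists>q\<in>decode ` A. p \<noteq> q \<and> (\<exists>r. cond r \<and> ext r p \<and> ext r q)"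
    by (rule conditions_ccc)
  then obtain x y r where xy: "x \<in> A" "y \<in> A" "decode x \<noteq> decode y" and r: "cond r"
    "ext r (decode x)" "ext r (decode y)" by blast
  have "x \<noteq> y" using xy(3) by blast
  have "(code r, x) \<in> P" "(code r, y) \<in> P"
    using P_extend r A xy(1,2) by blast+
  then have "compatible P x y" unfolding compatible_def by blast
  then show False using inc xy(1,2) \<open>x \<noteq> y\<close> unfolding pairwise_def by blast
qed

text \<open>Discharges the interface: \<open>decode\<close> plays the part of \<open>le\<close>, and
  the two density facts come from \<open>add_isolated\<close> and
  \<open>extend_below\<close>.\<close>

lemma P_generic:
  assumes "infinite (UNIV :: 'i set)" "|UNIV :: 'a set| \<le>o |UNIV :: 'i set|"
    "|Field P| \<le>o |UNIV :: 'i set|"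
    "w \<in> Field lam" "below w = range e" "\<And>n. below (e n) = e ` {..<n}"
    "m1 \<in> Field lam" "below m1 = insert m (below m)" "\<And>a. a \<in> Field lam \<Longrightarrow> |below a| <o |Field lam|"
  shows "generic_skeleton TYPE('i) P lam w e m m1 decode T"
proof
  fix x assume x: "x \<in> Field P"
  note c = conjunct1[OF Field_P_D[OF x]]
  show "Field (decode x) \<subseteq> T" "finite (decode x)" "Partial_order (decode x)"
    by (rule cond_T[OF c], rule cond_finite[OF c], rule cond_partial_order[OF c])
  show "fst s \<in> below (fst t)" if "(s, t) \<in> decode x" "s \<noteq> t" for s t
    by (rule cond_level[OF c that])
  show "s = t" if "(u, s) \<in> decode x" "(u, t) \<in> decode x" "fst s = fst t" "fst s \<in> below m" for u s t
    by (rule cond_bone1[OF c that])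
  show "\<exists>z. fst z = g \<and> (s, z) \<in> decode x \<and> (z, t) \<in> decode x"
    if "(s, t) \<in> decode x" "s \<noteq> t" "fst t \<in> below m" "below (fst t) = insert g (below g)" for s t g
    by (rule cond_bone2[OF c that])
  show "\<exists>y. (y, x) \<in> P \<and> t \<in> Field (decode y)" if t: "t \<in> T" for t
  proof (cases "t \<in> Field (decode x)")
    case True
    then show ?thesis using x P_partial_order
      unfolding partial_order_on_def preorder_on_def refl_on_def by blast
  next
    case False
    note a = add_isolated[OF c t False]
    show ?thesis using P_extend[OF x a(1,2)] a(3) decode_code[OF a(1)] by metis
  qed
  show "\<exists>y s. (y, x) \<in> P \<and> fst s = a \<and> s \<notin> Field (decode x) \<and> (s, t) \<in> decode y"
    if t: "t \<in> Field (decode x)" "a \<in> below (fst t)" for t a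
  proof -
    obtain q s where q: "cond q" "ext q (decode x)" "fst s = a" "s \<notin> Field (decode x)" "(s, t) \<in> q"
      using extend_below[OF c t] by blast
    show ?thesis
      using P_extend[OF x q(1,2)] q(3-5) decode_code[OF q(1)] by metis
  qed
next
  fix x y assume yx: "(y, x) \<in> P"
  note e = conjunct2[OF conjunct2[OF P_D[OF yx]]]
  show "decode x \<subseteq> decode y" using ext_sub[OF e] by blast
  show "(s, t) \<in> decode x" if "s \<in> Field (decode x)" "t \<in> Field (decode x)" "(s, t) \<in> decode y" for s t
    by (rule ext_restrict[OF e that])
  show "\<exists>v. (u, v) \<in> decode y \<and> (v, s) \<in> decode x \<and> (v, t) \<in> decode x"
    if "s \<in> Field (decode x)" "t \<in> Field (decode x)" "s \<noteq> t" "(u, s) \<in> decode y" "(u, t) \<in> decode y" for s t u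
    by (rule ext_meet[OF e that])
qed (use assms P_partial_order P_ccc uncountable_m countable_below_m T_def in simp_all)

end

theorem theorem9:
  fixes lam :: "'a rel"
  assumes "Card_order lam" and "omega3 \<le>o lam"
    and "\<exists>F. strongly_unbounded lam F"
    and "|UNIV :: 'a set| \<le>o |UNIV :: 'i set|"
  shows "\<exists>P :: 'a rel. forcing_notion P \<and> ccc P \<and>
    (\<forall>p \<in> Field P.
       forces P (fm_omega1_skeleton_exists (check_ordinal P lam :: ('i, 'a) name)) p)"
proof -
  obtain F0 where F0: "strongly_unbounded lam F0" using assms(3) by blast
  have wo: "Well_order lam" using assms(1) by (simp add: card_order_on_def)
  have co1: "Card_order omega1" by (rule cardSuc_Card_order[OF natLeq_Card_order])
  have "omega1 <o omega3"
    by (rule ordLess_transitive[OF cardSuc_greater[OF co1] cardSuc_greater[OF cardSuc_Card_order[OF co1]]])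
  then have o1_lam: "omega1 <o lam" using assms(2) by (rule ordLess_ordLeq_trans)
  have nat_o1: "natLeq <o omega1" by (rule cardSuc_greater[OF natLeq_Card_order])
  have nat_lam: "natLeq <o lam" using ordLess_transitive[OF nat_o1 o1_lam] .
  have lam_iso: "|Field lam| =o lam" by (rule card_of_Field_ordIso[OF assms(1)])
  have "natLeq \<le>o |Field lam|"
    by (rule ordLeq_ordIso_trans[OF ordLess_imp_ordLeq[OF nat_lam] ordIso_symmetric[OF lam_iso]])
  then have inf_lam: "infinite (Field lam)"
    using infinite_iff_natLeq_ordLeq[of "Field lam"] by simp
  interpret initial_segments lam by unfold_locales (rule wo)
  obtain w e where w: "w \<in> Field lam" and e: "bij_betw e (Field natLeq) (below w)"
    and e_iso: "\<And>i j. i \<in> Field natLeq \<Longrightarrow> j \<in> Field natLeq \<Longrightarrow> (i, j) \<in> natLeq \<longleftrightarrow> (e i, e j) \<in> lam"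
    using initial_segment_iso[OF wo nat_lam] by metis
  obtain m f where m: "m \<in> Field lam" and f: "bij_betw f (Field omega1) (below m)"
    and f_iso: "\<And>x y. x \<in> Field omega1 \<Longrightarrow> y \<in> Field omega1 \<Longrightarrow> (x, y) \<in> omega1 \<longleftrightarrow> (f x, f y) \<in> lam"
    using initial_segment_iso[OF wo o1_lam] by metis
  have range_e: "below w = range e" using e by (simp add: bij_betw_def Field_natLeq)
  \<comment> \<open>General in \<open>r\<close>, to serve both \<open>e\<close>, defined on the
    natural numbers, and \<open>f\<close>, defined on omega1.\<close>
  have below_iso: "below (h x) = h ` underS r x"
    if h: "bij_betw h (Field r) (below a)" and "x \<in> Field r"
      and iso: "\<And>x y. x \<in> Field r \<Longrightarrow> y \<in> Field r \<Longrightarrow> (x, y) \<in> r \<longleftrightarrow> (h x, h y) \<in> lam"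
    for h :: "'c \<Rightarrow> 'a" and r a x
  proof (intro set_eqI iffI)
    fix b assume b: "b \<in> below (h x)"
    have hx: "h x \<in> below a" using bij_betwE[OF h] that(2) by blast
    have "b \<in> below a" using below_trans[OF b hx] .
    then obtain y where y: "y \<in> Field r" "b = h y" using h unfolding bij_betw_def by blast
    then have "(y, x) \<in> r" "y \<noteq> x" using b iso[OF y(1) that(2)] by (auto simp: underS_def)
    then show "b \<in> h ` underS r x" using y(2) by (auto simp: underS_def)
  next
    fix b assume "b \<in> h ` underS r x"
    then obtain y where y: "(y, x) \<in> r" "y \<noteq> x" "b = h y" by (auto simp: underS_def)
    have yF: "y \<in> Field r" using y(1) by (rule FieldI1)
    have "h y \<noteq> h x" using h y(2) yF that(2) by (auto simp: bij_betw_def inj_on_def)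
    then show "b \<in> below (h x)" using iso[OF yF that(2)] y by (simp add: underS_def)
  qed
  have below_e: "below (e n) = e ` {..<n}" for n
    using below_iso[OF e _ e_iso, of n] by (simp add: Field_natLeq natLeq_underS_less lessThan_def)
  have inf_w: "infinite (below w)"
    using bij_betw_finite[OF e] by (simp add: Field_natLeq)
  have unc_m: "uncountable (below m)"
  proof
    assume "countable (below m)"
    then have "countable (Field omega1)" using f by simp
    then have "|Field omega1| \<le>o natLeq" by (simp add: countable_iff_natLeq)
    then have "omega1 \<le>o natLeq"
      by (rule ordIso_ordLeq_trans[OF ordIso_symmetric[OF card_of_Field_ordIso[OF co1]]])
    then show False using nat_o1 not_ordLess_ordLeq by blast
  qed
  have count_m: "countable (below a)" if a: "a \<in> below m" for a
  proof -
    obtain x where x: "x \<in> Field omega1" "a = f x" using a f unfolding bij_betw_def by blast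
    have "|underS omega1 x| <o omega1" by (rule card_of_underS[OF co1 x(1)])
    then have "|underS omega1 x| \<le>o natLeq"
      by (rule cardSuc_ordLeq_ordLess[OF natLeq_Card_order card_of_Card_order, THEN iffD1])
    then have "countable (f ` underS omega1 x)" by (simp add: countable_iff_natLeq[symmetric])
    then show ?thesis using below_iso[OF f x(1) f_iso] x(2) by simp
  qed
  \<comment> \<open>An infinite cardinal has no last element, so \<open>m\<close> has a successor in
    \<open>lam\<close>.\<close>
  obtain b where "m \<in> below b"
    using infinite_Card_order_limit[OF assms(1) inf_lam m] by (auto simp: underS_def)
  then obtain m1 where m1: "m1 \<in> Field lam" "below m1 = insert m (below m)"
    using successor_exists by blast
  have card_below: "|below a| <o |Field lam|" if "a \<in> Field lam" for a
    by (rule ordLess_ordIso_trans[OF card_of_underS[OF assms(1) that] ordIso_symmetric[OF lam_iso]])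
  \<comment> \<open>The values in \<open>omega1\<close> are carried by \<open>f\<close> to its copy
    below \<open>m\<close>.\<close>
  define F where "F x y = f (F0 {x, y})" for x y
  have F_sym: "F x y = F y x" for x y by (simp add: F_def insert_commute)
  have F0_o1: "F0 {x, y} \<in> Field omega1" if "x \<in> Field lam" "y \<in> Field lam" "x \<noteq> y" for x y
    using F0 that unfolding strongly_unbounded_def nsets_def by (auto simp: image_subset_iff)
  have F_below: "F x y \<in> below m" if "x \<in> Field lam" "y \<in> Field lam" "x \<noteq> y" for x y
    unfolding F_def using bij_betwE[OF f] F0_o1[OF that] by blast
  have F_unbounded: "\<exists>a\<in>A. \<exists>b\<in>A. a \<noteq> b \<and> (\<forall>x\<in>a. \<forall>y\<in>b. d \<in> below (F x y))"
    if d: "d \<in> below m" and unc: "uncountable A" and disj: "pairwise disjnt A"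
      and A: "\<And>a. a \<in> A \<Longrightarrow> a \<subseteq> Field lam \<and> finite a \<and> card a = n" for d n and A :: "'a set set"
  proof -
    obtain d' where d': "d' \<in> Field omega1" "d = f d'" using d f unfolding bij_betw_def by blast
    have "natLeq <o |A|"
      using unc not_ordLeq_iff_ordLess[OF natLeq_Well_order card_of_Well_order, of A]
      unfolding countable_iff_natLeq by simp
    then have "omega1 \<le>o |A|"
      by (rule cardSuc_least[OF natLeq_Card_order card_of_Card_order])
    then have "|Field omega1| \<le>o |A|"
      by (rule ordIso_ordLeq_trans[OF card_of_Field_ordIso[OF co1]])
    \<comment> \<open>The hypothesis concerns families of size exactly omega1, so \<open>A\<close>
      is cut down to such a subfamily.\<close>
    then obtain B where B: "B \<subseteq> A" "|Field omega1| =o |B|"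
      using internalize_card_of_ordLeq2 by metis
    have "|B| =o omega1"
      by (rule ordIso_transitive[OF ordIso_symmetric[OF B(2)] card_of_Field_ordIso[OF co1]])
    moreover have "B \<subseteq> nsets (Field lam) n" using A B(1) by (auto simp: nsets_def)
    moreover have "pairwise disjnt B" using disj B(1) by (rule pairwise_subset)
    ultimately obtain a b where ab: "a \<in> B" "b \<in> B" "a \<noteq> b"
      "\<forall>x\<in>a. \<forall>y\<in>b. (d', F0 {x, y}) \<in> omega1 \<and> d' \<noteq> F0 {x, y}"
      using F0 d'(1) unfolding strongly_unbounded_def by meson
    have "d \<in> below (F x y)" if xy: "x \<in> a" "y \<in> b" for x y
    proof -
      have o: "F0 {x, y} \<in> Field omega1" using ab(4) xy FieldI2 by fast
      have "d' \<in> underS omega1 (F0 {x, y})" using ab(4) xy by (simp add: underS_def)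
      then have "f d' \<in> f ` underS omega1 (F0 {x, y})" by (rule imageI)
      then show ?thesis using below_iso[OF f o f_iso] by (simp add: F_def d'(2))
    qed
    then show ?thesis using ab(1-3) B(1) by blast
  qed
  interpret skeleton_conditions lam w m F
    by unfold_locales
      (use m unc_m count_m inf_w F_sym F_below F_unbounded range_e in \<open>simp_all add: countable_image\<close>)
  \<comment> \<open>A condition is a finite subset of this set, which has the size of
    lambda.\<close>
  let ?Z = "(Field lam \<times> Field lam) \<times> (Field lam \<times> Field lam)"
  have Z: "infinite ?Z" "|?Z| \<le>o |Field lam|"
  proof -
    have "Field lam \<noteq> {}" using w by blast
    then show "infinite ?Z" using inf_lam by (auto simp: finite_cartesian_product_iff)
    have 1: "|Field lam \<times> Field lam| =o |Field lam|" by (rule card_of_Times_same_infinite[OF inf_lam])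
    have 2: "|?Z| =o |Field lam \<times> Field lam|"
      by (rule card_of_Times_same_infinite) (use inf_lam in \<open>auto simp: finite_cartesian_product_iff\<close>)
    show "|?Z| \<le>o |Field lam|" by (rule ordIso_imp_ordLeq[OF ordIso_transitive[OF 2 1]])
  qed
  have T_lam: "T \<subseteq> Field lam \<times> Field lam"
    using m below_Field by (auto simp: T_def)
  have "Collect cond \<subseteq> {X. X \<subseteq> ?Z \<and> finite X}"
  proof
    fix p assume "p \<in> Collect cond"
    then have p: "cond p" by simp
    have "x \<in> T \<and> y \<in> T" if "(x, y) \<in> p" for x y
      using cond_Field[OF p FieldI1[OF that]] cond_Field[OF p FieldI2[OF that]] by blast
    then have "p \<subseteq> ?Z" using T_lam by (intro subrelI) blast
    then show "p \<in> {X. X \<subseteq> ?Z \<and> finite X}" using cond_finite[OF p] by simp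
  qed
  then have "|Collect cond| \<le>o |Field lam|"
    by (rule ordLeq_transitive[OF card_of_mono1 ordLeq_transitive[OF card_of_finite_subsets[OF Z(1)] Z(2)]])
  then obtain code :: "('a \<times> 'a) rel \<Rightarrow> 'a" where "inj_on code (Collect cond)"
    using card_of_ordLeq by metis
  then interpret coded_conditions lam w m F code by unfold_locales
  have inf_a: "infinite (UNIV :: 'a set)" using inf_lam finite_subset[OF subset_UNIV] by metis
  have inf_i: "infinite (UNIV :: 'i set)" by (rule card_of_ordLeq_infinite[OF assms(4) inf_a])
  have "|Field P| \<le>o |UNIV :: 'i set|"
    by (rule ordLeq_transitive[OF card_of_mono1[OF subset_UNIV] assms(4)])
  then interpret generic_skeleton P "TYPE('i)" lam w e m m1 decode T
    by (intro P_generic inf_i assms(4) w range_e below_e m1 card_below)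
  have "forcing_notion P"
    unfolding forcing_notion_def using P_partial_order Field_P cond_empty by auto
  \<comment> \<open>Both sides unfold to the same term, as \<open>top_name\<close> collects the
    canonical names over the whole field of \<open>lam\<close>.\<close>
  moreover have "(check_ordinal P lam :: ('i, 'a) name) = top_name"
    unfolding check_ordinal_def top_name_def chk_def ordn_def ..
  ultimately show ?thesis
    using P_ccc omega1_skeleton_exists by (intro exI[of _ P]) simp
qed

end
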